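(* Let $\chi\subset\mathbb{R}^n$ be open, let $h:\mathbb{R}^n\to\mathbb{R}$ satisfy (Z1), (Z2)', (Z3) of the context, and let $\mu>0$. Suppose that $h$ is a stochastic zeroing control barrier function (stochastic ZCBF) for the system $$dX_t=\{f(X_t)+g(X_t)(u_o(X_t)+u(t))\}\,dt+\sigma(X_t)\,dW_t,\qquad X_0=x_0,$$ i.e. there exist a continuous mapping $\phi:\mathbb{R}^n\to\mathbb{R}^m$ and a constant $b>0$ such that $$\mathcal{L}_{f,g,\sigma}(\phi(x),u_o(x),h(x))\ge b\,H_\sigma(h(x))\qquad\text{for all }x\in\mathbb{R}^n\text{ with }h(x)\le\mu. \qquad( * )$$ Then the system with $u=\phi(X_t)$ is transiently safe in $(\chi_\mu,\chi,1-e^{-bh(x_0)})$. Moreover, if $( * )$ is satisfied for any $\mu>0$ (i.e. the inequality holds for all $x\in\mathbb{R}^n$), then the system with $u=\phi(X_t)$ is safe in $(\chi,\chi,1-e^{-bh(x_0)})$.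
   Context: System data: $f:\mathbb{R}^n\to\mathbb{R}^n$, $g:\mathbb{R}^n\to\mathbb{R}^{n\times m}$, $\sigma:\mathbb{R}^n\to\mathbb{R}^{n\times d}$ are locally Lipschitz, $u_o:\mathbb{R}^n\to\mathbb{R}^m$ is continuous, $W_t$ is a $d$-dimensional standard Wiener process on a filtered probability space, and the stochastic differential is in the Itô sense. For a feedback $u=\phi(x)$, $X_t$ denotes the maximal solution of the closed-loop system. $\mathbb{P}_{x_0}$ is probability conditioned on $X_0=x_0$. Operators: for a $C^2$ function $y$, let $(L_Fy)(x)=\left(\frac{\partial y}{\partial x}F_1(x),\ldots,\frac{\partial y}{\partial x}F_q(x)\right)$ (a row vector) for $F=(F_1,\ldots,F_q)$, and $$L^D_{f,g}(u,u_o(x),y(x))=(L_fy)(x)+(L_gy)(x)(u+u_o(x)),\qquad L^I_\sigma(y(x))=\tfrac12\mathrm{tr}\left[\sigma(x)\sigma(x)^T\,\nabla^2y(x)\right],$$ $$\mathcal{L}_{f,g,\sigma}(u,u_o(x),y(x))=L^D_{f,g}(u,u_o(x),y(x))+L^I_\sigma(y(x)),\qquad H_\sigma(h(x))=\tfrac12L_\sigma h(x)(L_\sigma h(x))^T.$$ Conditions on $h$ and $\chi$: (Z1) $h$ is $C^2$ (on $\mathbb{R}^n$). (Z2)' $h$ is proper in $\mathbb{R}^n$: for every $L\in\mathbb{R}$ the superlevel set $\{x\in\mathbb{R}^n\mid h(x)\ge L\}$ is compact. (Z3) $\chi=\{x\in\mathbb{R}^n\mid h(x)>0\}$ and $\partial\chi=\{x\in\mathbb{R}^n\mid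 h(x)=0\}$. Safety: $\chi_\mu:=\{x\in\mathbb{R}^n\mid 0<h(x)\le\mu\}$. For $x_0\in\chi_\mu$, $\tau_{0\mu}$ is the first exit time of $X_t$ from $\chi_\mu$; for $x_0\in\chi$, $\tau_0$ is the first exit time of $X_t$ from $\chi$. For $p\in[0,1]$ (possibly depending on $x_0$), the system is transiently safe in $(\chi_\mu,\chi,p)$ if for every $x_0\in\chi_\mu$ $$\mathbb{P}_{x_0}\left(\inf_{t\ge0}h(X_{t\wedge\tau_{0\mu}})>0\right)\ge p,$$ where $a\wedge b=\min(a,b)$. The system is safe in $(\chi,\chi,p)$ if for every $x_0\in\chi$ the same holds with $\tau_{0\mu}$ replaced by $\tau_0$, i.e. $\mathbb{P}_{x_0}\left(\inf_{t\ge0}h(X_{t\wedge\tau_0})>0\right)\ge p$. *)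

theory Defs
  imports "HOL-Probability.Probability"
begin

section \<open>Differential operators\<close>

definition grad :: "(real^'n \<Rightarrow> real) \<Rightarrow> real^'n \<Rightarrow> real^'n" where
  "grad y x = (\<chi> i. frechet_derivative y (at x) (axis i 1))"

definition hessian :: "(real^'n \<Rightarrow> real) \<Rightarrow> real^'n \<Rightarrow> real^'n^'n" where
  "hessian y x = jacobian (grad y) (at x)"

definition C2 :: "(real^'n \<Rightarrow> real) \<Rightarrow> bool" where
  "C2 y \<longleftrightarrow> (\<forall>x. y differentiable at x) \<and> (\<forall>x. grad y differentiable at x) \<and>
     continuous_on UNIV (hessian y)"

text \<open>\<open>lie_vec\<close> is $L_f y$ for a single vector field; \<open>lie_mat\<close> is the row vector $L_F y$ for
  the matrix-valued map $F = (F_1,\ldots,F_q)$ with columns $F_j$.\<close>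

definition lie_vec :: "(real^'n \<Rightarrow> real^'n) \<Rightarrow> (real^'n \<Rightarrow> real) \<Rightarrow> real^'n \<Rightarrow> real" where
  "lie_vec f y x = grad y x \<bullet> f x"

definition lie_mat :: "(real^'n \<Rightarrow> real^'q^'n) \<Rightarrow> (real^'n \<Rightarrow> real) \<Rightarrow> real^'n \<Rightarrow> real^'q" where
  "lie_mat F y x = grad y x v* F x"

definition LD :: "(real^'n \<Rightarrow> real^'n) \<Rightarrow> (real^'n \<Rightarrow> real^'m^'n) \<Rightarrow>
    real^'m \<Rightarrow> real^'m \<Rightarrow> (real^'n \<Rightarrow> real) \<Rightarrow> real^'n \<Rightarrow> real" where
  "LD f g u v y x = lie_vec f y x + lie_mat g y x \<bullet> (u + v)"

definition LI :: "(real^'n \<Rightarrow> real^'d^'n) \<Rightarrow> (real^'n \<Rightarrow> real) \<Rightarrow> real^'n \<Rightarrow> real" where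
  "LI \<sigma> y x = 1/2 * trace (\<sigma> x ** transpose (\<sigma> x) ** hessian y x)"

definition generator :: "(real^'n \<Rightarrow> real^'n) \<Rightarrow> (real^'n \<Rightarrow> real^'m^'n) \<Rightarrow> (real^'n \<Rightarrow> real^'d^'n) \<Rightarrow>
    real^'m \<Rightarrow> real^'m \<Rightarrow> (real^'n \<Rightarrow> real) \<Rightarrow> real^'n \<Rightarrow> real" where
  "generator f g \<sigma> u v y x = LD f g u v y x + LI \<sigma> y x"

definition H_op :: "(real^'n \<Rightarrow> real^'d^'n) \<Rightarrow> (real^'n \<Rightarrow> real) \<Rightarrow> real^'n \<Rightarrow> real" where
  "H_op \<sigma> h x = 1/2 * (lie_mat \<sigma> h x \<bullet> lie_mat \<sigma> h x)"

section \<open>Wiener processes\<close>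

text \<open>Filtrations are indexed by \<open>real\<close> in order to use the library notions; only nonnegative
  times matter (one may take \<open>F t = F 0\<close> for \<open>t < 0\<close>). Completeness and right-continuity of the
  filtration are not required.\<close>

locale filtered_prob_space = prob_space M + filtration "space M" F
  for M :: "'a measure" and F :: "real \<Rightarrow> 'a measure" +
  assumes sub: "\<And>t. subalgebra M (F t)"

locale wiener_process = filtered_prob_space M F
  for M :: "'a measure" and F :: "real \<Rightarrow> 'a measure" +
  fixes W :: "real \<Rightarrow> 'a \<Rightarrow> real^'d"
  assumes adapted: "\<And>t. 0 \<le> t \<Longrightarrow> W t \<in> borel_measurable (F t)"
    and start: "AE \<omega> in M. W 0 \<omega> = 0"
    and paths: "AE \<omega> in M. continuous_on {0..} (\<lambda>t. W t \<omega>)"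
    and incr_indep: "\<And>s t. 0 \<le> s \<Longrightarrow> s < t \<Longrightarrow>
      indep_set (sets (F s)) {(\<lambda>\<omega>. W t \<omega> - W s \<omega>) -` A \<inter> space M | A. A \<in> sets borel}"
    and comp_indep: "\<And>s t. 0 \<le> s \<Longrightarrow> s < t \<Longrightarrow>
      indep_vars (\<lambda>_. borel) (\<lambda>i \<omega>. (W t \<omega> - W s \<omega>) $ i) UNIV"
    and comp_normal: "\<And>s t i. 0 \<le> s \<Longrightarrow> s < t \<Longrightarrow>
      distributed M lborel (\<lambda>\<omega>. (W t \<omega> - W s \<omega>) $ i) (normal_density 0 (sqrt (t - s)))"

section \<open>The Ito integral\<close>

text \<open>A simple process is given by its number of steps \<open>N\<close>, its times \<open>t 0 \<le> \<dots> \<le> t N\<close> and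
  the bounded, \<open>F (t k)\<close>-measurable values \<open>\<xi> k\<close> taken on the interval \<open>{t k <.. t (k+1)}\<close>.\<close>

definition simple_process :: "(real \<Rightarrow> 'a measure) \<Rightarrow> nat \<Rightarrow> (nat \<Rightarrow> real) \<Rightarrow>
    (nat \<Rightarrow> 'a \<Rightarrow> real^'d^'n) \<Rightarrow> bool" where
  "simple_process F N t \<xi> \<longleftrightarrow> 0 \<le> t 0 \<and>
     (\<forall>k<N. t k \<le> t (Suc k) \<and> \<xi> k \<in> borel_measurable (F (t k)) \<and>
        (\<exists>C. \<forall>\<omega>\<in>space (F (t k)). norm (\<xi> k \<omega>) \<le> C))"

definition simple_value :: "nat \<Rightarrow> (nat \<Rightarrow> real) \<Rightarrow> (nat \<Rightarrow> 'a \<Rightarrow> real^'d^'n) \<Rightarrow>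
    real \<Rightarrow> 'a \<Rightarrow> real^'d^'n" where
  "simple_value N t \<xi> s \<omega> = (\<Sum>k<N. indicator {t k <.. t (Suc k)} s *\<^sub>R \<xi> k \<omega>)"

definition simple_integral_W :: "(real \<Rightarrow> 'a \<Rightarrow> real^'d) \<Rightarrow> nat \<Rightarrow> (nat \<Rightarrow> real) \<Rightarrow>
    (nat \<Rightarrow> 'a \<Rightarrow> real^'d^'n) \<Rightarrow> real \<Rightarrow> 'a \<Rightarrow> real^'n" where
  "simple_integral_W W N t \<xi> T \<omega> =
     (\<Sum>k<N. \<xi> k \<omega> *v (W (min T (t (Suc k))) \<omega> - W (min T (t k)) \<omega>))"

definition null_in_prob :: "'a measure \<Rightarrow> (nat \<Rightarrow> 'a \<Rightarrow> ennreal) \<Rightarrow> bool" where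
  "null_in_prob M Z \<longleftrightarrow>
     (\<forall>\<epsilon>>0::real. (\<lambda>j. measure M {\<omega>\<in>space M. Z j \<omega> > ennreal \<epsilon>}) \<longlonglongrightarrow> 0)"

definition progressive :: "(real \<Rightarrow> 'a measure) \<Rightarrow> (real \<Rightarrow> 'a \<Rightarrow> 'b::topological_space) \<Rightarrow> bool" where
  "progressive F H \<longleftrightarrow> (\<forall>t\<ge>0. (\<lambda>(s, \<omega>). H s \<omega>)
     \<in> borel_measurable (restrict_space borel {0..t} \<Otimes>\<^sub>M F t))"

text \<open>\<open>Y\<close> is a version of $\int_0^T H_s\,dW_s$. The integral is the limit in probability of the
  integrals of simple processes approximating \<open>H\<close> in $L^2([0,T])$ in probability; it is unique up
  to almost sure equality.\<close>

definition has_ito_integral :: "'a measure \<Rightarrow> (real \<Rightarrow> 'a measure) \<Rightarrow> (real \<Rightarrow> 'a \<Rightarrow> real^'d) \<Rightarrow>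
    (real \<Rightarrow> 'a \<Rightarrow> real^'d^'n) \<Rightarrow> real \<Rightarrow> ('a \<Rightarrow> real^'n) \<Rightarrow> bool" where
  "has_ito_integral M F W H T Y \<longleftrightarrow>
     progressive F H \<and>
     (AE \<omega> in M. (\<integral>\<^sup>+ s\<in>{0..T}. ennreal ((norm (H s \<omega>))\<^sup>2) \<partial>lborel) < \<infinity>) \<and>
     Y \<in> borel_measurable M \<and>
     (\<exists>N t \<xi>. (\<forall>j. simple_process F (N j) (t j) (\<xi> j)) \<and>
        null_in_prob M (\<lambda>j \<omega>. \<integral>\<^sup>+ s\<in>{0..T}.
           ennreal ((norm (simple_value (N j) (t j) (\<xi> j) s \<omega> - H s \<omega>))\<^sup>2) \<partial>lborel) \<and>
        null_in_prob M (\<lambda>j \<omega>.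
           ennreal (norm (simple_integral_W W (N j) (t j) (\<xi> j) T \<omega> - Y \<omega>))))"

section \<open>Maximal solutions of stochastic differential equations\<close>

text \<open>\<open>(X, \<zeta>)\<close> is a maximal solution of $dX_t = a(X_t)\,dt + \sigma(X_t)\,dW_t$, $X_0 = x_0$, with
  explosion time \<open>\<zeta>\<close>: a continuous adapted process on $[0,\zeta)$ that satisfies the integral
  equation up to every member of a sequence of stopping times announcing \<open>\<zeta>\<close>, and whose norm is
  unbounded near \<open>\<zeta>\<close> if \<open>\<zeta>\<close> is finite. The values \<open>X t \<omega>\<close> for \<open>t \<ge> \<zeta> \<omega>\<close> are irrelevant.
  As usual for continuous processes, the path properties are required for every \<open>\<omega>\<close> (rather than
  after discarding a null set), which makes the events below measurable without completing \<open>M\<close>.\<close>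

definition maximal_solution :: "'a measure \<Rightarrow> (real \<Rightarrow> 'a measure) \<Rightarrow> (real \<Rightarrow> 'a \<Rightarrow> real^'d) \<Rightarrow>
    (real^'n \<Rightarrow> real^'n) \<Rightarrow> (real^'n \<Rightarrow> real^'d^'n) \<Rightarrow> real^'n \<Rightarrow>
    (real \<Rightarrow> 'a \<Rightarrow> real^'n) \<Rightarrow> ('a \<Rightarrow> ereal) \<Rightarrow> bool" where
  "maximal_solution M F W a \<sigma> x0 X \<zeta> \<longleftrightarrow>
     (\<forall>t\<ge>0. Measurable.pred (F t) (\<lambda>\<omega>. \<zeta> \<omega> \<le> ereal t)) \<and>
     (\<forall>t\<ge>0. (\<lambda>\<omega>. if ereal t < \<zeta> \<omega> then X t \<omega> else 0) \<in> borel_measurable (F t)) \<and>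
     (\<forall>\<omega>\<in>space M. continuous_on {t. 0 \<le> t \<and> ereal t < \<zeta> \<omega>} (\<lambda>t. X t \<omega>)) \<and>
     (AE \<omega> in M. X 0 \<omega> = x0) \<and>
     (\<exists>\<tau> :: nat \<Rightarrow> 'a \<Rightarrow> real.
        (\<forall>k. stopping_time F (\<tau> k)) \<and>
        (\<forall>\<omega>\<in>space M. (\<forall>k. 0 \<le> \<tau> k \<omega> \<and> ereal (\<tau> k \<omega>) < \<zeta> \<omega>) \<and>
           incseq (\<lambda>k. \<tau> k \<omega>) \<and> (\<lambda>k. ereal (\<tau> k \<omega>)) \<longlonglongrightarrow> \<zeta> \<omega>) \<and>
        (\<forall>k. \<forall>t\<ge>0. \<exists>I.
           has_ito_integral M F W (\<lambda>s \<omega>. if s \<le> \<tau> k \<omega> then \<sigma> (X s \<omega>) else 0) t I \<and>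
           (AE \<omega> in M. X (min t (\<tau> k \<omega>)) \<omega> =
              x0 + integral {0..min t (\<tau> k \<omega>)} (\<lambda>s. a (X s \<omega>)) + I \<omega>))) \<and>
     (\<forall>\<omega>\<in>space M. \<zeta> \<omega> < \<infinity> \<longrightarrow>
        Limsup (at_left (real_of_ereal (\<zeta> \<omega>))) (\<lambda>t. ereal (norm (X t \<omega>))) = \<infinity>)"

definition closed_loop_drift :: "(real^'n \<Rightarrow> real^'n) \<Rightarrow> (real^'n \<Rightarrow> real^'m^'n) \<Rightarrow>
    (real^'n \<Rightarrow> real^'m) \<Rightarrow> (real^'n \<Rightarrow> real^'m) \<Rightarrow> real^'n \<Rightarrow> real^'n" where
  "closed_loop_drift f g u\<^sub>o \<phi> x = f x + g x *v (u\<^sub>o x + \<phi> x)"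

section \<open>Safety\<close>

definition exit_time :: "(real \<Rightarrow> 'a \<Rightarrow> real^'n) \<Rightarrow> ('a \<Rightarrow> ereal) \<Rightarrow> (real^'n) set \<Rightarrow> 'a \<Rightarrow> ereal" where
  "exit_time X \<zeta> A \<omega> = Inf {ereal t | t. 0 \<le> t \<and> ereal t < \<zeta> \<omega> \<and> X t \<omega> \<notin> A}"

text \<open>The infimum is taken in the extended reals, where it is always meaningful.\<close>

definition stopped_inf :: "(real^'n \<Rightarrow> real) \<Rightarrow> (real \<Rightarrow> 'a \<Rightarrow> real^'n) \<Rightarrow> ('a \<Rightarrow> ereal) \<Rightarrow> 'a \<Rightarrow> ereal" where
  "stopped_inf h X \<tau> \<omega> = (INF t\<in>{0..}. ereal (h (X (real_of_ereal (min (ereal t) (\<tau> \<omega>))) \<omega>)))"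

definition chi_mu :: "(real^'n \<Rightarrow> real) \<Rightarrow> real \<Rightarrow> (real^'n) set" where
  "chi_mu h \<mu> = {x. 0 < h x \<and> h x \<le> \<mu>}"

text \<open>Safety of the system $dX_t = a(X_t)\,dt + \sigma(X_t)\,dW_t$; the probability bound \<open>p\<close> is a
  function of the initial state. As the coefficients of a closed loop need not be Lipschitz, the
  bound is required of every maximal solution.\<close>

definition transiently_safe :: "'a measure \<Rightarrow> (real \<Rightarrow> 'a measure) \<Rightarrow> (real \<Rightarrow> 'a \<Rightarrow> real^'d) \<Rightarrow>
    (real^'n \<Rightarrow> real^'n) \<Rightarrow> (real^'n \<Rightarrow> real^'d^'n) \<Rightarrow> (real^'n \<Rightarrow> real) \<Rightarrow> real \<Rightarrow>
    (real^'n \<Rightarrow> real) \<Rightarrow> bool" where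
  "transiently_safe M F W a \<sigma> h \<mu> p \<longleftrightarrow>
     (\<forall>x0\<in>chi_mu h \<mu>. \<forall>X \<zeta>. maximal_solution M F W a \<sigma> x0 X \<zeta> \<longrightarrow>
        measure M {\<omega>\<in>space M. stopped_inf h X (exit_time X \<zeta> (chi_mu h \<mu>)) \<omega> > 0} \<ge> p x0)"

definition safe :: "'a measure \<Rightarrow> (real \<Rightarrow> 'a measure) \<Rightarrow> (real \<Rightarrow> 'a \<Rightarrow> real^'d) \<Rightarrow>
    (real^'n \<Rightarrow> real^'n) \<Rightarrow> (real^'n \<Rightarrow> real^'d^'n) \<Rightarrow> (real^'n \<Rightarrow> real) \<Rightarrow> (real^'n) set \<Rightarrow>
    (real^'n \<Rightarrow> real) \<Rightarrow> bool" where
  "safe M F W a \<sigma> h X0 p \<longleftrightarrow>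
     (\<forall>x0\<in>X0. \<forall>X \<zeta>. maximal_solution M F W a \<sigma> x0 X \<zeta> \<longrightarrow>
        measure M {\<omega>\<in>space M. stopped_inf h X (exit_time X \<zeta> X0) \<omega> > 0} \<ge> p x0)"

section \<open>Stochastic zeroing control barrier functions\<close>

text \<open>\<open>h\<close> is a stochastic ZCBF, as witnessed by the feedback \<open>\<phi>\<close> and the constant \<open>b\<close>.\<close>

definition stochastic_ZCBF_with :: "(real^'n \<Rightarrow> real^'n) \<Rightarrow> (real^'n \<Rightarrow> real^'m^'n) \<Rightarrow>
    (real^'n \<Rightarrow> real^'d^'n) \<Rightarrow> (real^'n \<Rightarrow> real^'m) \<Rightarrow> (real^'n \<Rightarrow> real) \<Rightarrow> real \<Rightarrow>
    (real^'n \<Rightarrow> real^'m) \<Rightarrow> real \<Rightarrow> bool" where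
  "stochastic_ZCBF_with f g \<sigma> u\<^sub>o h \<mu> \<phi> b \<longleftrightarrow> continuous_on UNIV \<phi> \<and> b > 0 \<and>
     (\<forall>x. h x \<le> \<mu> \<longrightarrow> generator f g \<sigma> (\<phi> x) (u\<^sub>o x) h x \<ge> b * H_op \<sigma> h x)"

end

theory Submission
  imports Defs
begin

text \<open>
  Where \<open>h \<ge> 0\<close>, the condition on the generator says that \<open>exp (- b * h)\<close> has nonpositive generator,
  so that along the stopped solution it is a supermartingale which starts at \<open>exp (- b * h x0)\<close>.
  Since it has to reach \<open>exp (- b * \<delta>)\<close> before \<open>h\<close> falls to \<open>\<delta>\<close>, this happens with
  probability at most \<open>exp (b * \<delta> - b * h x0)\<close>; finally \<open>\<delta>\<close> tends to \<open>0\<close>.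

  No Ito formula is used. A maximal inequality shows that the Ito integral of a left-continuous
  integrand is a limit in probability, uniformly on dyadic grid points, of its Riemann sums. On a
  fine grid the solution is therefore close to the sum \<open>Z\<close> of its Euler increments, killed at the
  first grid point outside the region \<open>\<delta> < h \<le> \<mu>\<close>. The increments of \<open>Z\<close> are bounded coefficients
  times independent Gaussian vectors, so a second-order Taylor expansion, step by step, bounds the
  expectation of a compactly supported \<open>C\<^sup>2\<close> function that agrees with \<open>exp (- b * h)\<close>
  where \<open>h \<ge> 0\<close>.
\<close>

section \<open>Moments of Wiener increments\<close>

text \<open>The integral equation is given only at fixed times, each with its own version of the Ito
  integral, and the filtration need be neither complete nor right-continuous. Observing the path on
  a grid copes with both: survival up to a grid point is decided by finitely many values of the
  path. Killing also confines the Euler coefficients to states where they are bounded and the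
  generator inequality is known, but the Euler sum itself has Gaussian steps and may land anywhere.
  So the test function needs globally bounded, uniformly continuous derivatives.
  \<open>exp (- b * h)\<close> can blow up where \<open>h\<close> is negative; compactness of the
  superlevel sets gives its cutoff below \<open>h = 0\<close> compact support. A Taylor remainder
  bounded by a small multiple of \<open>|w|^2\<close> plus a large multiple of \<open>|w|^4\<close>
  suffices, since a step of length \<delta> has fourth moment of order \<open>\<delta>^2\<close> and
  only about \<open>1/\<delta>\<close> steps fit into a bounded time. The mesh tends to 0 for a
  fixed horizon; then the horizon grows along with the stopping times that announce the
  explosion.\<close>

lemma matrix_norm_sq: "(norm (A::real^'d^'n))\<^sup>2 = trace (transpose A ** A)"
proof -
  have "(norm A)\<^sup>2 = (\<Sum>i\<in>UNIV. \<Sum>j\<in>UNIV. A$i$j * A$i$j)"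
    by (simp add: power2_norm_eq_inner inner_vec_def)
  also have "\<dots> = (\<Sum>j\<in>UNIV. \<Sum>i\<in>UNIV. A$i$j * A$i$j)" by (rule sum.swap)
  also have "\<dots> = trace (transpose A ** A)"
    by (simp add: trace_def matrix_matrix_mult_def transpose_def)
  finally show ?thesis .
qed

text \<open>Pulls a quadratic form in the displacement \<open>A *v w\<close> back to one in
  \<open>w\<close>, the shape whose expectation \<open>incr_quadratic\<close> computes.\<close>

lemma inner_matrix_quadratic:
  "((A::real^'d^'n) *v w) \<bullet> (Q *v (A *v w)) = w \<bullet> ((transpose A ** Q ** A) *v w)"
proof -
  have "w \<bullet> ((transpose A ** Q ** A) *v w) = w \<bullet> (transpose A *v (Q *v (A *v w)))"
    by (simp only: matrix_vector_mul_assoc matrix_mul_assoc)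
  also have "\<dots> = (A *v w) \<bullet> (Q *v (A *v w))"
    by (simp only: dot_lmul_matrix[symmetric] vector_transpose_matrix)
  finally show ?thesis by simp
qed

lemma measurable_matrix_vector_mult [measurable]:
  "(\<lambda>(A::real^'d^'n, x). A *v x) \<in> borel_measurable borel"
proof -
  have "continuous_on UNIV (\<lambda>p::(real^'d^'n) \<times> (real^'d). fst p *v snd p)"
    unfolding matrix_vector_mult_def by (intro continuous_intros)
  then show ?thesis by (intro borel_measurable_continuous_onI) (simp add: case_prod_unfold)
qed

lemma borel_measurable_vec_nth_intro [measurable (raw)]:
  "f \<in> borel_measurable N \<Longrightarrow> (\<lambda>x. (f x :: ('b::euclidean_space)^'i) $ i) \<in> borel_measurable N"
  by (rule borel_measurable_continuous_on[where f="\<lambda>x. x $ i"]) (auto intro!: continuous_intros)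

lemma measurable_matrix_vector_mult' [measurable (raw)]:
  assumes [measurable]: "A \<in> borel_measurable N" "x \<in> borel_measurable N"
  shows "(\<lambda>\<omega>. (A \<omega> ::real^'d^'n) *v x \<omega>) \<in> borel_measurable N"
  using measurable_compose[OF _ measurable_matrix_vector_mult, of "\<lambda>\<omega>. (A \<omega>, x \<omega>)" N]
  by (simp add: borel_prod[symmetric])

section \<open>Independence and Gaussian moments of the increments of \<open>W\<close>\<close>

context wiener_process
begin

lemma measurable_F_mono: "f \<in> borel_measurable (F s) \<Longrightarrow> s \<le> t \<Longrightarrow> f \<in> borel_measurable (F t)"
  using sets_F_mono[of s t] space_F unfolding measurable_def by auto

lemma measurable_F_M: "f \<in> borel_measurable (F s) \<Longrightarrow> f \<in> borel_measurable M"
  using sub[of s] unfolding subalgebra_def measurable_def by auto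

lemma pred_F_mono: "Measurable.pred (F s) P \<Longrightarrow> s \<le> t \<Longrightarrow> Measurable.pred (F t) P"
  using sets_F_mono[of s t] space_F unfolding pred_def by auto

lemma pred_F_M: "Measurable.pred (F s) P \<Longrightarrow> Measurable.pred M P"
  using sub[of s] unfolding subalgebra_def pred_def by auto

lemma W_measurable: "0 \<le> t \<Longrightarrow> W t \<in> borel_measurable M"
  using adapted measurable_F_M by blast

lemma bounded_F_integrable:
  fixes Y :: "'a \<Rightarrow> 'b::{banach,second_countable_topology}"
  assumes "Y \<in> borel_measurable (F r)" "\<And>\<omega>. \<omega> \<in> space M \<Longrightarrow> norm (Y \<omega>) \<le> K"
  shows "integrable M Y"
  using assms by (intro integrable_const_bound[where B=K]) (auto intro: measurable_F_M AE_I2)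

context
  fixes s t :: real
  assumes st: "0 \<le> s" "s < t"
begin

lemma incr_measurable [measurable]: "(\<lambda>\<omega>. W t \<omega> - W s \<omega>) \<in> borel_measurable M"
  using W_measurable[of s] W_measurable[of t] st by simp

text \<open>Both generated sigma-algebras sit inside the families that \<open>incr_indep\<close>
  declares independent: that of \<open>Y\<close> inside \<open>F s\<close>, that of the transformed
  increment inside the preimages under the increment.\<close>

lemma indep_var_incr:
  fixes Y :: "'a \<Rightarrow> real" and \<phi> :: "real^'d \<Rightarrow> real"
  assumes Y: "Y \<in> borel_measurable (F s)" and \<phi>: "\<phi> \<in> borel_measurable borel"
  shows "indep_var borel Y borel (\<lambda>\<omega>. \<phi> (W t \<omega> - W s \<omega>))"
  unfolding indep_var_eq
proof (intro conjI)
  let ?w = "\<lambda>\<omega>. W t \<omega> - W s \<omega>"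
  show "random_variable borel Y" using Y by (rule measurable_F_M)
  show "random_variable borel (\<lambda>\<omega>. \<phi> (?w \<omega>))" using \<phi> by measurable
  have 1: "sigma_sets (space M) {Y -` A \<inter> space M |A. A \<in> sets borel} \<subseteq> sets (F s)"
    using measurable_sets[OF Y] sets.sigma_sets_subset[of "{Y -` A \<inter> space M |A. A \<in> sets borel}" "F s"]
    by (auto simp: space_F)
  \<comment> \<open>The preimages of Borel sets already form a sigma-algebra, so the generated one
    cannot leave this family.\<close>
  have 2: "sets (vimage_algebra (space M) ?w borel) = {?w -` A \<inter> space M |A. A \<in> sets borel}"
    by (rule sets_vimage_algebra2) simp
  have 3: "sigma_sets (space M) {(\<lambda>\<omega>. \<phi> (?w \<omega>)) -` A \<inter> space M |A. A \<in> sets borel}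
     \<subseteq> {?w -` A \<inter> space M |A. A \<in> sets borel}"
    unfolding 2[symmetric]
  proof (rule sets.sigma_sets_subset[of _ "vimage_algebra (space M) ?w borel", simplified], unfold 2, safe)
    fix A :: "real set" assume "A \<in> sets borel"
    with \<phi> have "\<phi> -` A \<in> sets borel" using measurable_sets[of \<phi> borel borel A] by simp
    moreover have "(\<lambda>\<omega>. \<phi> (?w \<omega>)) -` A \<inter> space M = ?w -` (\<phi> -` A) \<inter> space M" by auto
    ultimately show "\<exists>Aa. (\<lambda>\<omega>. \<phi> (?w \<omega>)) -` A \<inter> space M = ?w -` Aa \<inter> space M \<and> Aa \<in> sets borel"
      by blast
  qed
  show "indep_set (sigma_sets (space M) {Y -` A \<inter> space M |A. A \<in> sets borel})
    (sigma_sets (space M) {(\<lambda>\<omega>. \<phi> (?w \<omega>)) -` A \<inter> space M |A. A \<in> sets borel})"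
    unfolding indep_set_def
    by (rule indep_sets_mono_sets[OF incr_indep[OF st, unfolded indep_set_def]])
       (use 1 3 in \<open>auto split: bool.splits\<close>)
qed

text \<open>Independence from the past enters all later moment computations through this
  factorisation, which stands in for conditional expectation given \<open>F s\<close>.\<close>

lemma expectation_incr_mult:
  fixes Y :: "'a \<Rightarrow> real" and \<phi> :: "real^'d \<Rightarrow> real"
  assumes Y: "Y \<in> borel_measurable (F s)" and \<phi>: "\<phi> \<in> borel_measurable borel"
    and "integrable M Y" "integrable M (\<lambda>\<omega>. \<phi> (W t \<omega> - W s \<omega>))"
  shows "integrable M (\<lambda>\<omega>. Y \<omega> * \<phi> (W t \<omega> - W s \<omega>))"
    and "(\<integral>\<omega>. Y \<omega> * \<phi> (W t \<omega> - W s \<omega>) \<partial>M) = expectation Y * expectation (\<lambda>\<omega>. \<phi> (W t \<omega> - W s \<omega>))"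
  using indep_var_integrable[OF indep_var_incr[OF Y \<phi>]] indep_var_lebesgue_integral[OF indep_var_incr[OF Y \<phi>]] assms
  by auto

lemma incr_moment:
  "integrable M (\<lambda>\<omega>. ((W t \<omega> - W s \<omega>) $ i) ^ k)"
  "expectation (\<lambda>\<omega>. ((W t \<omega> - W s \<omega>) $ i) ^ k) = (\<integral>x. normal_density 0 (sqrt (t - s)) x * x ^ k \<partial>lborel)"
  using distributed_integrable[OF comp_normal[OF st, of i], of "\<lambda>x. x ^ k"]
    distributed_integral[OF comp_normal[OF st, of i], of "\<lambda>x. x ^ k"]
    integrable_normal_moment[of "sqrt (t - s)" 0 k] st
  by auto

lemma incr_mean: "expectation (\<lambda>\<omega>. (W t \<omega> - W s \<omega>) $ i) = 0"
  using incr_moment(2)[of i 1] integral_normal_moment_nz_1[of "sqrt (t - s)" 0] st by simp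

lemma incr_second: "expectation (\<lambda>\<omega>. ((W t \<omega> - W s \<omega>) $ i)\<^sup>2) = t - s"
  using incr_moment(2)[of i 2] integral_normal_moment_even[of "sqrt (t - s)" 0 1] st by simp

lemma incr_fourth: "expectation (\<lambda>\<omega>. ((W t \<omega> - W s \<omega>) $ i)^4) = 3 * (t - s)\<^sup>2"
  using incr_moment(2)[of i 4] integral_normal_moment_even[of "sqrt (t - s)" 0 2] st
  by (simp add: fact_numeral field_simps power2_eq_square)

lemma incr_cov:
  "integrable M (\<lambda>\<omega>. (W t \<omega> - W s \<omega>) $ i * (W t \<omega> - W s \<omega>) $ j)"
  "expectation (\<lambda>\<omega>. (W t \<omega> - W s \<omega>) $ i * (W t \<omega> - W s \<omega>) $ j) = (if i = j then t - s else 0)"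
proof -
  have "integrable M (\<lambda>\<omega>. (W t \<omega> - W s \<omega>) $ i * (W t \<omega> - W s \<omega>) $ j) \<and>
    expectation (\<lambda>\<omega>. (W t \<omega> - W s \<omega>) $ i * (W t \<omega> - W s \<omega>) $ j) = (if i = j then t - s else 0)"
  proof (cases "i = j")
    case True then show ?thesis
      using incr_moment(1)[of i 2] incr_second[of i] by (simp add: power2_eq_square)
  next
    case False
    have ind: "indep_vars (\<lambda>_. borel) (\<lambda>i \<omega>. (W t \<omega> - W s \<omega>) $ i) {i, j}"
      by (rule indep_vars_subset[OF comp_indep[OF st]]) simp
    have int: "integrable M (\<lambda>\<omega>. (W t \<omega> - W s \<omega>) $ k)" for k
      using incr_moment(1)[of k 1] by simp
    from indep_vars_integrable[OF _ ind int] indep_vars_lebesgue_integral[OF _ ind int]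
    show ?thesis using False incr_mean by simp
  qed
  then show "integrable M (\<lambda>\<omega>. (W t \<omega> - W s \<omega>) $ i * (W t \<omega> - W s \<omega>) $ j)"
    "expectation (\<lambda>\<omega>. (W t \<omega> - W s \<omega>) $ i * (W t \<omega> - W s \<omega>) $ j) = (if i = j then t - s else 0)"
    by auto
qed

lemma incr_norm_sq:
  "integrable M (\<lambda>\<omega>. (norm (W t \<omega> - W s \<omega>))\<^sup>2)"
  "expectation (\<lambda>\<omega>. (norm (W t \<omega> - W s \<omega>))\<^sup>2) = CARD('d) * (t - s)"
proof -
  have eq: "(norm (x::real^'d))\<^sup>2 = (\<Sum>i\<in>UNIV. x $ i * x $ i)" for x
    by (simp add: power2_norm_eq_inner inner_vec_def)
  show "integrable M (\<lambda>\<omega>. (norm (W t \<omega> - W s \<omega>))\<^sup>2)"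
    unfolding eq by (intro Bochner_Integration.integrable_sum incr_cov)
  show "expectation (\<lambda>\<omega>. (norm (W t \<omega> - W s \<omega>))\<^sup>2) = CARD('d) * (t - s)"
    unfolding eq by (subst Bochner_Integration.integral_sum) (auto simp only: incr_cov, auto)
qed

text \<open>By Cauchy-Schwarz the square of a sum of \<open>CARD('d)\<close> terms is at most
  \<open>CARD('d)\<close> times the sum of their squares; a second factor \<open>CARD('d)\<close>
  counts the fourth moments. The order \<open>(t - s)\<^sup>2\<close> is what makes fourth-order
  remainders negligible.\<close>

lemma incr_norm_fourth:
  "integrable M (\<lambda>\<omega>. (norm (W t \<omega> - W s \<omega>))^4)"
  "expectation (\<lambda>\<omega>. (norm (W t \<omega> - W s \<omega>))^4) \<le> 3 * CARD('d)\<^sup>2 * (t - s)\<^sup>2"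
proof -
  have le: "(norm (x::real^'d))^4 \<le> CARD('d) * (\<Sum>i\<in>UNIV. (x $ i)^4)" for x
  proof -
    have "(norm x)^4 = (\<Sum>i\<in>UNIV. (x $ i)\<^sup>2)\<^sup>2"
      by (simp add: power2_norm_eq_inner[symmetric, of x, unfolded inner_vec_def inner_real_def, folded power2_eq_square])
    also have "\<dots> \<le> (\<Sum>i\<in>(UNIV::'d set). ((x $ i)\<^sup>2)\<^sup>2) * (\<Sum>i\<in>(UNIV::'d set). 1\<^sup>2)"
      using Cauchy_Schwarz_ineq_sum[of "\<lambda>i. (x $ i)\<^sup>2" "\<lambda>_. 1" UNIV] by simp
    finally show ?thesis by (simp add: mult.commute power_mult[symmetric])
  qed
  have int: "integrable M (\<lambda>\<omega>. CARD('d) * (\<Sum>i\<in>UNIV. ((W t \<omega> - W s \<omega>) $ i)^4))"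
    by (intro Bochner_Integration.integrable_sum integrable_mult_right incr_moment)
  show int4: "integrable M (\<lambda>\<omega>. (norm (W t \<omega> - W s \<omega>))^4)"
    by (rule Bochner_Integration.integrable_bound[OF int])
       (auto intro!: AE_I2 order_trans[OF le] simp: sum_nonneg)
  have "expectation (\<lambda>\<omega>. (norm (W t \<omega> - W s \<omega>))^4)
    \<le> expectation (\<lambda>\<omega>. CARD('d) * (\<Sum>i\<in>UNIV. ((W t \<omega> - W s \<omega>) $ i)^4))"
    by (intro integral_mono int int4 le)
  also have "\<dots> = CARD('d) * (\<Sum>i\<in>(UNIV::'d set). 3 * (t - s)\<^sup>2)"
    by (subst integral_mult_right_zero, subst Bochner_Integration.integral_sum)
       (use incr_moment(1) in \<open>auto simp only: incr_fourth\<close>)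
  finally show "expectation (\<lambda>\<omega>. (norm (W t \<omega> - W s \<omega>))^4) \<le> 3 * CARD('d)\<^sup>2 * (t - s)\<^sup>2"
    by (simp add: power2_eq_square mult_ac)
qed

text \<open>The martingale property of one step: in each component a coefficient known at time
  \<open>s\<close> factors out of a centred increment. The bound on \<open>c\<close> supplies
  integrability.\<close>

lemma incr_linear:
  fixes c :: "'a \<Rightarrow> real^'d"
  assumes c: "c \<in> borel_measurable (F s)" and K: "\<And>\<omega>. \<omega> \<in> space M \<Longrightarrow> norm (c \<omega>) \<le> K"
  shows "integrable M (\<lambda>\<omega>. c \<omega> \<bullet> (W t \<omega> - W s \<omega>))"
    and "expectation (\<lambda>\<omega>. c \<omega> \<bullet> (W t \<omega> - W s \<omega>)) = 0"
proof -
  have ci: "integrable M (\<lambda>\<omega>. c \<omega> $ i)" for i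
    by (rule bounded_F_integrable[of _ s K])
       (use c in measurable, use K component_le_norm_cart order_trans in \<open>auto, blast\<close>)
  have cm: "(\<lambda>\<omega>. c \<omega> $ i) \<in> borel_measurable (F s)" for i using c by measurable
  note * = expectation_incr_mult[OF cm, of "\<lambda>x. x $ _", OF _ ci]
  have wi: "integrable M (\<lambda>\<omega>. (W t \<omega> - W s \<omega>) $ i)" for i using incr_moment(1)[of i 1] by simp
  have i1: "integrable M (\<lambda>\<omega>. c \<omega> $ i * (W t \<omega> - W s \<omega>) $ i)" for i
    by (rule *) (use wi in auto)
  have i2: "expectation (\<lambda>\<omega>. c \<omega> $ i * (W t \<omega> - W s \<omega>) $ i) = 0" for i
    by (subst *(2)) (use wi in \<open>auto simp: incr_mean simp del: vector_minus_component\<close>)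
  show "integrable M (\<lambda>\<omega>. c \<omega> \<bullet> (W t \<omega> - W s \<omega>))"
    unfolding inner_vec_def inner_real_def by (intro Bochner_Integration.integrable_sum i1)
  show "expectation (\<lambda>\<omega>. c \<omega> \<bullet> (W t \<omega> - W s \<omega>)) = 0"
    unfolding inner_vec_def inner_real_def by (subst Bochner_Integration.integral_sum) (auto simp only: i1 i2, auto)
qed

text \<open>Origin of the second-order term of the generator: uncorrelated components leave only the
  diagonal of \<open>B\<close>, each entry weighted with the variance \<open>t - s\<close>.\<close>

lemma incr_quadratic:
  fixes B :: "'a \<Rightarrow> real^'d^'d"
  assumes B: "B \<in> borel_measurable (F s)" and K: "\<And>\<omega>. \<omega> \<in> space M \<Longrightarrow> norm (B \<omega>) \<le> K"
  shows "integrable M (\<lambda>\<omega>. (W t \<omega> - W s \<omega>) \<bullet> (B \<omega> *v (W t \<omega> - W s \<omega>)))"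
    and "expectation (\<lambda>\<omega>. (W t \<omega> - W s \<omega>) \<bullet> (B \<omega> *v (W t \<omega> - W s \<omega>))) = (t - s) * expectation (\<lambda>\<omega>. trace (B \<omega>))"
proof -
  have nb: "norm (B \<omega> $ i $ j) \<le> norm (B \<omega>)" for \<omega> i j
    by (metis order_trans Finite_Cartesian_Product.norm_nth_le)
  have ci: "integrable M (\<lambda>\<omega>. B \<omega> $ i $ j)" for i j
    by (rule bounded_F_integrable[of _ s K])
       (use B in measurable, use K nb order_trans in blast)
  have cm: "(\<lambda>\<omega>. B \<omega> $ i $ j) \<in> borel_measurable (F s)" for i j using B by measurable
  have eq: "w \<bullet> (A *v w) = (\<Sum>i\<in>UNIV. \<Sum>j\<in>UNIV. A $ i $ j * (w $ i * w $ j))" for A :: "real^'d^'d" and w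
    by (simp add: inner_vec_def matrix_vector_mult_def sum_distrib_left mult_ac)
  have i1: "integrable M (\<lambda>\<omega>. B \<omega> $ i $ j * ((W t \<omega> - W s \<omega>) $ i * (W t \<omega> - W s \<omega>) $ j))" for i j
    by (rule expectation_incr_mult[OF cm, of "\<lambda>x. x $ _ * x $ _", OF _ ci]) (simp_all only: incr_cov, measurable)
  have i2: "expectation (\<lambda>\<omega>. B \<omega> $ i $ j * ((W t \<omega> - W s \<omega>) $ i * (W t \<omega> - W s \<omega>) $ j))
      = expectation (\<lambda>\<omega>. B \<omega> $ i $ j) * (if i = j then t - s else 0)" for i j
    by (subst expectation_incr_mult(2)[OF cm, of "\<lambda>x. x $ _ * x $ _", OF _ ci]) (simp_all only: incr_cov, measurable)
  show "integrable M (\<lambda>\<omega>. (W t \<omega> - W s \<omega>) \<bullet> (B \<omega> *v (W t \<omega> - W s \<omega>)))"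
    unfolding eq by (intro Bochner_Integration.integrable_sum i1)
  have "expectation (\<lambda>\<omega>. (W t \<omega> - W s \<omega>) \<bullet> (B \<omega> *v (W t \<omega> - W s \<omega>)))
     = (\<Sum>i\<in>UNIV. \<Sum>j\<in>UNIV. expectation (\<lambda>\<omega>. B \<omega> $ i $ j * ((W t \<omega> - W s \<omega>) $ i * (W t \<omega> - W s \<omega>) $ j)))"
    unfolding eq
    apply (subst Bochner_Integration.integral_sum, intro Bochner_Integration.integrable_sum i1)
    apply (subst Bochner_Integration.integral_sum, intro i1, rule refl)
    done
  also have "\<dots> = (\<Sum>i\<in>UNIV. expectation (\<lambda>\<omega>. B \<omega> $ i $ i) * (t - s))"
    unfolding i2 by (simp add: sum.delta if_distrib[of "\<lambda>x. _ * x"] cong: if_cong)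
  also have "\<dots> = (t - s) * expectation (\<lambda>\<omega>. trace (B \<omega>))"
    unfolding trace_def
    by (subst Bochner_Integration.integral_sum) (auto simp: ci sum_distrib_right[symmetric])
  finally show "expectation (\<lambda>\<omega>. (W t \<omega> - W s \<omega>) \<bullet> (B \<omega> *v (W t \<omega> - W s \<omega>))) = (t - s) * expectation (\<lambda>\<omega>. trace (B \<omega>))" .
qed

end
end

section \<open>Martingale sums and a maximal inequality\<close>

text \<open>The norm of a matrix is here the Frobenius norm, so Cauchy-Schwarz is applied to each
  row and the squares are added.\<close>

lemma norm_matrix_vector_le: "norm ((A::real^'d^'n) *v x) \<le> norm A * norm x"
proof (rule power2_le_imp_le)
  have "(norm (A *v x))\<^sup>2 = (\<Sum>i\<in>UNIV. ((A *v x) $ i)\<^sup>2)"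
    unfolding power2_norm_eq_inner inner_vec_def by (simp add: power2_eq_square)
  also have "\<dots> = (\<Sum>i\<in>UNIV. (A $ i \<bullet> x)\<^sup>2)"
    by (simp add: matrix_vector_mult_def inner_vec_def)
  also have "\<dots> \<le> (\<Sum>i\<in>UNIV. (A $ i \<bullet> A $ i) * (x \<bullet> x))"
    by (intro sum_mono Cauchy_Schwarz_ineq)
  also have "\<dots> = (norm A * norm x)\<^sup>2"
    by (simp add: power_mult_distrib power2_norm_eq_inner inner_vec_def[of A A] sum_distrib_right)
  finally show "(norm (A *v x))\<^sup>2 \<le> (norm A * norm x)\<^sup>2" .
qed simp

lemma norm_transpose [simp]: "norm (transpose (A::real^'d^'n)) = norm A"
proof -
  have "(norm (transpose A))\<^sup>2 = (norm A)\<^sup>2"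
    unfolding power2_norm_eq_inner inner_vec_def inner_real_def transpose_def
    using sum.swap[of "\<lambda>i j. A $ i $ j * A $ i $ j" UNIV UNIV] by simp
  then show ?thesis by simp
qed

text \<open>Row \<open>i\<close> of the product is \<open>transpose B *v (A $ i)\<close>, which
  reduces the claim to the matrix-vector bound.\<close>

lemma norm_matrix_matrix_le: "norm ((A::real^'d^'n) ** (B::real^'k^'d)) \<le> norm A * norm B"
proof (rule power2_le_imp_le)
  have "(norm (A ** B))\<^sup>2 = (\<Sum>i\<in>UNIV. (norm ((A ** B) $ i))\<^sup>2)"
    by (simp add: power2_norm_eq_inner inner_vec_def)
  also have "\<dots> = (\<Sum>i\<in>UNIV. (norm (transpose B *v (A $ i)))\<^sup>2)"
    by (intro sum.cong refl arg_cong[where f="\<lambda>x. (norm x)\<^sup>2"])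
       (simp add: vec_eq_iff matrix_matrix_mult_def matrix_vector_mult_def transpose_def mult.commute)
  also have "\<dots> \<le> (\<Sum>i\<in>UNIV. (norm (transpose B) * norm (A $ i))\<^sup>2)"
    by (intro sum_mono power_mono norm_matrix_vector_le) simp
  also have "\<dots> = (norm A * norm B)\<^sup>2"
    by (simp add: power_mult_distrib power2_norm_eq_inner inner_vec_def[of A A] sum_distrib_left mult.commute)
  finally show "(norm (A ** B))\<^sup>2 \<le> (norm A * norm B)\<^sup>2" .
qed simp

lemma measurable_transpose [measurable (raw)]:
  "f \<in> borel_measurable N \<Longrightarrow> (\<lambda>x. transpose (f x :: real^'d^'n)) \<in> borel_measurable N"
  by (rule borel_measurable_continuous_on[where f=transpose])
     (auto simp: transpose_def intro!: continuous_intros)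

lemma measurable_matrix_matrix_mult [measurable (raw)]:
  fixes A :: "'b \<Rightarrow> real^'d^'n" and B :: "'b \<Rightarrow> real^'k^'d"
  assumes A: "A \<in> borel_measurable N" and B: "B \<in> borel_measurable N"
  shows "(\<lambda>\<omega>. A \<omega> ** B \<omega>) \<in> borel_measurable N"
proof -
  have "continuous_on UNIV (\<lambda>p::(real^'d^'n) \<times> (real^'k^'d). fst p ** snd p)"
    unfolding matrix_matrix_mult_def by (intro continuous_intros)
  then have "(\<lambda>p::(real^'d^'n) \<times> (real^'k^'d). fst p ** snd p) \<in> borel_measurable (borel \<Otimes>\<^sub>M borel)"
    by (subst borel_prod) (rule borel_measurable_continuous_onI)
  from measurable_compose[OF measurable_Pair[OF A B] this] show ?thesis by simp
qed

section \<open>Sums of Wiener increments with adapted coefficients\<close>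

context wiener_process
begin

text \<open>Indexed by steps rather than by time, so that Riemann sums of a process and Euler sums
  with killed coefficients are both instances. The coefficient belongs to the left end of its step,
  as in the Ito integral.\<close>

definition incr_sum :: "real \<Rightarrow> (nat \<Rightarrow> 'a \<Rightarrow> real^'d^'n) \<Rightarrow> nat \<Rightarrow> 'a \<Rightarrow> real^'n" where
  "incr_sum \<delta> G i \<omega> = (\<Sum>l<i. G l \<omega> *v (W (real (Suc l) * \<delta>) \<omega> - W (real l * \<delta>) \<omega>))"

lemma incr_sum_0 [simp]: "incr_sum \<delta> G 0 \<omega> = 0"
  and incr_sum_Suc: "incr_sum \<delta> G (Suc i) \<omega> =
    incr_sum \<delta> G i \<omega> + G i \<omega> *v (W (real (Suc i) * \<delta>) \<omega> - W (real i * \<delta>) \<omega>)"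
  by (simp_all add: incr_sum_def)

lemma incr_sum_diff:
  "incr_sum \<delta> (\<lambda>l \<omega>. G l \<omega> - H l \<omega>) i \<omega> = incr_sum \<delta> G i \<omega> - incr_sum \<delta> H i \<omega>"
  by (simp add: incr_sum_def sum_subtractf matrix_vector_mult_diff_rdistrib)

lemma incr_sum_measurable:
  assumes "0 \<le> \<delta>" and G: "\<And>l. l < i \<Longrightarrow> G l \<in> borel_measurable (F (real l * \<delta>))"
  shows "incr_sum \<delta> G i \<in> borel_measurable (F (real i * \<delta>))"
  unfolding incr_sum_def[abs_def]
proof (intro borel_measurable_sum measurable_matrix_vector_mult' borel_measurable_diff)
  fix l assume l: "l \<in> {..<i}"
  then have le: "real l * \<delta> \<le> real i * \<delta>" "real (Suc l) * \<delta> \<le> real i * \<delta>" "0 \<le> real l * \<delta>" "0 \<le> real (Suc l) * \<delta>"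
    using assms(1) by (auto intro!: mult_right_mono)
  show "G l \<in> borel_measurable (F (real i * \<delta>))" using G l le by (auto intro: measurable_F_mono)
  show "W (real (Suc l) * \<delta>) \<in> borel_measurable (F (real i * \<delta>))"
    "W (real l * \<delta>) \<in> borel_measurable (F (real i * \<delta>))"
    using adapted le by (auto intro: measurable_F_mono)
qed

text \<open>The sum is stopped as soon as its norm exceeds \<open>\<epsilon>\<close> or its energy exceeds \<open>\<eta>\<close>. The stopped
  sum has second moment at most \<open>\<eta>\<close>.\<close>

lemma incr_sum_maximal_inequality:
  fixes G :: "nat \<Rightarrow> 'a \<Rightarrow> real^'d^'n"
  assumes \<delta>: "0 < \<delta>" and \<epsilon>: "0 < \<epsilon>" and \<eta>: "0 < \<eta>"
    and G: "\<And>l. G l \<in> borel_measurable (F (real l * \<delta>))"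
  shows "prob {\<omega>\<in>space M. \<exists>i\<le>N. \<epsilon> < norm (incr_sum \<delta> G i \<omega>)}
    \<le> prob {\<omega>\<in>space M. \<eta> < \<delta> * (\<Sum>l<N. (norm (G l \<omega>))\<^sup>2)} + \<eta> / \<epsilon>\<^sup>2"
proof -
  define S where "S = incr_sum \<delta> G"
  \<comment> \<open>\<open>c l\<close> says that step \<open>l\<close> is still taken. Its energy
    includes step \<open>l\<close> itself, which is known at the left end because \<open>G l\<close>
    is; hence the stopped energy cannot overshoot \<eta>.\<close>
  define c where "c l \<omega> \<longleftrightarrow> (\<forall>m\<le>l. norm (S m \<omega>) \<le> \<epsilon>) \<and> \<delta> * (\<Sum>m\<le>l. (norm (G m \<omega>))\<^sup>2) \<le> \<eta>" for l \<omega>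
  define G' where "G' l \<omega> = (if c l \<omega> then G l \<omega> else 0)" for l \<omega>
  define S' where "S' = incr_sum \<delta> G'"
  have G_le: "G m \<in> borel_measurable (F (real l * \<delta>))" if "m \<le> l" for m l
    using G \<delta> that by (intro measurable_F_mono[OF G]) auto
  have S_le: "S m \<in> borel_measurable (F (real l * \<delta>))" if "m \<le> l" for m l
    unfolding S_def using G \<delta> that
    by (intro measurable_F_mono[OF incr_sum_measurable]) (auto intro: mult_right_mono)
  have c_meas: "Measurable.pred (F (real l * \<delta>)) (c l)" for l
  proof -
    have [measurable]: "(\<lambda>\<omega>. \<delta> * (\<Sum>m\<le>l. (norm (G m \<omega>))\<^sup>2)) \<in> borel_measurable (F (real l * \<delta>))"
      by (intro borel_measurable_times borel_measurable_sum borel_measurable_power borel_measurable_const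
          measurable_compose[OF G_le borel_measurable_norm]) auto
    have [measurable]: "Measurable.pred (F (real l * \<delta>)) (\<lambda>\<omega>. norm (S m \<omega>) \<le> \<epsilon>)" if "m \<in> {..l}" for m
      by (rule measurable_compose[OF S_le, of m l "\<lambda>x. norm x \<le> \<epsilon>"]) (use that in auto)
    have "Measurable.pred (F (real l * \<delta>)) (\<lambda>\<omega>. \<forall>m\<in>{..l}. norm (S m \<omega>) \<le> \<epsilon>)"
      by (intro pred_intros_finite) auto
    then show ?thesis unfolding c_def by (auto simp: Ball_def)
  qed
  have G'_meas: "G' l \<in> borel_measurable (F (real l * \<delta>))" for l
    unfolding G'_def[abs_def] using c_meas G by measurable
  \<comment> \<open>A bound however large \<open>G\<close> is: on \<open>c l\<close> the term of
    step \<open>l\<close> is part of an energy that is at most \<eta>.\<close>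
  have G'_bound: "(norm (G' l \<omega>))\<^sup>2 \<le> \<eta> / \<delta>" for l \<omega>
  proof (cases "c l \<omega>")
    case True
    have "(norm (G l \<omega>))\<^sup>2 \<le> (\<Sum>m\<le>l. (norm (G m \<omega>))\<^sup>2)"
      by (rule member_le_sum) auto
    also have "\<dots> \<le> \<eta> / \<delta>" using True \<delta> by (simp add: c_def field_simps)
    finally show ?thesis by (simp add: G'_def True)
  qed (use \<delta> \<eta> in \<open>simp add: G'_def\<close>)
  then have G'_norm: "norm (G' l \<omega>) \<le> sqrt (\<eta> / \<delta>)" for l \<omega>
    by (simp add: real_le_rsqrt)
  have c_mono: "c l \<omega> \<Longrightarrow> m \<le> l \<Longrightarrow> c m \<omega>" for l m \<omega>
  proof -
    assume *: "c l \<omega>" "m \<le> l"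
    have "(\<Sum>k\<le>m. (norm (G k \<omega>))\<^sup>2) \<le> (\<Sum>k\<le>l. (norm (G k \<omega>))\<^sup>2)"
      using * by (intro sum_mono2) auto
    then have "\<delta> * (\<Sum>k\<le>m. (norm (G k \<omega>))\<^sup>2) \<le> \<delta> * (\<Sum>k\<le>l. (norm (G k \<omega>))\<^sup>2)"
      using \<delta> by simp
    with * show "c m \<omega>" by (auto simp: c_def)
  qed
  have S'_eq: "S' i \<omega> = S i \<omega>" if "\<And>l. l < i \<Longrightarrow> c l \<omega>" for i \<omega>
    unfolding S'_def S_def incr_sum_def G'_def using that by (intro sum.cong) auto
  \<comment> \<open>The discrete Ito isometry: in each step the cross term has mean zero, and the
    quadratic term contributes \<delta> times the expected squared norm of the coefficient.\<close>
  have moment: "integrable M (\<lambda>\<omega>. (norm (S' i \<omega>))\<^sup>2) \<and>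
    expectation (\<lambda>\<omega>. (norm (S' i \<omega>))\<^sup>2) = expectation (\<lambda>\<omega>. \<delta> * (\<Sum>l<i. (norm (G' l \<omega>))\<^sup>2))" for i
  proof (induction i)
    case 0 show ?case by (simp add: S'_def)
  next
    case (Suc i)
    let ?s = "real i * \<delta>" and ?t = "real (Suc i) * \<delta>"
    let ?w = "\<lambda>\<omega>. W ?t \<omega> - W ?s \<omega>"
    \<comment> \<open>Coefficient of the cross term. Where \<open>c i\<close> holds, the stopped sum
      equals \<open>S i\<close>, whose norm is at most \<epsilon>, so \<open>k\<close> is bounded;
      elsewhere \<open>G' i\<close> is zero.\<close>
    define k where "k \<omega> = (if c i \<omega> then 2 *\<^sub>R (transpose (G' i \<omega>) *v S i \<omega>) else 0)" for \<omega>
    have st: "0 \<le> ?s" "?s < ?t" using \<delta> by auto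
    have km: "k \<in> borel_measurable (F ?s)"
      unfolding k_def[abs_def] using c_meas[of i] G'_meas[of i] S_le[of i i] by measurable
    have kb: "norm (k \<omega>) \<le> 2 * (sqrt (\<eta> / \<delta>) * \<epsilon>)" for \<omega>
    proof (cases "c i \<omega>")
      case True
      have "norm (transpose (G' i \<omega>) *v S i \<omega>) \<le> norm (G' i \<omega>) * norm (S i \<omega>)"
        using norm_matrix_vector_le[of "transpose (G' i \<omega>)" "S i \<omega>"] by simp
      also have "\<dots> \<le> sqrt (\<eta> / \<delta>) * \<epsilon>"
        using G'_norm True \<epsilon> \<eta> \<delta> by (intro mult_mono) (auto simp: c_def)
      finally show ?thesis by (simp add: k_def True)
    qed (use \<epsilon> \<eta> \<delta> in \<open>simp add: k_def\<close>)
    have Bm: "(\<lambda>\<omega>. transpose (G' i \<omega>) ** G' i \<omega>) \<in> borel_measurable (F ?s)"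
      using G'_meas[of i] by measurable
    have Bb: "norm (transpose (G' i \<omega>) ** G' i \<omega>) \<le> \<eta> / \<delta>" for \<omega>
      using norm_matrix_matrix_le[of "transpose (G' i \<omega>)" "G' i \<omega>"] G'_bound[of i \<omega>]
      by (simp add: power2_eq_square)
    have step: "(norm (S' (Suc i) \<omega>))\<^sup>2 = (norm (S' i \<omega>))\<^sup>2 + k \<omega> \<bullet> ?w \<omega>
       + ?w \<omega> \<bullet> ((transpose (G' i \<omega>) ** G' i \<omega>) *v ?w \<omega>)" for \<omega>
    proof -
      have "(norm (S' (Suc i) \<omega>))\<^sup>2 = (norm (S' i \<omega>))\<^sup>2 + 2 * (S' i \<omega> \<bullet> (G' i \<omega> *v ?w \<omega>))
        + (G' i \<omega> *v ?w \<omega>) \<bullet> (G' i \<omega> *v ?w \<omega>)"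
        unfolding S'_def incr_sum_Suc power2_norm_eq_inner
        by (simp add: inner_add inner_commute)
      also have "2 * (S' i \<omega> \<bullet> (G' i \<omega> *v ?w \<omega>)) = k \<omega> \<bullet> ?w \<omega>"
      proof (cases "c i \<omega>")
        case True
        with c_mono[OF True] S'_eq[of i \<omega>] show ?thesis
          by (simp add: k_def dot_lmul_matrix[symmetric] transpose_matrix_vector)
      qed (simp add: k_def G'_def)
      also have "(G' i \<omega> *v ?w \<omega>) \<bullet> (G' i \<omega> *v ?w \<omega>) = ?w \<omega> \<bullet> ((transpose (G' i \<omega>) ** G' i \<omega>) *v ?w \<omega>)"
        using inner_matrix_quadratic[of "G' i \<omega>" "?w \<omega>" "mat 1"] by (simp add: matrix_mul_rid)
      finally show ?thesis .
    qed
    note lin = incr_linear[OF st km kb] and quad = incr_quadratic[OF st Bm Bb]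
    have iG: "integrable M (\<lambda>\<omega>. (norm (G' l \<omega>))\<^sup>2)" for l
    proof (rule integrable_const_bound[where B="\<eta> / \<delta>"])
      show "(\<lambda>\<omega>. (norm (G' l \<omega>))\<^sup>2) \<in> borel_measurable M"
        using measurable_F_M[OF G'_meas[of l]] by measurable
    qed (simp add: G'_bound)
    have ts: "?t - ?s = \<delta>" by (simp add: distrib_right)
    have i1: "integrable M (\<lambda>\<omega>. (norm (S' i \<omega>))\<^sup>2)" using Suc by blast
    have i2: "integrable M (\<lambda>\<omega>. (norm (S' i \<omega>))\<^sup>2 + k \<omega> \<bullet> ?w \<omega>)"
      by (intro Bochner_Integration.integrable_add i1 lin(1))
    have "integrable M (\<lambda>\<omega>. (norm (S' (Suc i) \<omega>))\<^sup>2)"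
      unfolding step by (intro Bochner_Integration.integrable_add i2 quad(1))
    moreover have "expectation (\<lambda>\<omega>. (norm (S' (Suc i) \<omega>))\<^sup>2)
       = expectation (\<lambda>\<omega>. (norm (S' i \<omega>))\<^sup>2) + \<delta> * expectation (\<lambda>\<omega>. (norm (G' i \<omega>))\<^sup>2)"
      unfolding step Bochner_Integration.integral_add[OF i2 quad(1)]
        Bochner_Integration.integral_add[OF i1 lin(1)] lin(2) quad(2) ts matrix_norm_sq by simp
    moreover have "expectation (\<lambda>\<omega>. \<delta> * (\<Sum>l<Suc i. (norm (G' l \<omega>))\<^sup>2)) =
       expectation (\<lambda>\<omega>. \<delta> * (\<Sum>l<i. (norm (G' l \<omega>))\<^sup>2)) + \<delta> * expectation (\<lambda>\<omega>. (norm (G' i \<omega>))\<^sup>2)"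
    proof -
      have "integrable M (\<lambda>\<omega>. \<delta> * (\<Sum>l<i. (norm (G' l \<omega>))\<^sup>2))"
        by (intro integrable_mult_right Bochner_Integration.integrable_sum iG)
      from Bochner_Integration.integral_add[OF this integrable_mult_right[OF iG[of i], of \<delta>]]
      show ?thesis by (simp add: distrib_left)
    qed
    ultimately show ?case using Suc by simp
  qed
  have energy': "\<delta> * (\<Sum>l<i. (norm (G' l \<omega>))\<^sup>2) \<le> \<eta>" for i \<omega>
  proof (induction i)
    case (Suc i)
    show ?case
    proof (cases "c i \<omega>")
      case True
      have "(\<Sum>l<Suc i. (norm (G' l \<omega>))\<^sup>2) = (\<Sum>m\<le>i. (norm (G m \<omega>))\<^sup>2)"
        using c_mono[OF True] by (intro sum.cong) (auto simp: G'_def)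
      then show ?thesis using True by (simp add: c_def)
    qed (use Suc in \<open>simp add: G'_def\<close>)
  qed (use \<eta> in simp)
  have S'm: "S' N \<in> borel_measurable M"
    unfolding S'_def using G'_meas \<delta> by (intro measurable_F_M[OF incr_sum_measurable]) auto
  have SM: "S i \<in> borel_measurable M" for i by (rule measurable_F_M[OF S_le[of i i]]) simp
  have GM: "G i \<in> borel_measurable M" for i by (rule measurable_F_M[OF G])
  note [measurable] = S'm SM GM
  have "expectation (\<lambda>\<omega>. (norm (S' N \<omega>))\<^sup>2) \<le> \<eta>"
    unfolding moment[THEN conjunct2]
  proof (rule integral_le_const)
    have G'M: "G' l \<in> borel_measurable M" for l by (rule measurable_F_M[OF G'_meas])
    have *: "(\<lambda>\<omega>. \<delta> * (\<Sum>l<N. (norm (G' l \<omega>))\<^sup>2)) \<in> borel_measurable M"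
      by (intro borel_measurable_times borel_measurable_sum borel_measurable_power borel_measurable_const
          measurable_compose[OF G'M borel_measurable_norm])
    have "0 \<le> \<delta> * (\<Sum>l<N. (norm (G' l \<omega>))\<^sup>2)" for \<omega> using \<delta> by (simp add: sum_nonneg)
    then have "norm (\<delta> * (\<Sum>l<N. (norm (G' l \<omega>))\<^sup>2)) \<le> \<eta>" for \<omega>
      by (simp only: real_norm_def abs_of_nonneg energy')
    with * show "integrable M (\<lambda>\<omega>. \<delta> * (\<Sum>l<N. (norm (G' l \<omega>))\<^sup>2))"
      by (intro integrable_const_bound[where B=\<eta>] AE_I2)
  qed (use energy' in blast)
  then have "expectation (\<lambda>\<omega>. (norm (S' N \<omega>))\<^sup>2) / \<epsilon>\<^sup>2 \<le> \<eta> / \<epsilon>\<^sup>2"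
    by (intro divide_right_mono) auto
  moreover have "prob {\<omega>\<in>space M. \<epsilon>\<^sup>2 \<le> (norm (S' N \<omega>))\<^sup>2} \<le> expectation (\<lambda>\<omega>. (norm (S' N \<omega>))\<^sup>2) / \<epsilon>\<^sup>2"
    using moment[of N] \<epsilon> by (intro integral_Markov_inequality_measure[where A="space M"]) auto
  ultimately have markov: "prob {\<omega>\<in>space M. \<epsilon>\<^sup>2 \<le> (norm (S' N \<omega>))\<^sup>2} \<le> \<eta> / \<epsilon>\<^sup>2"
    by (rule order_trans[rotated])
  \<comment> \<open>If the total energy is at most \<eta>, only the norm can cause stopping: the sum
    freezes at the first index \<open>j\<close> where the norm exceeds \<epsilon>, so
    \<open>S' N\<close> is still \<open>S j\<close>. A bound for the last stopped value thus
    controls the maximum.\<close>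
  have "{\<omega>\<in>space M. \<exists>i\<le>N. \<epsilon> < norm (S i \<omega>)}
    \<subseteq> {\<omega>\<in>space M. \<eta> < \<delta> * (\<Sum>l<N. (norm (G l \<omega>))\<^sup>2)} \<union> {\<omega>\<in>space M. \<epsilon>\<^sup>2 \<le> (norm (S' N \<omega>))\<^sup>2}"
  proof (safe, rule ccontr)
    fix \<omega> i assume i: "i \<le> N" "\<epsilon> < norm (S i \<omega>)" and \<omega>: "\<omega> \<in> space M"
      and e: "\<not> \<eta> < \<delta> * (\<Sum>l<N. (norm (G l \<omega>))\<^sup>2)" and n: "\<not> \<epsilon>\<^sup>2 \<le> (norm (S' N \<omega>))\<^sup>2"
    define j where "j = (LEAST i. \<epsilon> < norm (S i \<omega>))"
    have j: "\<epsilon> < norm (S j \<omega>)" "j \<le> i" "\<And>m. m < j \<Longrightarrow> norm (S m \<omega>) \<le> \<epsilon>"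
      unfolding j_def
      subgoal by (rule LeastI[of "\<lambda>i. \<epsilon> < norm (S i \<omega>)", OF i(2)])
      subgoal by (rule Least_le[of "\<lambda>i. \<epsilon> < norm (S i \<omega>)", OF i(2)])
      subgoal for m using not_less_Least[of m "\<lambda>i. \<epsilon> < norm (S i \<omega>)"] by simp
      done
    have cj: "c l \<omega>" if "l < j" for l
    proof -
      have "(\<Sum>m\<le>l. (norm (G m \<omega>))\<^sup>2) \<le> (\<Sum>l<N. (norm (G l \<omega>))\<^sup>2)"
        using that j i by (intro sum_mono2) auto
      then have "\<delta> * (\<Sum>m\<le>l. (norm (G m \<omega>))\<^sup>2) \<le> \<delta> * (\<Sum>l<N. (norm (G l \<omega>))\<^sup>2)"
        using \<delta> by simp
      then show ?thesis using e j that by (auto simp: c_def)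
    qed
    have nc: "\<not> c l \<omega>" if "j \<le> l" for l using j that by (auto simp: c_def not_le)
    have "S' N \<omega> = S' j \<omega>"
      unfolding S'_def incr_sum_def using j i nc
      by (intro sum.mono_neutral_right) (auto simp: G'_def)
    also have "\<dots> = S j \<omega>" using S'_eq cj by simp
    finally have "\<epsilon> \<le> norm (S' N \<omega>)" using j by simp
    then show False using n \<epsilon> by (simp add: power_mono)
  qed
  then have "prob {\<omega>\<in>space M. \<exists>i\<le>N. \<epsilon> < norm (S i \<omega>)} \<le>
    prob ({\<omega>\<in>space M. \<eta> < \<delta> * (\<Sum>l<N. (norm (G l \<omega>))\<^sup>2)} \<union> {\<omega>\<in>space M. \<epsilon>\<^sup>2 \<le> (norm (S' N \<omega>))\<^sup>2})"
    by (rule finite_measure_mono) measurable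
  also have "\<dots> \<le> prob {\<omega>\<in>space M. \<eta> < \<delta> * (\<Sum>l<N. (norm (G l \<omega>))\<^sup>2)} + prob {\<omega>\<in>space M. \<epsilon>\<^sup>2 \<le> (norm (S' N \<omega>))\<^sup>2}"
    by (rule measure_Un_le) measurable
  finally show ?thesis using markov unfolding S_def by simp
qed

end

section \<open>Dyadic discretisation\<close>

text \<open>Dominated convergence for the indicators. The index from which \<open>A n\<close> is
  avoided may depend on the outcome; this turns pathwise limits into limits of
  probabilities.\<close>

lemma (in prob_space) prob_tendsto_zero:
  assumes A: "\<And>n. A n \<in> events" and ev: "AE \<omega> in M. \<forall>\<^sub>F n in sequentially. \<omega> \<notin> A n"
  shows "(\<lambda>n. prob (A n)) \<longlonglongrightarrow> 0"
proof -
  have "(\<lambda>n. integral\<^sup>L M (indicator (A n) :: 'a \<Rightarrow> real)) \<longlonglongrightarrow> integral\<^sup>L M (\<lambda>_. 0::real)"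
  proof (rule integral_dominated_convergence[where w="\<lambda>_. 1"])
    show "AE \<omega> in M. (\<lambda>n. indicator (A n) \<omega> :: real) \<longlonglongrightarrow> 0"
      using ev
    proof eventually_elim
      case (elim \<omega>)
      show ?case by (rule tendsto_eventually, use elim in eventually_elim) auto
    qed
  qed (use A in \<open>auto simp: indicator_def\<close>)
  then show ?thesis using A by simp
qed

text \<open>The limit argument that accompanies the maximal inequality: the energy threshold \<eta>
  is fixed first, so that \<open>\<eta> / e\<^sup>2\<close> is small, and only then does
  \<open>n\<close> grow.\<close>

lemma (in prob_space) prob_tendsto_zeroI:
  fixes p :: "real \<Rightarrow> nat \<Rightarrow> real"
  assumes bound: "\<And>\<eta>. 0 < \<eta> \<Longrightarrow> \<forall>\<^sub>F n in sequentially. prob (A n) \<le> p \<eta> n + \<eta> / e\<^sup>2"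
    and p: "\<And>\<eta>. 0 < \<eta> \<Longrightarrow> p \<eta> \<longlonglongrightarrow> 0" and "0 < e"
  shows "(\<lambda>n. prob (A n)) \<longlonglongrightarrow> 0"
proof (rule order_tendstoI)
  fix a :: real assume "a < 0"
  then show "\<forall>\<^sub>F n in sequentially. a < prob (A n)" by (intro always_eventually allI) (rule less_le_trans, auto)
next
  fix a :: real assume a: "0 < a"
  define \<eta> where "\<eta> = a / 2 * e\<^sup>2"
  have \<eta>: "0 < \<eta>" "\<eta> / e\<^sup>2 = a / 2" using a \<open>0 < e\<close> by (auto simp: \<eta>_def)
  have "\<forall>\<^sub>F n in sequentially. p \<eta> n < a / 2" using p[OF \<eta>(1)] a by (intro order_tendstoD) auto
  then show "\<forall>\<^sub>F n in sequentially. prob (A n) < a"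
    using bound[OF \<eta>(1)] by eventually_elim (use \<eta>(2) in linarith)
qed

lemma ennreal_double: "0 \<le> x \<Longrightarrow> 2 * ennreal x = ennreal (2 * x)"
  by (simp add: ennreal_mult)

text \<open>Sampling at the left end of each cell of mesh \<open>1 / 2 ^ n\<close>, which preserves
  adaptedness. \<open>nat\<close> sends negative times to the value at 0.\<close>

definition dyadic_floor :: "nat \<Rightarrow> (real \<Rightarrow> 'b) \<Rightarrow> real \<Rightarrow> 'b" where
  "dyadic_floor n v s = v (real (nat \<lfloor>s * 2 ^ n\<rfloor>) / 2 ^ n)"

text \<open>Dyadic grids are nested: going from level \<open>n'\<close> to level \<open>n\<close> is
  an integer division by \<open>2 ^ (n' - n)\<close>, and floors compose under integer
  division.\<close>

lemma nat_floor_dyadic_refine: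
  assumes "n \<le> n'"
  shows "nat \<lfloor>real (nat \<lfloor>(s::real) * 2 ^ n'\<rfloor>) / 2 ^ n' * 2 ^ n\<rfloor> = nat \<lfloor>s * 2 ^ n\<rfloor>"
proof -
  have pw: "(2::real) ^ n' = 2 ^ n * 2 ^ (n' - n)" using assms by (simp flip: power_add)
  have "\<lfloor>real_of_int (max 0 \<lfloor>s * 2 ^ n'\<rfloor>) / 2 ^ n' * 2 ^ n\<rfloor> = \<lfloor>real_of_int (max 0 \<lfloor>s * 2 ^ n'\<rfloor>) / real (2 ^ (n' - n))\<rfloor>"
    by (simp add: pw)
  also have "\<dots> = max 0 \<lfloor>s * 2 ^ n'\<rfloor> div int (2 ^ (n' - n))"
    by (metis floor_divide_of_int_eq of_int_of_nat_eq)
  also have "\<dots> = max 0 (\<lfloor>s * 2 ^ n'\<rfloor> div int (2 ^ (n' - n)))"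
    by (auto simp: max_def pos_imp_zdiv_nonneg_iff)
  also have "\<lfloor>s * 2 ^ n'\<rfloor> div int (2 ^ (n' - n)) = \<lfloor>s * 2 ^ n' / real (2 ^ (n' - n))\<rfloor>"
    using floor_divide_real_eq_div[of "int (2 ^ (n' - n))" "s * 2 ^ n'"] by simp
  also have "s * 2 ^ n' / real (2 ^ (n' - n)) = s * 2 ^ n" by (simp add: pw)
  finally have "\<lfloor>real_of_int (max 0 \<lfloor>s * 2 ^ n'\<rfloor>) / 2 ^ n' * 2 ^ n\<rfloor> = max 0 \<lfloor>s * 2 ^ n\<rfloor>" .
  moreover have "real (nat x) = real_of_int (max 0 x)" "nat (max 0 x) = nat x" for x :: int
    by (simp_all add: max_def)
  ultimately show ?thesis by (simp only:)
qed

text \<open>Lets a process sampled at level \<open>n\<close> serve as an integrand on every finer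
  grid, where sums from different levels become comparable.\<close>

lemma dyadic_floor_dyadic_floor:
  "n \<le> n' \<Longrightarrow> dyadic_floor n' (dyadic_floor n v) = dyadic_floor n v"
  by (rule ext) (simp only: dyadic_floor_def nat_floor_dyadic_refine)

text \<open>The sample points approach \<open>s\<close> from below and differ from it by at most
  \<open>(1/2) ^ n\<close>, so left continuity at \<open>s\<close> is enough.\<close>

lemma dyadic_floor_tendsto:
  fixes v :: "real \<Rightarrow> 'b::topological_space"
  assumes "0 \<le> s" and v: "continuous (at s within {0..s}) v"
  shows "(\<lambda>n. dyadic_floor n v s) \<longlonglongrightarrow> v s"
  unfolding dyadic_floor_def
proof (rule continuous_within_tendsto_compose[OF v])
  have eq: "real (nat \<lfloor>s * 2 ^ n\<rfloor>) = real_of_int \<lfloor>s * 2 ^ n\<rfloor>" for n using assms(1) by simp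
  have le: "real (nat \<lfloor>s * 2 ^ n\<rfloor>) / 2 ^ n \<le> s" for n
    unfolding eq by (simp add: divide_le_eq)
  then show "\<forall>\<^sub>F n in sequentially. real (nat \<lfloor>s * 2 ^ n\<rfloor>) / 2 ^ n \<in> {0..s}" by simp
  have ge: "s - (1/2) ^ n \<le> real (nat \<lfloor>s * 2 ^ n\<rfloor>) / 2 ^ n" for n
  proof -
    have "s * 2 ^ n - 1 \<le> real_of_int \<lfloor>s * 2 ^ n\<rfloor>" by linarith
    then have "(s * 2 ^ n - 1) / 2 ^ n \<le> real_of_int \<lfloor>s * 2 ^ n\<rfloor> / 2 ^ n"
      by (intro divide_right_mono) auto
    then show ?thesis unfolding eq by (simp add: diff_divide_distrib power_one_over)
  qed
  show "(\<lambda>n. real (nat \<lfloor>s * 2 ^ n\<rfloor>) / 2 ^ n) \<longlonglongrightarrow> s"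
  proof (rule tendsto_sandwich[of "\<lambda>n. s - (1/2) ^ n" _ _ "\<lambda>_. s"])
    have "(\<lambda>n. s - (1/2) ^ n) \<longlonglongrightarrow> s - 0" by (intro tendsto_intros LIMSEQ_realpow_zero) auto
    then show "(\<lambda>n. s - (1/2) ^ n) \<longlonglongrightarrow> s" by simp
  qed (use le ge in auto)
qed

text \<open>Has exactly the shape of the squared distance in \<open>has_ito_integral\<close>, whose
  approximation condition is later read off by unfolding.\<close>

definition sq_dist :: "real \<Rightarrow> (real \<Rightarrow> 'b::real_normed_vector) \<Rightarrow> (real \<Rightarrow> 'b) \<Rightarrow> ennreal" where
  "sq_dist T v w = (\<integral>\<^sup>+ s\<in>{0..T}. ennreal ((norm (v s - w s))\<^sup>2) \<partial>lborel)"

lemma sq_dist_commute: "sq_dist T v w = sq_dist T w v"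
  by (simp add: sq_dist_def norm_minus_commute)

text \<open>With the indicator moved onto the paths, measurability is needed only for paths cut off
  outside \<open>{0..T}\<close>.\<close>

lemma sq_dist_eq: "sq_dist T v w =
  (\<integral>\<^sup>+ s. ennreal ((norm (indicator {0..T} s *\<^sub>R v s - indicator {0..T} s *\<^sub>R w s))\<^sup>2) \<partial>lborel)"
  unfolding sq_dist_def by (intro nn_integral_cong) (simp add: indicator_def)

text \<open>The factors 2 come from
  \<open>(p + q)\<^sup>2 \<le> 2 * (p\<^sup>2 + q\<^sup>2)\<close>; they are the price of working
  with squared distances.\<close>

lemma sq_dist_triangle:
  fixes v w x :: "real \<Rightarrow> 'b::euclidean_space"
  assumes v: "(\<lambda>s. indicator {0..T} s *\<^sub>R v s) \<in> borel_measurable borel"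
    and x: "(\<lambda>s. indicator {0..T} s *\<^sub>R x s) \<in> borel_measurable borel"
    and w: "(\<lambda>s. indicator {0..T} s *\<^sub>R w s) \<in> borel_measurable borel"
  shows "sq_dist T v w \<le> 2 * sq_dist T v x + 2 * sq_dist T w x"
proof -
  let ?i = "\<lambda>s. indicator {0..T} s :: real"
  have "norm (a - c) \<le> norm (a - b) + norm (b - c)" for a b c :: 'b
    using norm_triangle_ineq[of "a - b" "b - c"] by simp
  then have "(norm (a - c))\<^sup>2 \<le> (norm (a - b) + norm (b - c))\<^sup>2" for a b c :: 'b
    by (rule power_mono) simp
  moreover have "(p + q)\<^sup>2 \<le> 2 * (p\<^sup>2 + q\<^sup>2)" for p q :: real
    using sum_squares_bound[of p q] by (simp add: power2_sum)
  ultimately have "(norm (a - c))\<^sup>2 \<le> 2 * ((norm (a - b))\<^sup>2 + (norm (b - c))\<^sup>2)" for a b c :: 'b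
    using order_trans by blast
  then have "sq_dist T v w \<le> (\<integral>\<^sup>+ s. ennreal (2 * ((norm (?i s *\<^sub>R v s - ?i s *\<^sub>R x s))\<^sup>2 + (norm (?i s *\<^sub>R x s - ?i s *\<^sub>R w s))\<^sup>2)) \<partial>lborel)"
    unfolding sq_dist_eq by (intro nn_integral_mono ennreal_leI)
  also have "\<dots> = (\<integral>\<^sup>+ s. 2 * (ennreal ((norm (?i s *\<^sub>R v s - ?i s *\<^sub>R x s))\<^sup>2) + ennreal ((norm (?i s *\<^sub>R x s - ?i s *\<^sub>R w s))\<^sup>2)) \<partial>lborel)"
    by (intro nn_integral_cong) (simp add: ennreal_mult' )
  also have "\<dots> = 2 * (sq_dist T v x + sq_dist T x w)"
    unfolding sq_dist_eq using v x w
    by (subst nn_integral_cmult, simp, subst nn_integral_add) auto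
  finally show ?thesis by (simp add: distrib_left sq_dist_commute[of T w])
qed

lemma indicator_grid_interval:
  assumes "0 \<le> s"
  shows "indicator {real l / 2 ^ n..<real (Suc l) / 2 ^ n} s = (if nat \<lfloor>s * 2 ^ n\<rfloor> = l then 1 else 0 :: ennreal)"
proof -
  have "nat \<lfloor>s * 2 ^ n\<rfloor> = l \<longleftrightarrow> \<lfloor>s * 2 ^ n\<rfloor> = int l" using assms by auto
  also have "\<dots> \<longleftrightarrow> real l \<le> s * 2 ^ n \<and> s * 2 ^ n < real l + 1" by (simp add: floor_eq_iff)
  also have "\<dots> \<longleftrightarrow> s \<in> {real l / 2 ^ n..<real (Suc l) / 2 ^ n}"
    by (auto simp: field_simps)
  finally show ?thesis by (simp add: indicator_def)
qed

text \<open>Translates the energy in \<open>incr_sum_maximal_inequality\<close> into a distance of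
  sampled paths, to which approximation in time applies.\<close>

lemma sq_dist_dyadic_floor:
  "sq_dist (real i / 2 ^ n) (dyadic_floor n v) (dyadic_floor n w) =
    ennreal (1 / 2 ^ n * (\<Sum>l<i. (norm (v (real l / 2 ^ n) - w (real l / 2 ^ n)))\<^sup>2))"
proof -
  let ?c = "\<lambda>l. ennreal ((norm (v (real l / 2 ^ n) - w (real l / 2 ^ n)))\<^sup>2)"
  have "sq_dist (real i / 2 ^ n) (dyadic_floor n v) (dyadic_floor n w)
    = (\<integral>\<^sup>+ s. (\<Sum>l<i. ?c l * indicator {real l / 2 ^ n..<real (Suc l) / 2 ^ n} s) \<partial>lborel)"
    unfolding sq_dist_def
  proof (rule nn_integral_cong_AE)
    \<comment> \<open>The right end point carries the sample with index \<open>i\<close>, which the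
      sum omits; a single point is null.\<close>
    have "AE s in lborel. s \<noteq> real i / 2 ^ n" by (rule AE_lborel_singleton)
    then show "AE s in lborel. ennreal ((norm (dyadic_floor n v s - dyadic_floor n w s))\<^sup>2) * indicator {0..real i / 2 ^ n} s
      = (\<Sum>l<i. ?c l * indicator {real l / 2 ^ n..<real (Suc l) / 2 ^ n} s)"
    proof eventually_elim
      case (elim s)
      show ?case
      proof (cases "0 \<le> s")
        case True
        have "nat \<lfloor>s * 2 ^ n\<rfloor> < i \<longleftrightarrow> s \<le> real i / 2 ^ n"
          using True elim by (auto simp: nat_less_iff floor_less_iff field_simps)
        then show ?thesis using True
          by (simp only: indicator_grid_interval[OF True] if_distrib[of "\<lambda>x. _ * x"] mult_1_right mult_zero_right
              dyadic_floor_def sum.delta' finite_lessThan lessThan_iff) (simp add: indicator_def)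
      next
        case False
        have "indicator {real l / 2 ^ n..<real (Suc l) / 2 ^ n} s = (0::ennreal)" for l
        proof -
          have "0 \<le> real l / 2 ^ n" by simp
          then have "\<not> real l / 2 ^ n \<le> s" using False by linarith
          then show ?thesis by simp
        qed
        then show ?thesis using False by simp
      qed
    qed
  qed
  also have "\<dots> = (\<Sum>l<i. ?c l * ennreal (1 / 2 ^ n))"
    by (subst nn_integral_sum)
       (auto simp: nn_integral_cmult_indicator emeasure_lborel_Ico divide_right_mono diff_divide_distrib[symmetric] intro!: sum.cong)
  also have "\<dots> = ennreal (1 / 2 ^ n * (\<Sum>l<i. (norm (v (real l / 2 ^ n) - w (real l / 2 ^ n)))\<^sup>2))"
    by (simp add: ennreal_mult[symmetric] sum_ennreal sum_distrib_left mult.commute)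
  finally show ?thesis .
qed

lemma dyadic_floor_measurable:
  fixes v :: "real \<Rightarrow> 'b::topological_space"
  shows "dyadic_floor n v \<in> borel_measurable borel"
  unfolding dyadic_floor_def[abs_def]
  by (rule measurable_compose[of "\<lambda>s. nat \<lfloor>s * 2 ^ n\<rfloor>" borel "count_space UNIV"]) auto

text \<open>Such a path is the pointwise limit of its dyadic samples, each of which takes countably
  many values.\<close>

lemma left_continuous_measurable:
  fixes v :: "real \<Rightarrow> 'b::euclidean_space"
  assumes "\<And>s. 0 \<le> s \<Longrightarrow> continuous (at s within {0..s}) v"
  shows "(\<lambda>s. indicator {0..T} s *\<^sub>R v s) \<in> borel_measurable borel"
proof (rule borel_measurable_LIMSEQ_metric)
  show "(\<lambda>s. indicator {0..T} s *\<^sub>R dyadic_floor n v s) \<in> borel_measurable borel" for n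
    using dyadic_floor_measurable[of n v] by measurable
  show "(\<lambda>n. indicator {0..T} s *\<^sub>R dyadic_floor n v s) \<longlonglongrightarrow> indicator {0..T} s *\<^sub>R v s" for s
    using dyadic_floor_tendsto[OF _ assms, of s] by (cases "s \<in> {0..T}") auto
qed

lemma sq_dist_dyadic_floor_tendsto:
  fixes v :: "real \<Rightarrow> 'b::euclidean_space"
  assumes c: "\<And>s. 0 \<le> s \<Longrightarrow> continuous (at s within {0..s}) v"
    and b: "\<And>s. 0 \<le> s \<Longrightarrow> s \<le> T \<Longrightarrow> norm (v s) \<le> B"
  shows "(\<lambda>n. sq_dist T (dyadic_floor n v) v) \<longlonglongrightarrow> 0"
proof -
  let ?i = "\<lambda>s. indicator {0..T} s :: real"
  have m: "(\<lambda>s. ?i s *\<^sub>R dyadic_floor n v s) \<in> borel_measurable borel" for n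
    using dyadic_floor_measurable[of n v] by measurable
  note [measurable] = m left_continuous_measurable[OF c, of T]
  have "(\<lambda>n. \<integral>\<^sup>+ s. ennreal ((norm (?i s *\<^sub>R dyadic_floor n v s - ?i s *\<^sub>R v s))\<^sup>2) \<partial>lborel) \<longlonglongrightarrow> (\<integral>\<^sup>+ (s::real). 0 \<partial>lborel)"
  proof (rule nn_integral_dominated_convergence[where w="\<lambda>s. ennreal ((2 * B)\<^sup>2) * indicator {0..T} s"])
    show "AE s in lborel. ennreal ((norm (?i s *\<^sub>R dyadic_floor n v s - ?i s *\<^sub>R v s))\<^sup>2) \<le> ennreal ((2 * B)\<^sup>2) * indicator {0..T} s" for n
    proof (rule AE_I2)
      fix s
      show "ennreal ((norm (?i s *\<^sub>R dyadic_floor n v s - ?i s *\<^sub>R v s))\<^sup>2) \<le> ennreal ((2 * B)\<^sup>2) * indicator {0..T} s"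
      proof (cases "s \<in> {0..T}")
        case True
        \<comment> \<open>The sample point stays in \<open>{0..T}\<close>, so the bound
          \<open>B\<close> covers both values and \<open>(2 * B)\<^sup>2\<close> dominates.\<close>
        have "real (nat \<lfloor>s * 2 ^ n\<rfloor>) / 2 ^ n \<le> s" using True by (simp add: divide_le_eq)
        then have "norm (dyadic_floor n v s) \<le> B" unfolding dyadic_floor_def using True by (intro b) auto
        moreover have "norm (v s) \<le> B" using b True by auto
        ultimately have "norm (dyadic_floor n v s - v s) \<le> 2 * B"
          using norm_triangle_ineq4[of "dyadic_floor n v s" "v s"] by linarith
        then have "(norm (dyadic_floor n v s - v s))\<^sup>2 \<le> (2 * B)\<^sup>2" by (intro power_mono) auto
        then show ?thesis using True by (simp add: ennreal_leI)
      qed simp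
    qed
    show "(\<integral>\<^sup>+ s. ennreal ((2 * B)\<^sup>2) * indicator {0..T} s \<partial>lborel) < \<infinity>"
      by (cases "0 \<le> T") (simp_all add: nn_integral_cmult_indicator ennreal_mult_less_top)
    show "AE s in lborel. (\<lambda>n. ennreal ((norm (?i s *\<^sub>R dyadic_floor n v s - ?i s *\<^sub>R v s))\<^sup>2)) \<longlonglongrightarrow> 0"
    proof (rule AE_I2)
      fix s
      show "(\<lambda>n. ennreal ((norm (?i s *\<^sub>R dyadic_floor n v s - ?i s *\<^sub>R v s))\<^sup>2)) \<longlonglongrightarrow> 0"
      proof (cases "s \<in> {0..T}")
        case True
        then have "(\<lambda>n. dyadic_floor n v s) \<longlonglongrightarrow> v s" by (intro dyadic_floor_tendsto c) auto
        then have "(\<lambda>n. (norm (dyadic_floor n v s - v s))\<^sup>2) \<longlonglongrightarrow> (norm (v s - v s))\<^sup>2"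
          by (intro tendsto_intros)
        then have "(\<lambda>n. ennreal ((norm (dyadic_floor n v s - v s))\<^sup>2)) \<longlonglongrightarrow> ennreal ((norm (v s - v s))\<^sup>2)"
          by (rule tendsto_ennrealI)
        then show ?thesis using True by simp
      qed simp
    qed
  qed measurable
  then show ?thesis unfolding sq_dist_eq by simp
qed

section \<open>Left-continuous adapted integrands and their Riemann sums\<close>

context wiener_process
begin

text \<open>Made to contain both the simple processes and the stopped coefficients \<open>if s \<le>
  \<tau> \<omega> then \<sigma> (X s \<omega>) else 0\<close>, which may jump immediately after the
  stopping time. Left continuity alone does not bound a path on an interval, hence the separate
  boundedness clause.\<close>

definition left_regular :: "(real \<Rightarrow> 'a \<Rightarrow> 'b::euclidean_space) \<Rightarrow> bool" where
  "left_regular v \<longleftrightarrow> (\<forall>t\<ge>0. v t \<in> borel_measurable (F t)) \<and>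
     (\<forall>\<omega>\<in>space M. (\<forall>s\<ge>0. continuous (at s within {0..s}) (\<lambda>u. v u \<omega>)) \<and>
        (\<forall>T. \<exists>B. \<forall>s. 0 \<le> s \<longrightarrow> s \<le> T \<longrightarrow> norm (v s \<omega>) \<le> B))"

abbreviation path :: "(real \<Rightarrow> 'a \<Rightarrow> 'b) \<Rightarrow> 'a \<Rightarrow> real \<Rightarrow> 'b" where
  "path v \<omega> \<equiv> \<lambda>s. v s \<omega>"

abbreviation floored :: "nat \<Rightarrow> (real \<Rightarrow> 'a \<Rightarrow> 'b) \<Rightarrow> 'a \<Rightarrow> real \<Rightarrow> 'b" where
  "floored n v \<omega> \<equiv> dyadic_floor n (path v \<omega>)"

abbreviation far :: "real \<Rightarrow> real \<Rightarrow> ('a \<Rightarrow> real \<Rightarrow> 'b::real_normed_vector) \<Rightarrow> ('a \<Rightarrow> real \<Rightarrow> 'b) \<Rightarrow> 'a set" where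
  "far T \<eta> v w \<equiv> {\<omega>\<in>space M. ennreal \<eta> < sq_dist T (v \<omega>) (w \<omega>)}"

abbreviation grid_sum :: "nat \<Rightarrow> (real \<Rightarrow> 'a \<Rightarrow> real^'d^'n) \<Rightarrow> nat \<Rightarrow> 'a \<Rightarrow> real^'n" where
  "grid_sum n v \<equiv> incr_sum (1 / 2 ^ n) (\<lambda>l. v (real l / 2 ^ n))"

text \<open>A sampled process selects one of countably many random variables by a measurable
  function of time; left continuity makes the process itself the pointwise limit of its
  samples.\<close>

lemma left_regular_joint_measurable:
  fixes v :: "real \<Rightarrow> 'a \<Rightarrow> 'b::euclidean_space"
  assumes v: "left_regular v"
  shows "(\<lambda>(\<omega>, s). indicator {0..T} s *\<^sub>R floored n v \<omega> s) \<in> borel_measurable (M \<Otimes>\<^sub>M lborel)"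
    and "(\<lambda>(\<omega>, s). indicator {0..T} s *\<^sub>R v s \<omega>) \<in> borel_measurable (M \<Otimes>\<^sub>M lborel)"
proof -
  have vM: "v (real l / 2 ^ n) \<in> borel_measurable M" for l n
    using v by (intro measurable_F_M[of _ "real l / 2 ^ n"]) (auto simp: left_regular_def)
  have *: "(\<lambda>(\<omega>, s). indicator {0..T} s *\<^sub>R floored n v \<omega> s) \<in> borel_measurable (M \<Otimes>\<^sub>M lborel)" for n
  proof -
    have "(\<lambda>x. v (real (nat \<lfloor>(snd x :: real) * 2 ^ n\<rfloor>) / 2 ^ n) (fst x)) \<in> borel_measurable (M \<Otimes>\<^sub>M lborel)"
    proof (rule measurable_compose_countable[where f="\<lambda>l x. v (real l / 2 ^ n) (fst x)"])
      show "(\<lambda>x. v (real l / 2 ^ n) (fst x)) \<in> borel_measurable (M \<Otimes>\<^sub>M lborel)" for l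
        using vM by measurable
    qed measurable
    then have "(\<lambda>x. indicator {0..T} (snd x) *\<^sub>R v (real (nat \<lfloor>snd x * 2 ^ n\<rfloor>) / 2 ^ n) (fst x)) \<in> borel_measurable (M \<Otimes>\<^sub>M lborel)"
      by measurable
    then show "(\<lambda>(\<omega>, s). indicator {0..T} s *\<^sub>R floored n v \<omega> s) \<in> borel_measurable (M \<Otimes>\<^sub>M lborel)"
      by (simp add: dyadic_floor_def case_prod_unfold)
  qed
  then show "(\<lambda>(\<omega>, s). indicator {0..T} s *\<^sub>R floored n v \<omega> s) \<in> borel_measurable (M \<Otimes>\<^sub>M lborel)" .
  show "(\<lambda>(\<omega>, s). indicator {0..T} s *\<^sub>R v s \<omega>) \<in> borel_measurable (M \<Otimes>\<^sub>M lborel)"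
  proof (rule borel_measurable_LIMSEQ_metric)
    show "(\<lambda>(\<omega>, s). indicator {0..T} s *\<^sub>R floored i v \<omega> s) \<in> borel_measurable (M \<Otimes>\<^sub>M lborel)" for i
      by (rule *)
    fix x :: "'a \<times> real" assume "x \<in> space (M \<Otimes>\<^sub>M lborel)"
    then have "fst x \<in> space M" by (auto simp: space_pair_measure)
    then have "0 \<le> snd x \<Longrightarrow> (\<lambda>n. dyadic_floor n (path v (fst x)) (snd x)) \<longlonglongrightarrow> v (snd x) (fst x)"
      using v by (intro dyadic_floor_tendsto) (auto simp: left_regular_def)
    then show "(\<lambda>i. case x of (\<omega>, s) \<Rightarrow> indicator {0..T} s *\<^sub>R floored i v \<omega> s)
      \<longlonglongrightarrow> (case x of (\<omega>, s) \<Rightarrow> indicator {0..T} s *\<^sub>R v s \<omega>)"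
      by (cases x; cases "snd x \<in> {0..T}") auto
  qed
qed

lemma left_regular_path_measurable:
  assumes v: "left_regular v" and "\<omega> \<in> space M"
  shows "(\<lambda>s. indicator {0..T} s *\<^sub>R v s \<omega>) \<in> borel_measurable borel"
    "(\<lambda>s. indicator {0..T} s *\<^sub>R floored n v \<omega> s) \<in> borel_measurable borel"
  using assms dyadic_floor_measurable[of n "path v \<omega>"]
  by (auto simp: left_regular_def intro!: left_continuous_measurable)

lemma sq_dist_measurable:
  fixes v w :: "'a \<Rightarrow> real \<Rightarrow> 'b::euclidean_space"
  assumes v: "(\<lambda>(\<omega>, s). indicator {0..T} s *\<^sub>R v \<omega> s) \<in> borel_measurable (M \<Otimes>\<^sub>M lborel)"
    and w: "(\<lambda>(\<omega>, s). indicator {0..T} s *\<^sub>R w \<omega> s) \<in> borel_measurable (M \<Otimes>\<^sub>M lborel)"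
  shows "(\<lambda>\<omega>. sq_dist T (v \<omega>) (w \<omega>)) \<in> borel_measurable M"
proof -
  let ?i = "\<lambda>s. indicator {0..T} s :: real"
  have "(\<lambda>(\<omega>, s). ennreal ((norm (?i s *\<^sub>R v \<omega> s - ?i s *\<^sub>R w \<omega> s))\<^sup>2)) \<in> borel_measurable (M \<Otimes>\<^sub>M lborel)"
    using v w unfolding case_prod_unfold by measurable
  then show ?thesis unfolding sq_dist_eq by (rule lborel.borel_measurable_nn_integral)
qed

lemma prob_sq_dist_dyadic_floor_tendsto:
  fixes v :: "real \<Rightarrow> 'a \<Rightarrow> 'b::euclidean_space"
  assumes v: "left_regular v" and "0 < \<eta>"
  shows "(\<lambda>n. prob (far T \<eta> (floored n v) (path v))) \<longlonglongrightarrow> 0"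
proof (rule prob_tendsto_zero)
  show "(far T \<eta> (floored n v) (path v)) \<in> events" for n
    using sq_dist_measurable[OF left_regular_joint_measurable[OF v]] by measurable
  show "AE \<omega> in M. \<forall>\<^sub>F n in sequentially.
      \<omega> \<notin> (far T \<eta> (floored n v) (path v))"
  proof (rule AE_I2)
    fix \<omega> assume \<omega>: "\<omega> \<in> space M"
    then obtain B where "\<And>s. 0 \<le> s \<Longrightarrow> s \<le> T \<Longrightarrow> norm (v s \<omega>) \<le> B"
      using v unfolding left_regular_def by metis
    then have "(\<lambda>n. sq_dist T (floored n v \<omega>) (path v \<omega>)) \<longlonglongrightarrow> 0"
      using v \<omega> by (intro sq_dist_dyadic_floor_tendsto) (auto simp: left_regular_def)
    then have "\<forall>\<^sub>F n in sequentially. sq_dist T (floored n v \<omega>) (path v \<omega>) < ennreal \<eta>"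
      using \<open>0 < \<eta>\<close> by (intro order_tendstoD) auto
    then show "\<forall>\<^sub>F n in sequentially.
      \<omega> \<notin> (far T \<eta> (floored n v) (path v))"
      by eventually_elim (auto simp: not_less)
  qed
qed

text \<open>Within a coarse cell the sampled integrand is constant, so the fine increments of
  \<open>W\<close> telescope to the coarse one.\<close>

lemma grid_sum_refine:
  assumes "n \<le> n'"
  shows "grid_sum n' (\<lambda>s \<omega>. floored n v \<omega> s) (i * 2 ^ (n' - n)) \<omega> = grid_sum n v i \<omega>"
proof -
  define k where "k = (2::nat) ^ (n' - n)"
  have pw: "(2::real) ^ n' = 2 ^ n * real k" and k: "k > 0" using assms by (simp_all add: k_def flip: power_add)
  let ?W = "\<lambda>l. W (real l * (1 / 2 ^ n')) \<omega>"
  have "grid_sum n' (\<lambda>s \<omega>. floored n v \<omega> s) (i * k) \<omega>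
    = (\<Sum>l<i * k. floored n v \<omega> (real l / 2 ^ n') *v (?W (Suc l) - ?W l))"
    by (simp add: incr_sum_def)
  also have "\<dots> = (\<Sum>m<i. \<Sum>l = m * k..<m * k + k. floored n v \<omega> (real l / 2 ^ n') *v (?W (Suc l) - ?W l))"
    by (rule sum.nat_group[symmetric])
  also have "\<dots> = (\<Sum>m<i. \<Sum>l = m * k..<m * k + k. v (real m / 2 ^ n) \<omega> *v (?W (Suc l) - ?W l))"
  proof (intro sum.cong refl)
    fix m l assume "l \<in> {m * k..<m * k + k}"
    then have "real m * real k \<le> real l \<and> real l < real m * real k + real k"
      by (metis atLeastLessThan_iff of_nat_add of_nat_le_iff of_nat_less_iff of_nat_mult)
    then have "\<lfloor>real l / 2 ^ n' * 2 ^ n\<rfloor> = int m" using k by (simp add: floor_eq_iff pw field_simps)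
    then show "floored n v \<omega> (real l / 2 ^ n') *v (?W (Suc l) - ?W l) = v (real m / 2 ^ n) \<omega> *v (?W (Suc l) - ?W l)"
      by (simp only: dyadic_floor_def nat_int)
  qed
  also have "\<dots> = (\<Sum>m<i. v (real m / 2 ^ n) \<omega> *v (?W (m * k + k) - ?W (m * k)))"
  proof (intro sum.cong refl)
    fix m
    show "(\<Sum>l = m * k..<m * k + k. v (real m / 2 ^ n) \<omega> *v (?W (Suc l) - ?W l)) = v (real m / 2 ^ n) \<omega> *v (?W (m * k + k) - ?W (m * k))"
      using sum_Suc_diff'[of "m * k" "m * k + k" ?W]
        linear_sum[OF matrix_vector_mul_linear, of "v (real m / 2 ^ n) \<omega>" "\<lambda>l. ?W (Suc l) - ?W l" "{m * k..<m * k + k}"]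
      by simp
  qed
  also have "\<dots> = grid_sum n v i \<omega>"
  proof -
    have "real (m * k) * (1 / 2 ^ n') = real m * (1 / 2 ^ n)" "real (m * k + k) * (1 / 2 ^ n') = real (Suc m) * (1 / 2 ^ n)" for m
      using k by (simp_all add: pw field_simps)
    then show ?thesis by (simp only: incr_sum_def)
  qed
  finally show ?thesis by (simp add: k_def)
qed

end

section \<open>The Ito integral as a limit of Riemann sums\<close>

lemma indicator_Ioc_left_continuous:
  "continuous (at (s::real) within {0..s}) (\<lambda>u. indicator {a<..b} u :: real)"
  unfolding continuous_within
proof (rule tendsto_eventually)
  \<comment> \<open>The distance from \<open>s\<close> to the nearest jump strictly to its left; a
    jump at \<open>s\<close> itself does no harm, since the interval contains its right end.\<close>
  define d where "d = (if b < s then s - b else if a < s then s - a else 1)"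
  have "d > 0" by (simp add: d_def)
  moreover have "indicator {a<..b} u = (indicator {a<..b} s :: real)" if "u \<in> {0..s}" "dist u s < d" for u
    using that by (auto simp: d_def dist_real_def indicator_def split: if_splits)
  ultimately show "\<forall>\<^sub>F u in at s within {0..s}. indicator {a<..b} u = (indicator {a<..b} s :: real)"
    unfolding eventually_at by blast
qed

text \<open>The tail of a telescoping sum, used for the steps of the grid that lie after a jump time
  of a simple process.\<close>

lemma sum_increments_above:
  fixes w :: "nat \<Rightarrow> 'b::ab_group_add"
  shows "(\<Sum>l<N. if k \<le> l then w (Suc l) - w l else 0) = w N - w (min N k)"
  by (induction N) (auto simp: min_def not_le le_Suc_eq)

lemma simple_process_times_nonneg:
  assumes "simple_process F N t \<xi>" "k \<le> N"
  shows "0 \<le> t k"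
  using assms(2)
proof (induction k)
  case (Suc k)
  then show ?case
    using assms(1) order_trans[of 0 "t k" "t (Suc k)"] by (auto simp: simple_process_def)
qed (use assms(1) in \<open>simp add: simple_process_def\<close>)

lemma sum_matrix_vector_mult: "(\<Sum>k\<in>K. A k) *v x = (\<Sum>k\<in>K. A k *v x)"
  by (induction K rule: infinite_finite_induct) (auto simp: matrix_vector_mult_add_rdistrib)

section \<open>From simple processes to the Ito integral\<close>

context wiener_process
begin

text \<open>The half-open intervals \<open>{t k<..t (Suc k)}\<close> give left continuity and
  adaptedness at once: \<open>\<xi> k\<close> is used only after the time \<open>t k\<close> at
  which it is known.\<close>

lemma simple_value_left_regular:
  fixes \<xi> :: "nat \<Rightarrow> 'a \<Rightarrow> real^'d^'n"
  assumes "simple_process F N t \<xi>"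
  shows "left_regular (simple_value N t \<xi>)"
  unfolding left_regular_def
proof (intro conjI allI impI ballI)
  have F: "\<xi> k \<in> borel_measurable (F (t k))" if "k < N" for k
    using assms that by (auto simp: simple_process_def)
  show "simple_value N t \<xi> s \<in> borel_measurable (F s)" for s
    unfolding simple_value_def[abs_def]
  proof (rule borel_measurable_sum)
    fix k assume "k \<in> {..<N}"
    then have k: "\<xi> k \<in> borel_measurable (F (t k))" using F by simp
    show "(\<lambda>\<omega>. indicator {t k<..t (Suc k)} s *\<^sub>R \<xi> k \<omega>) \<in> borel_measurable (F s)"
    proof (cases "t k < s")
      case True
      then show ?thesis using measurable_F_mono[OF k, of s] by simp
    qed (simp add: indicator_def)
  qed
  fix \<omega>
  show "continuous (at s within {0..s}) (\<lambda>u. simple_value N t \<xi> u \<omega>)" for s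
    unfolding simple_value_def by (intro continuous_intros indicator_Ioc_left_continuous)
  have "norm (simple_value N t \<xi> s \<omega>) \<le> (\<Sum>k<N. norm (\<xi> k \<omega>))" for s
    unfolding simple_value_def by (rule sum_norm_le) (simp add: indicator_def)
  then show "\<exists>B. \<forall>s\<ge>0. s \<le> T \<longrightarrow> norm (simple_value N t \<xi> s \<omega>) \<le> B" for T
    by blast
qed

text \<open>The Riemann sum equals the integral of the same simple process with its jump times
  rounded up to the grid; continuity of the path of \<open>W\<close> does the rest. For
  \<open>n \<ge> m\<close> the number of steps corresponds to the fixed time
  \<open>i / 2^m\<close>.\<close>

lemma grid_sum_simple_tendsto:
  fixes \<xi> :: "nat \<Rightarrow> 'a \<Rightarrow> real^'d^'n"
  assumes s: "simple_process F N t \<xi>" and c: "continuous_on {0..} (\<lambda>t. W t \<omega>)"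
  shows "(\<lambda>n. grid_sum n (simple_value N t \<xi>) (i * 2 ^ (n - m)) \<omega>)
    \<longlonglongrightarrow> simple_integral_W W N t \<xi> (real i / 2 ^ m) \<omega>"
proof -
  define T where "T = real i / 2 ^ m"
  \<comment> \<open>\<open>r n u\<close> is the first grid point strictly after \<open>u\<close>. A
    step that starts at a jump time \<open>u\<close> still uses the old value, so the new value acts
    from the next grid point on.\<close>
  define r where "r n u = real (nat \<lfloor>u * 2 ^ n\<rfloor> + 1) / 2 ^ n" for n and u :: real
  note t0 = simple_process_times_nonneg[OF s]
  have mono: "t k \<le> t (Suc k)" if "k < N" for k using s that by (auto simp: simple_process_def)
  have r_lim: "(\<lambda>n. r n u) \<longlonglongrightarrow> u" if "0 \<le> u" for u
  proof (rule tendsto_sandwich[of "\<lambda>_. u" _ _ "\<lambda>n. u + (1/2) ^ n"])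
    have eq: "r n u = (real_of_int \<lfloor>u * 2 ^ n\<rfloor> + 1) / 2 ^ n" for n
      using that by (simp add: r_def)
    have "u \<le> r n u" for n
      unfolding eq using real_of_int_floor_add_one_ge[of "u * 2 ^ n"] by (simp add: field_simps)
    then show "\<forall>\<^sub>F n in sequentially. u \<le> r n u" by simp
    have "r n u \<le> u + (1/2) ^ n" for n
    proof -
      have "r n u \<le> (u * 2 ^ n + 1) / 2 ^ n" unfolding eq by (intro divide_right_mono) auto
      then show ?thesis by (simp add: add_divide_distrib power_one_over)
    qed
    then show "\<forall>\<^sub>F n in sequentially. r n u \<le> u + (1/2) ^ n" by simp
    have "(\<lambda>n. u + (1/2) ^ n) \<longlonglongrightarrow> u + 0" by (intro tendsto_intros LIMSEQ_realpow_zero) auto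
    then show "(\<lambda>n. u + (1/2) ^ n) \<longlonglongrightarrow> u" by simp
  qed simp
  have T0: "0 \<le> T" by (simp add: T_def)
  have r0: "0 \<le> r n u" for n u by (simp add: r_def)
  have W_lim: "(\<lambda>n. W (min T (r n u)) \<omega>) \<longlonglongrightarrow> W (min T u) \<omega>" if "0 \<le> u" for u
  proof (rule continuous_on_tendsto_compose[OF c])
    show "(\<lambda>n. min T (r n u)) \<longlonglongrightarrow> min T u" using r_lim[OF that] by (intro tendsto_intros)
  qed (use that T0 r0 in auto)
  have sum_eq: "grid_sum n (simple_value N t \<xi>) (i * 2 ^ (n - m)) \<omega>
     = (\<Sum>k<N. \<xi> k \<omega> *v (W (min T (r n (t (Suc k)))) \<omega> - W (min T (r n (t k))) \<omega>))" if "m \<le> n" for n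
  proof -
    let ?J = "i * 2 ^ (n - m)"
    let ?w = "\<lambda>l. W (real l * (1 / 2 ^ n)) \<omega>"
    have pw: "(2::real) ^ n = 2 ^ m * 2 ^ (n - m)" using that by (simp flip: power_add)
    have J: "real ?J / 2 ^ n = T" by (simp add: T_def pw)
    \<comment> \<open>The indicator of a half-open interval is the difference of two tails, each of
      which telescopes.\<close>
    have ind: "indicator {t k<..t (Suc k)} (real l / 2 ^ n) *\<^sub>R (?w (Suc l) - ?w l) =
      (if nat \<lfloor>t k * 2 ^ n\<rfloor> + 1 \<le> l then ?w (Suc l) - ?w l else 0) -
      (if nat \<lfloor>t (Suc k) * 2 ^ n\<rfloor> + 1 \<le> l then ?w (Suc l) - ?w l else 0)" if k: "k < N" for k l
    proof -
      have *: "nat \<lfloor>u * 2 ^ n\<rfloor> + 1 \<le> l \<longleftrightarrow> u < real l / 2 ^ n" if "0 \<le> u" for u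
      proof -
        have "nat \<lfloor>u * 2 ^ n\<rfloor> + 1 \<le> l \<longleftrightarrow> \<lfloor>u * 2 ^ n\<rfloor> < int l"
          using that nat_less_iff[of "\<lfloor>u * 2 ^ n\<rfloor>" l] by (simp add: Suc_le_eq)
        also have "\<dots> \<longleftrightarrow> u < real l / 2 ^ n" by (simp add: floor_less_iff field_simps)
        finally show ?thesis .
      qed
      show ?thesis using *[OF t0[of k]] *[OF t0[of "Suc k"]] k mono[OF k]
        by (simp only:) (auto simp: indicator_def)
    qed
    have above: "(\<Sum>l<?J. if nat \<lfloor>u * 2 ^ n\<rfloor> + 1 \<le> l then ?w (Suc l) - ?w l else 0) = W T \<omega> - W (min T (r n u)) \<omega>" for u
    proof -
      have "real (min ?J (nat \<lfloor>u * 2 ^ n\<rfloor> + 1)) * (1 / 2 ^ n) = min T (r n u)"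
        unfolding J[symmetric] r_def by (auto simp: min_def divide_le_cancel simp del: of_nat_add of_nat_mult)
      moreover have "real ?J * (1 / 2 ^ n) = T" using J by simp
      ultimately show ?thesis using sum_increments_above[of "nat \<lfloor>u * 2 ^ n\<rfloor> + 1" ?w ?J] by (simp only:)
    qed
    have "grid_sum n (simple_value N t \<xi>) ?J \<omega> =
      (\<Sum>l<?J. \<Sum>k<N. \<xi> k \<omega> *v (indicator {t k<..t (Suc k)} (real l / 2 ^ n) *\<^sub>R (?w (Suc l) - ?w l)))"
      unfolding incr_sum_def simple_value_def
      by (simp add: sum_matrix_vector_mult scaleR_matrix_vector_assoc[symmetric] matrix_vector_mult_scaleR)
    also have "\<dots> = (\<Sum>k<N. \<xi> k \<omega> *v (\<Sum>l<?J. indicator {t k<..t (Suc k)} (real l / 2 ^ n) *\<^sub>R (?w (Suc l) - ?w l)))"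
      by (subst sum.swap) (simp only: linear_sum[OF matrix_vector_mul_linear])
    also have "\<dots> = (\<Sum>k<N. \<xi> k \<omega> *v (W (min T (r n (t (Suc k)))) \<omega> - W (min T (r n (t k))) \<omega>))"
      by (intro sum.cong refl arg_cong[where f="\<lambda>x. _ *v x"])
         (simp only: ind sum_subtractf above lessThan_iff, simp)
    finally show ?thesis .
  qed
  have "(\<lambda>n. \<Sum>k<N. \<xi> k \<omega> *v (W (min T (r n (t (Suc k)))) \<omega> - W (min T (r n (t k))) \<omega>))
     \<longlonglongrightarrow> simple_integral_W W N t \<xi> T \<omega>"
    unfolding simple_integral_W_def
    by (intro tendsto_sum bounded_linear.tendsto[OF matrix_vector_mul_bounded_linear] tendsto_diff W_lim t0) auto
  then show ?thesis unfolding T_def[symmetric]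
    by (rule Lim_transform_eventually)
       (use sum_eq in \<open>auto simp: eventually_sequentially intro!: exI[of _ m]\<close>)
qed

lemma left_regular_dyadic_floor_adapted:
  assumes "left_regular v" "0 \<le> s"
  shows "(\<lambda>\<omega>. floored n v \<omega> s) \<in> borel_measurable (F s)"
proof -
  let ?r = "real (nat \<lfloor>s * 2 ^ n\<rfloor>) / 2 ^ n"
  have "?r \<le> s" using assms(2) by (simp add: divide_le_eq)
  moreover have "v ?r \<in> borel_measurable (F ?r)" using assms by (simp add: left_regular_def)
  ultimately show ?thesis unfolding dyadic_floor_def by (rule measurable_F_mono[rotated])
qed

text \<open>The maximal inequality for the difference of two integrands, with the energy rewritten
  as the squared distance of the sampled paths.\<close>

lemma prob_grid_sum_diff_le:
  fixes v w :: "real \<Rightarrow> 'a \<Rightarrow> real^'d^'n"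
  assumes v: "\<And>s. 0 \<le> s \<Longrightarrow> v s \<in> borel_measurable (F s)"
    and w: "\<And>s. 0 \<le> s \<Longrightarrow> w s \<in> borel_measurable (F s)"
    and "0 < \<epsilon>" "0 < \<eta>"
  shows "prob {\<omega>\<in>space M. \<exists>l\<le>J. \<epsilon> < norm (grid_sum n v l \<omega> - grid_sum n w l \<omega>)}
    \<le> prob (far (real J / 2 ^ n) \<eta> (floored n v) (floored n w)) + \<eta> / \<epsilon>\<^sup>2"
proof -
  have "(\<lambda>\<omega>. v (real l / 2 ^ n) \<omega> - w (real l / 2 ^ n) \<omega>) \<in> borel_measurable (F (real l * (1 / 2 ^ n)))" for l
    using v[of "real l / 2 ^ n"] w[of "real l / 2 ^ n"] by simp
  from incr_sum_maximal_inequality[OF _ \<open>0 < \<epsilon>\<close> \<open>0 < \<eta>\<close> this, of J]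
  show ?thesis using \<open>0 < \<eta>\<close> by (simp add: incr_sum_diff sq_dist_dyadic_floor ennreal_less_iff)
qed

lemma grid_sum_measurable:
  assumes "left_regular v"
  shows "grid_sum n v l \<in> borel_measurable M"
  using assms by (intro measurable_F_M[OF incr_sum_measurable]) (auto simp: left_regular_def)

lemma sq_dist_triangle_left_regular:
  fixes v w x :: "real \<Rightarrow> 'a \<Rightarrow> 'b::euclidean_space"
  assumes "left_regular v" "left_regular w" "left_regular x" "\<omega> \<in> space M"
  shows "sq_dist T (floored n v \<omega>) (floored n' w \<omega>) \<le>
     2 * sq_dist T (floored n v \<omega>) (path x \<omega>) + 2 * sq_dist T (floored n' w \<omega>) (path x \<omega>)"
    and "sq_dist T (floored n v \<omega>) (path w \<omega>) \<le>
     2 * sq_dist T (floored n v \<omega>) (path x \<omega>) + 2 * sq_dist T (path w \<omega>) (path x \<omega>)"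
  by (intro sq_dist_triangle left_regular_path_measurable assms)+

text \<open>The sum for \<open>H\<close> at level \<open>n\<close> is rewritten as a sum at a finer
  level \<open>n'\<close> and compared there with a simple process \<open>V j\<close> from the
  definition of the integral. The limits are taken in the order \<open>n'\<close>, \<open>j\<close>,
  \<open>n\<close>. A dyadic end time lies on every grid from level \<open>m\<close> on.\<close>

lemma grid_sum_tendsto_ito:
  fixes H :: "real \<Rightarrow> 'a \<Rightarrow> real^'d^'n"
  assumes H: "left_regular H" and I: "has_ito_integral M F W H (real i / 2 ^ m) I" and "0 < \<epsilon>"
  shows "(\<lambda>n. prob {\<omega>\<in>space M. \<epsilon> < norm (grid_sum n H (i * 2 ^ (n - m)) \<omega> - I \<omega>)}) \<longlonglongrightarrow> 0"
proof -
  define T where "T = real i / 2 ^ m"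
  \<comment> \<open>One third each for replacing the sampled \<open>H\<close> by \<open>V j\<close>,
    the sum of \<open>V j\<close> by its integral, and that integral by \<open>I\<close>.\<close>
  define e where "e = \<epsilon> / 3"
  have e: "0 < e" "\<epsilon> = 3 * e" using \<open>0 < \<epsilon>\<close> by (auto simp: e_def)
  obtain N t \<xi> where simple: "\<And>j. simple_process F (N j) (t j) (\<xi> j)"
    and null1: "null_in_prob M (\<lambda>j \<omega>. \<integral>\<^sup>+ s\<in>{0..T}. ennreal ((norm (simple_value (N j) (t j) (\<xi> j) s \<omega> - H s \<omega>))\<^sup>2) \<partial>lborel)"
    and null2: "null_in_prob M (\<lambda>j \<omega>. ennreal (norm (simple_integral_W W (N j) (t j) (\<xi> j) T \<omega> - I \<omega>)))"
    and Im: "I \<in> borel_measurable M"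
    using I unfolding has_ito_integral_def T_def by blast
  define V where "V j = simple_value (N j) (t j) (\<xi> j)" for j
  define S where "S j = simple_integral_W W (N j) (t j) (\<xi> j) T" for j
  have V: "left_regular (V j)" for j unfolding V_def by (rule simple_value_left_regular[OF simple])
  have SM: "S j \<in> borel_measurable M" for j
  proof -
    note t0 = simple_process_times_nonneg[OF simple, of _ j]
    have "\<xi> j k \<in> borel_measurable M" if "k < N j" for k
      using simple[of j] that by (auto simp: simple_process_def intro: measurable_F_M)
    then show ?thesis unfolding S_def simple_integral_W_def[abs_def] using t0
      by (intro borel_measurable_sum measurable_matrix_vector_mult' borel_measurable_diff W_measurable) (auto simp: T_def)
  qed
  let ?J = "\<lambda>n. i * 2 ^ (n - m)"
  have J: "real (?J n) / 2 ^ n = T" if "m \<le> n" for n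
    using that by (simp add: T_def field_simps flip: power_add)
  let ?P = "\<lambda>n. prob {\<omega>\<in>space M. \<epsilon> < norm (grid_sum n H (?J n) \<omega> - I \<omega>)}"
  \<comment> \<open>Two nested uses of \<open>sq_dist_triangle\<close> weight the three distances by
    4, 4 and 2; ten twelfths of \<eta> stay below \<eta>.\<close>
  let ?p1 = "\<lambda>\<eta> n. prob (far T (\<eta> / 12) (floored n H) (path H))"
  let ?p2 = "\<lambda>\<eta> j. prob (far T (\<eta> / 12) (path (V j)) (path H))"
  let ?p3 = "\<lambda>\<eta> j n. prob (far T (\<eta> / 12) (floored n (V j)) (path (V j)))"
  let ?p4 = "\<lambda>j n. prob {\<omega>\<in>space M. e < norm (grid_sum n (V j) (?J n) \<omega> - S j \<omega>)}"
  let ?p5 = "\<lambda>j. prob {\<omega>\<in>space M. e < norm (S j \<omega> - I \<omega>)}"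
  note sqm = sq_dist_measurable[OF left_regular_joint_measurable(1)[OF H] left_regular_joint_measurable(2)[OF H]]
    sq_dist_measurable[OF left_regular_joint_measurable(2)[OF V] left_regular_joint_measurable(2)[OF H]]
    sq_dist_measurable[OF left_regular_joint_measurable(1)[OF V] left_regular_joint_measurable(2)[OF V]]
  have bound: "?P n \<le> ?p1 \<eta> n + ?p2 \<eta> j + ?p3 \<eta> j n' + \<eta> / e\<^sup>2 + ?p4 j n' + ?p5 j"
    if n: "m \<le> n" "n \<le> n'" and \<eta>: "0 < \<eta>" for \<eta> n n' j
  proof -
    let ?H = "\<lambda>s \<omega>. floored n H \<omega> s"
    let ?A = "{\<omega>\<in>space M. \<exists>l\<le>?J n'. e < norm (grid_sum n' ?H l \<omega> - grid_sum n' (V j) l \<omega>)}"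
    have Hm: "?H s \<in> borel_measurable (F s)" if "0 \<le> s" for s
      by (rule left_regular_dyadic_floor_adapted[OF H that])
    have Vm: "V j s \<in> borel_measurable (F s)" if "0 \<le> s" for s
      using V that by (auto simp: left_regular_def)
    have HM: "grid_sum n' ?H l \<in> borel_measurable M" for l
      using Hm by (intro measurable_F_M[OF incr_sum_measurable]) auto
    note [measurable] = HM grid_sum_measurable[OF H] grid_sum_measurable[OF V] Im SM sqm
    have "(2::nat) ^ (n - m) * 2 ^ (n' - n) = 2 ^ (n' - m)" using n by (simp flip: power_add)
    then have Jn: "?J n * 2 ^ (n' - n) = ?J n'" by (simp only: mult.assoc)
    have ref: "grid_sum n H (?J n) \<omega> = grid_sum n' ?H (?J n') \<omega>" for \<omega>
      using grid_sum_refine[OF n(2), of H "?J n" \<omega>] unfolding Jn by (rule sym)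
    have A: "prob ?A \<le> prob (far T \<eta> (floored n H) (floored n' (V j))) + \<eta> / e\<^sup>2"
      using prob_grid_sum_diff_le[OF Hm Vm e(1) \<eta>, of "?J n'" n'] n
      by (simp only: J dyadic_floor_dyadic_floor order_trans[OF n])
    have B: "(far T \<eta> (floored n H) (floored n' (V j)))
      \<subseteq> (far T (\<eta> / 12) (floored n H) (path H))
      \<union> (far T (\<eta> / 12) (path (V j)) (path H))
      \<union> (far T (\<eta> / 12) (floored n' (V j)) (path (V j)))"
      (is "_ \<subseteq> ?B1 \<union> ?B2 \<union> ?B3")
    proof (rule subsetI, rule ccontr)
      fix \<omega> assume \<omega>: "\<omega> \<in> (far T \<eta> (floored n H) (floored n' (V j)))"
        and "\<omega> \<notin> ?B1 \<union> ?B2 \<union> ?B3"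
      then have le: "sq_dist T (floored n H \<omega>) (path H \<omega>) \<le> ennreal (\<eta> / 12)"
        "sq_dist T (path (V j) \<omega>) (path H \<omega>) \<le> ennreal (\<eta> / 12)"
        "sq_dist T (floored n' (V j) \<omega>) (path (V j) \<omega>) \<le> ennreal (\<eta> / 12)"
        and sp: "\<omega> \<in> space M" by (auto simp: not_less)
      have "sq_dist T (floored n H \<omega>) (floored n' (V j) \<omega>)
        \<le> 2 * sq_dist T (floored n H \<omega>) (path (V j) \<omega>) + 2 * sq_dist T (floored n' (V j) \<omega>) (path (V j) \<omega>)"
        by (rule sq_dist_triangle_left_regular(1)[OF H V V sp])
      also have "\<dots> \<le> 2 * (2 * sq_dist T (floored n H \<omega>) (path H \<omega>) + 2 * sq_dist T (path (V j) \<omega>) (path H \<omega>))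
         + 2 * sq_dist T (floored n' (V j) \<omega>) (path (V j) \<omega>)"
        by (intro add_right_mono mult_left_mono sq_dist_triangle_left_regular(2)[OF H V H sp]) auto
      also have "\<dots> \<le> 2 * (2 * ennreal (\<eta> / 12) + 2 * ennreal (\<eta> / 12)) + 2 * ennreal (\<eta> / 12)"
        by (intro add_mono mult_left_mono le) auto
      also have "\<dots> = ennreal (2 * (2 * (\<eta> / 12) + 2 * (\<eta> / 12)) + 2 * (\<eta> / 12))"
        using \<eta> by (simp only: ennreal_double ennreal_plus[symmetric] add_nonneg_nonneg mult_nonneg_nonneg
              divide_nonneg_nonneg less_imp_le zero_le_numeral)
      also have "\<dots> \<le> ennreal \<eta>" using \<eta> by (intro ennreal_leI) simp
      finally show False using \<omega> by auto
    qed
    have "prob (far T \<eta> (floored n H) (floored n' (V j)))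
      \<le> prob (?B1 \<union> ?B2 \<union> ?B3)" by (rule finite_measure_mono[OF B]) measurable
    also have "\<dots> \<le> prob ?B1 + prob ?B2 + prob ?B3"
      by (intro order_trans[OF measure_Un_le] add_right_mono measure_Un_le) measurable
    finally have A': "prob ?A \<le> ?p1 \<eta> n + ?p2 \<eta> j + ?p3 \<eta> j n' + \<eta> / e\<^sup>2" using A by linarith
    let ?C4 = "{\<omega>\<in>space M. e < norm (grid_sum n' (V j) (?J n') \<omega> - S j \<omega>)}"
    let ?C5 = "{\<omega>\<in>space M. e < norm (S j \<omega> - I \<omega>)}"
    have "{\<omega>\<in>space M. \<epsilon> < norm (grid_sum n H (?J n) \<omega> - I \<omega>)} \<subseteq> ?A \<union> ?C4 \<union> ?C5"
    proof (rule subsetI, rule ccontr)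
      fix \<omega> assume \<omega>: "\<omega> \<in> {\<omega>\<in>space M. \<epsilon> < norm (grid_sum n H (?J n) \<omega> - I \<omega>)}" "\<omega> \<notin> ?A \<union> ?C4 \<union> ?C5"
      then have "norm (grid_sum n' ?H (?J n') \<omega> - grid_sum n' (V j) (?J n') \<omega>) \<le> e"
        "norm (grid_sum n' (V j) (?J n') \<omega> - S j \<omega>) \<le> e" "norm (S j \<omega> - I \<omega>) \<le> e"
        by (auto simp: not_less)
      then have "norm ((grid_sum n' ?H (?J n') \<omega> - grid_sum n' (V j) (?J n') \<omega>) +
         (grid_sum n' (V j) (?J n') \<omega> - S j \<omega>) + (S j \<omega> - I \<omega>)) \<le> e + e + e"
        by (intro norm_triangle_mono)
      then show False using \<omega>(1) unfolding ref e(2) by simp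
    qed
    then have "?P n \<le> prob (?A \<union> ?C4 \<union> ?C5)" by (rule finite_measure_mono) measurable
    also have "\<dots> \<le> prob ?A + prob ?C4 + prob ?C5"
      by (intro order_trans[OF measure_Un_le] add_right_mono measure_Un_le) measurable
    finally show ?thesis using A' by linarith
  qed
  have p2: "?p2 \<eta> \<longlonglongrightarrow> 0" if "0 < \<eta>" for \<eta>
    using null1 that unfolding null_in_prob_def V_def sq_dist_def by (auto dest: spec[of _ "\<eta> / 12"])
  have p5: "?p5 \<longlonglongrightarrow> 0"
    using null2 e unfolding null_in_prob_def S_def by (auto simp: ennreal_less_iff less_imp_le dest: spec[of _ e])
  have p3: "?p3 \<eta> j \<longlonglongrightarrow> 0" if "0 < \<eta>" for \<eta> j
    using prob_sq_dist_dyadic_floor_tendsto[OF V, of "\<eta> / 12"] that by simp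
  have p1: "?p1 \<eta> \<longlonglongrightarrow> 0" if "0 < \<eta>" for \<eta>
    using prob_sq_dist_dyadic_floor_tendsto[OF H, of "\<eta> / 12"] that by simp
  have p4: "?p4 j \<longlonglongrightarrow> 0" for j
  proof (rule prob_tendsto_zero)
    note [measurable] = grid_sum_measurable[OF V] SM
    show "{\<omega>\<in>space M. e < norm (grid_sum n (V j) (?J n) \<omega> - S j \<omega>)} \<in> events" for n by measurable
    show "AE \<omega> in M. \<forall>\<^sub>F n in sequentially. \<omega> \<notin> {\<omega>\<in>space M. e < norm (grid_sum n (V j) (?J n) \<omega> - S j \<omega>)}"
      using paths
    proof eventually_elim
      case (elim \<omega>)
      have "(\<lambda>n. grid_sum n (V j) (?J n) \<omega>) \<longlonglongrightarrow> S j \<omega>"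
        unfolding V_def S_def T_def by (rule grid_sum_simple_tendsto[OF simple elim])
      then have "\<forall>\<^sub>F n in sequentially. dist (grid_sum n (V j) (?J n) \<omega>) (S j \<omega>) < e"
        using e(1) by (rule tendstoD)
      then show ?case by eventually_elim (auto simp: dist_norm)
    qed
  qed
  \<comment> \<open>The left side does not depend on \<open>n'\<close>, so the two terms that do are
    removed by letting \<open>n'\<close> tend to infinity; \<open>bound2\<close> then removes
    \<open>j\<close> in the same way.\<close>
  have bound1: "?P n \<le> ?p1 \<eta> n + ?p2 \<eta> j + 0 + \<eta> / e\<^sup>2 + 0 + ?p5 j" if "m \<le> n" "0 < \<eta>" for \<eta> n j
  proof (rule LIMSEQ_le_const)
    show "(\<lambda>n'. ?p1 \<eta> n + ?p2 \<eta> j + ?p3 \<eta> j n' + \<eta> / e\<^sup>2 + ?p4 j n' + ?p5 j) \<longlonglongrightarrow> ?p1 \<eta> n + ?p2 \<eta> j + 0 + \<eta> / e\<^sup>2 + 0 + ?p5 j"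
      by (intro tendsto_add p3 p4 that tendsto_const)
    show "\<exists>k. \<forall>n'\<ge>k. ?P n \<le> ?p1 \<eta> n + ?p2 \<eta> j + ?p3 \<eta> j n' + \<eta> / e\<^sup>2 + ?p4 j n' + ?p5 j"
      using bound that by blast
  qed
  have bound2: "?P n \<le> ?p1 \<eta> n + 0 + 0 + \<eta> / e\<^sup>2 + 0 + 0" if "m \<le> n" "0 < \<eta>" for \<eta> n
  proof (rule LIMSEQ_le_const)
    show "(\<lambda>j. ?p1 \<eta> n + ?p2 \<eta> j + 0 + \<eta> / e\<^sup>2 + 0 + ?p5 j) \<longlonglongrightarrow> ?p1 \<eta> n + 0 + 0 + \<eta> / e\<^sup>2 + 0 + 0"
      by (intro tendsto_add p2 p5 that tendsto_const)
    show "\<exists>k. \<forall>j\<ge>k. ?P n \<le> ?p1 \<eta> n + ?p2 \<eta> j + 0 + \<eta> / e\<^sup>2 + 0 + ?p5 j"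
      using bound1 that by blast
  qed
  show ?thesis
  proof (rule prob_tendsto_zeroI[OF _ p1 e(1)])
    show "\<forall>\<^sub>F n in sequentially. ?P n \<le> ?p1 \<eta> n + \<eta> / e\<^sup>2" if "0 < \<eta>" for \<eta>
      using eventually_ge_at_top[of m] by eventually_elim (use bound2 that in simp)
  qed
qed

text \<open>Uniformity comes from the maximal inequality, applied to \<open>H\<close> and its
  samples on a finer grid. At the points of the coarse grid, finite in number for fixed
  \<open>n\<close>, the finer sums converge one by one by
  \<open>grid_sum_tendsto_ito\<close>.\<close>

lemma grid_sum_tendsto_ito_uniform:
  fixes H :: "real \<Rightarrow> 'a \<Rightarrow> real^'d^'n"
  assumes H: "left_regular H" and I: "\<And>t. 0 \<le> t \<Longrightarrow> has_ito_integral M F W H t (I t)" and "0 < \<epsilon>"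
  shows "(\<lambda>n. prob {\<omega>\<in>space M. \<exists>l\<le>K * 2 ^ n. \<epsilon> < norm (grid_sum n H l \<omega> - I (real l / 2 ^ n) \<omega>)}) \<longlonglongrightarrow> 0"
proof -
  define e where "e = \<epsilon> / 2"
  have e: "0 < e" "\<epsilon> = 2 * e" using \<open>0 < \<epsilon>\<close> by (auto simp: e_def)
  have Im: "I t \<in> borel_measurable M" if "0 \<le> t" for t using I[OF that] by (simp add: has_ito_integral_def)
  let ?P = "\<lambda>n. prob {\<omega>\<in>space M. \<exists>l\<le>K * 2 ^ n. \<epsilon> < norm (grid_sum n H l \<omega> - I (real l / 2 ^ n) \<omega>)}"
  \<comment> \<open>A single use of \<open>sq_dist_triangle\<close> weights both distances by 2,
    hence the quarters.\<close>
  let ?p = "\<lambda>\<eta> n. prob (far (real K) (\<eta> / 4) (floored n H) (path H))"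
  let ?C = "\<lambda>n n' l. {\<omega>\<in>space M. e < norm (grid_sum n' H (l * 2 ^ (n' - n)) \<omega> - I (real l / 2 ^ n) \<omega>)}"
  note sqm = sq_dist_measurable[OF left_regular_joint_measurable(1)[OF H] left_regular_joint_measurable(2)[OF H]]
    sq_dist_measurable[OF left_regular_joint_measurable(1)[OF H] left_regular_joint_measurable(1)[OF H]]
  have C_ev: "?C n n' l \<in> events" for n n' l
    using grid_sum_measurable[OF H] Im[of "real l / 2 ^ n"] by measurable
  have bound: "?P n \<le> ?p \<eta> n + ?p \<eta> n' + \<eta> / e\<^sup>2 + (\<Sum>l\<le>K * 2 ^ n. prob (?C n n' l))"
    if n: "n \<le> n'" and \<eta>: "0 < \<eta>" for \<eta> n n'
  proof -
    let ?H = "\<lambda>s \<omega>. floored n H \<omega> s"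
    let ?A = "{\<omega>\<in>space M. \<exists>l\<le>K * 2 ^ n'. e < norm (grid_sum n' ?H l \<omega> - grid_sum n' H l \<omega>)}"
    have Hfm: "?H s \<in> borel_measurable (F s)" if "0 \<le> s" for s
      by (rule left_regular_dyadic_floor_adapted[OF H that])
    have Hm: "H s \<in> borel_measurable (F s)" if "0 \<le> s" for s
      using H that by (auto simp: left_regular_def)
    have HM: "grid_sum n' ?H l \<in> borel_measurable M" for l
      using Hfm by (intro measurable_F_M[OF incr_sum_measurable]) auto
    note [measurable] = HM grid_sum_measurable[OF H] sqm
    have K: "real (K * 2 ^ n') / 2 ^ n' = real K" by simp
    have A: "prob ?A \<le> prob (far (real K) \<eta> (floored n H) (floored n' H)) + \<eta> / e\<^sup>2"
      using prob_grid_sum_diff_le[OF Hfm Hm e(1) \<eta>, of "K * 2 ^ n'" n'] n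
      by (simp only: K dyadic_floor_dyadic_floor)
    have B: "(far (real K) \<eta> (floored n H) (floored n' H))
      \<subseteq> (far (real K) (\<eta> / 4) (floored n H) (path H))
      \<union> (far (real K) (\<eta> / 4) (floored n' H) (path H))"
      (is "_ \<subseteq> ?B1 \<union> ?B2")
    proof (rule subsetI, rule ccontr)
      fix \<omega> assume \<omega>: "\<omega> \<in> (far (real K) \<eta> (floored n H) (floored n' H))"
        and "\<omega> \<notin> ?B1 \<union> ?B2"
      then have le: "sq_dist (real K) (floored n H \<omega>) (path H \<omega>) \<le> ennreal (\<eta> / 4)"
        "sq_dist (real K) (floored n' H \<omega>) (path H \<omega>) \<le> ennreal (\<eta> / 4)"
        and sp: "\<omega> \<in> space M" by (auto simp: not_less)
      have "sq_dist (real K) (floored n H \<omega>) (floored n' H \<omega>)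
        \<le> 2 * sq_dist (real K) (floored n H \<omega>) (path H \<omega>) + 2 * sq_dist (real K) (floored n' H \<omega>) (path H \<omega>)"
        by (rule sq_dist_triangle_left_regular(1)[OF H H H sp])
      also have "\<dots> \<le> 2 * ennreal (\<eta> / 4) + 2 * ennreal (\<eta> / 4)"
        by (intro add_mono mult_left_mono le) auto
      also have "\<dots> = ennreal (2 * (\<eta> / 4) + 2 * (\<eta> / 4))"
        using \<eta> by (simp only: ennreal_double ennreal_plus[symmetric] mult_nonneg_nonneg
              divide_nonneg_nonneg less_imp_le zero_le_numeral)
      also have "\<dots> = ennreal \<eta>" by simp
      finally show False using \<omega> by auto
    qed
    have "prob (far (real K) \<eta> (floored n H) (floored n' H))
      \<le> prob (?B1 \<union> ?B2)" by (rule finite_measure_mono[OF B]) measurable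
    also have "\<dots> \<le> prob ?B1 + prob ?B2" by (intro measure_Un_le) measurable
    finally have A': "prob ?A \<le> ?p \<eta> n + ?p \<eta> n' + \<eta> / e\<^sup>2" using A by linarith
    have "{\<omega>\<in>space M. \<exists>l\<le>K * 2 ^ n. \<epsilon> < norm (grid_sum n H l \<omega> - I (real l / 2 ^ n) \<omega>)} \<subseteq> ?A \<union> (\<Union>l\<le>K * 2 ^ n. ?C n n' l)"
    proof (rule subsetI, rule ccontr)
      fix \<omega> assume \<omega>: "\<omega> \<in> {\<omega>\<in>space M. \<exists>l\<le>K * 2 ^ n. \<epsilon> < norm (grid_sum n H l \<omega> - I (real l / 2 ^ n) \<omega>)}"
        "\<omega> \<notin> ?A \<union> (\<Union>l\<le>K * 2 ^ n. ?C n n' l)"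
      then obtain l where l: "l \<le> K * 2 ^ n" "\<epsilon> < norm (grid_sum n H l \<omega> - I (real l / 2 ^ n) \<omega>)" and sp: "\<omega> \<in> space M" by auto
      have "l * 2 ^ (n' - n) \<le> K * 2 ^ n * 2 ^ (n' - n)" using l by simp
      also have "\<dots> = K * 2 ^ n'" using n by (simp flip: power_add)
      finally have "norm (grid_sum n' ?H (l * 2 ^ (n' - n)) \<omega> - grid_sum n' H (l * 2 ^ (n' - n)) \<omega>) \<le> e"
        using \<omega> sp by (auto simp: not_less)
      moreover have "norm (grid_sum n' H (l * 2 ^ (n' - n)) \<omega> - I (real l / 2 ^ n) \<omega>) \<le> e"
        using \<omega>(2) sp l(1) by (auto simp: not_less)
      ultimately have "norm ((grid_sum n' ?H (l * 2 ^ (n' - n)) \<omega> - grid_sum n' H (l * 2 ^ (n' - n)) \<omega>) +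
         (grid_sum n' H (l * 2 ^ (n' - n)) \<omega> - I (real l / 2 ^ n) \<omega>)) \<le> e + e"
        by (rule norm_triangle_mono)
      then show False using l(2) unfolding grid_sum_refine[OF n] e(2) by simp
    qed
    then have "?P n \<le> prob (?A \<union> (\<Union>l\<le>K * 2 ^ n. ?C n n' l))"
      by (rule finite_measure_mono) (intro sets.Un sets.finite_UN C_ev, measurable)
    also have "\<dots> \<le> prob ?A + prob (\<Union>l\<le>K * 2 ^ n. ?C n n' l)"
      by (intro measure_Un_le sets.finite_UN C_ev) measurable
    also have "prob (\<Union>l\<le>K * 2 ^ n. ?C n n' l) \<le> (\<Sum>l\<le>K * 2 ^ n. prob (?C n n' l))"
      by (rule finite_measure_subadditive_finite) (use C_ev in auto)
    finally show ?thesis using A' by linarith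
  qed
  have p: "?p \<eta> \<longlonglongrightarrow> 0" if "0 < \<eta>" for \<eta>
    using prob_sq_dist_dyadic_floor_tendsto[OF H, of "\<eta> / 4"] that by simp
  have c: "(\<lambda>n'. prob (?C n n' l)) \<longlonglongrightarrow> 0" for n l
    by (rule grid_sum_tendsto_ito[OF H I e(1)]) simp
  have bound1: "?P n \<le> ?p \<eta> n + 0 + \<eta> / e\<^sup>2 + (\<Sum>l\<le>K * 2 ^ n. 0)" if "0 < \<eta>" for \<eta> n
  proof (rule LIMSEQ_le_const)
    show "(\<lambda>n'. ?p \<eta> n + ?p \<eta> n' + \<eta> / e\<^sup>2 + (\<Sum>l\<le>K * 2 ^ n. prob (?C n n' l))) \<longlonglongrightarrow> ?p \<eta> n + 0 + \<eta> / e\<^sup>2 + (\<Sum>l\<le>K * 2 ^ n. 0)"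
      by (intro tendsto_add tendsto_sum c p that tendsto_const)
    show "\<exists>k. \<forall>n'\<ge>k. ?P n \<le> ?p \<eta> n + ?p \<eta> n' + \<eta> / e\<^sup>2 + (\<Sum>l\<le>K * 2 ^ n. prob (?C n n' l))"
      using bound that by blast
  qed
  show ?thesis
  proof (rule prob_tendsto_zeroI[OF _ p e(1)])
    show "\<forall>\<^sub>F n in sequentially. ?P n \<le> ?p \<eta> n + \<eta> / e\<^sup>2" if "0 < \<eta>" for \<eta>
      using bound1[OF that] by (intro always_eventually allI) simp
  qed
qed

end

section \<open>A test function and its second-order expansion\<close>

text \<open>The exponent is at least 2, so the difference quotient at the kink is at most
  \<open>\<bar>h\<bar> ^ Suc n\<close> and tends to 0.\<close>

lemma DERIV_max_0_power: "DERIV (\<lambda>r::real. (max 0 r) ^ Suc (Suc n)) r :> real (Suc (Suc n)) * (max 0 r) ^ Suc n"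
proof (cases r "0::real" rule: linorder_cases)
  case less
  have "((\<lambda>r::real. 0) has_field_derivative 0) (at r)" by simp
  then have "((\<lambda>r::real. (max 0 r) ^ Suc (Suc n)) has_field_derivative 0) (at r)"
    by (rule has_field_derivative_transform_within_open[where S="{..<0}"]) (use less in auto)
  then show ?thesis using less by simp
next
  case greater
  have "((\<lambda>r::real. r ^ Suc (Suc n)) has_field_derivative real (Suc (Suc n)) * r ^ Suc n) (at r)"
    using DERIV_pow[of "Suc (Suc n)" r] by simp
  then have "((\<lambda>r::real. (max 0 r) ^ Suc (Suc n)) has_field_derivative real (Suc (Suc n)) * r ^ Suc n) (at r)"
    by (rule has_field_derivative_transform_within_open[where S="{0<..}"]) (use greater in auto)
  then show ?thesis using greater by simp
next
  case equal
  have "((\<lambda>h::real. (max 0 (0 + h)) ^ Suc (Suc n) / h) \<longlongrightarrow> 0) (at 0)"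
  proof (rule Lim_null_comparison)
    have "norm ((max 0 (0 + h)) ^ Suc (Suc n) / h) \<le> \<bar>h\<bar> ^ Suc n" for h :: real
    proof (cases "h \<le> 0")
      case True
      then have "max 0 (0 + h) = 0" by simp
      then show ?thesis by (simp del: power_Suc add: zero_le_power_abs power_0_Suc)
    qed simp
    then show "\<forall>\<^sub>F h in at (0::real). norm ((max 0 (0 + h)) ^ Suc (Suc n) / h) \<le> \<bar>h\<bar> ^ Suc n" by simp
    have "((\<lambda>h::real. \<bar>h\<bar> ^ Suc n) \<longlongrightarrow> \<bar>0\<bar> ^ Suc n) (at 0)" by (intro tendsto_intros)
    then show "((\<lambda>h::real. \<bar>h\<bar> ^ Suc n) \<longlongrightarrow> 0) (at 0)" by simp
  qed
  then show ?thesis unfolding DERIV_def equal by simp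
qed

text \<open>The exponential is multiplied by a twice continuously differentiable step that is 1 on
  the nonnegative numbers and 0 below -1. Only the values at nonnegative arguments and the vanishing
  below -1 matter afterwards.\<close>

lemma exp_cutoff:
  obtains \<Psi> \<Psi>' \<Psi>'' :: "real \<Rightarrow> real" where
    "\<And>r. DERIV \<Psi> r :> \<Psi>' r" "\<And>r. DERIV \<Psi>' r :> \<Psi>'' r" "continuous_on UNIV \<Psi>''"
    "\<And>r. 0 \<le> \<Psi> r"
    "\<And>r. 0 \<le> r \<Longrightarrow> \<Psi> r = exp (- b * r)" "\<And>r. 0 \<le> r \<Longrightarrow> \<Psi>' r = - b * exp (- b * r)"
    "\<And>r. 0 \<le> r \<Longrightarrow> \<Psi>'' r = b\<^sup>2 * exp (- b * r)"
    "\<And>r. r \<le> -1 \<Longrightarrow> \<Psi> r = 0 \<and> \<Psi>' r = 0 \<and> \<Psi>'' r = 0"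
proof -
  \<comment> \<open>The cube is the lowest integer power of the positive part with a continuous
    second derivative.\<close>
  define p p' p'' where "p r = (max 0 r) ^ 3" and "p' r = 3 * (max 0 r)\<^sup>2" and "p'' r = 6 * max 0 r" for r :: real
  have dp: "DERIV p r :> p' r" for r
    using DERIV_max_0_power[of 1 r] by (simp add: p_def[abs_def] p'_def numeral_eq_Suc)
  have dp': "DERIV p' r :> p'' r" for r
    unfolding p'_def[abs_def] p''_def
    by (rule derivative_eq_intros DERIV_max_0_power[of 0 r, folded numeral_2_eq_2] refl)+ (simp add: numeral_2_eq_2)
  have cp: "continuous_on UNIV p" "continuous_on UNIV p'" "continuous_on UNIV p''"
    unfolding p_def[abs_def] p'_def[abs_def] p''_def[abs_def] by (intro continuous_intros)+
  \<comment> \<open>For \<open>r \<ge> 0\<close> the inner \<open>p (- r)\<close> vanishes and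
    \<open>s\<close> is 1; for \<open>r \<le> -1\<close> it is at least 1 and the outer
    \<open>p\<close> vanishes.\<close>
  define s s' s'' where "s r = p (1 - p (- r))" and "s' r = p' (1 - p (- r)) * p' (- r)"
    and "s'' r = p'' (1 - p (- r)) * (p' (- r))\<^sup>2 - p' (1 - p (- r)) * p'' (- r)" for r
  have ds: "DERIV s r :> s' r" for r
    unfolding s_def[abs_def] s'_def
    by (rule derivative_eq_intros DERIV_chain2[OF dp] refl)+ simp
  have ds': "DERIV s' r :> s'' r" for r
    unfolding s'_def[abs_def] s''_def
    by (rule derivative_eq_intros DERIV_chain2[OF dp] DERIV_chain2[OF dp'] refl)+ (simp add: power2_eq_square algebra_simps)
  have s_pos: "s r = 1 \<and> s' r = 0 \<and> s'' r = 0" if "0 \<le> r" for r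
    using that by (simp add: s_def s'_def s''_def p_def p'_def p''_def max_def)
  have s_neg: "s r = 0 \<and> s' r = 0 \<and> s'' r = 0" if "r \<le> -1" for r
  proof -
    have "1 \<le> max 0 (- r)" using that by simp
    then have "1 - p (- r) \<le> 0" unfolding p_def by (metis diff_le_0_iff_le one_le_power)
    then show ?thesis by (simp add: s_def s'_def s''_def p_def[of "1 - _"] p'_def[of "1 - _"] p''_def[of "1 - _"])
  qed
  define \<Psi> \<Psi>' \<Psi>'' where "\<Psi> r = exp (- b * r) * s r" and "\<Psi>' r = exp (- b * r) * (s' r - b * s r)"
    and "\<Psi>'' r = exp (- b * r) * (s'' r - 2 * b * s' r + b\<^sup>2 * s r)" for r
  have "DERIV \<Psi> r :> \<Psi>' r" for r
    unfolding \<Psi>_def[abs_def] \<Psi>'_def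
    by (rule derivative_eq_intros ds refl)+ (simp add: algebra_simps)
  moreover have "DERIV \<Psi>' r :> \<Psi>'' r" for r
    unfolding \<Psi>'_def[abs_def] \<Psi>''_def
    by (rule derivative_eq_intros ds ds' refl)+ (simp add: algebra_simps power2_eq_square)
  moreover have "continuous_on UNIV \<Psi>''"
    unfolding \<Psi>''_def[abs_def] s_def[abs_def] s'_def[abs_def] s''_def[abs_def]
    by (intro continuous_intros continuous_on_compose2[OF cp(1)] continuous_on_compose2[OF cp(2)] continuous_on_compose2[OF cp(3)]) auto
  moreover have "0 \<le> \<Psi> r" for r by (simp add: \<Psi>_def s_def p_def)
  ultimately show thesis
    using s_pos s_neg by (intro that[of \<Psi> \<Psi>' \<Psi>'']) (auto simp: \<Psi>_def \<Psi>'_def \<Psi>''_def)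
qed

lemma compact_support_uniformly_continuous:
  fixes f :: "'a::euclidean_space \<Rightarrow> 'b::real_normed_vector"
  assumes c: "continuous_on UNIV f" and K: "compact K" and z: "\<And>x. x \<notin> K \<Longrightarrow> f x = 0"
  shows "uniformly_continuous_on UNIV f" and "\<exists>B\<ge>0. \<forall>x. norm (f x) \<le> B"
proof -
  obtain R where R: "\<And>x. x \<in> K \<Longrightarrow> norm x \<le> R"
    using compact_imp_bounded[OF K] by (auto simp: bounded_iff)
  have uc: "uniformly_continuous_on (cball 0 (R + 1)) f"
    by (intro compact_uniformly_continuous continuous_on_subset[OF c]) auto
  show "uniformly_continuous_on UNIV f"
    unfolding uniformly_continuous_on_def
  proof (intro allI impI)
    fix e :: real assume "0 < e"
    then obtain d where d: "0 < d" "\<And>x y. x \<in> cball 0 (R + 1) \<Longrightarrow> y \<in> cball 0 (R + 1) \<Longrightarrow> dist y x < d \<Longrightarrow> dist (f y) (f x) < e"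
      using uc unfolding uniformly_continuous_on_def by blast
    \<comment> \<open>The cap 1 matches the margin of the ball around the support: two points this
      close either both lie in the ball or both lie outside \<open>K\<close>.\<close>
    have "dist (f y) (f x) < e" if "dist y x < min d 1" for x y
    proof (cases "x \<in> cball 0 (R + 1) \<and> y \<in> cball 0 (R + 1)")
      case True then show ?thesis using d that by auto
    next
      case False
      have "norm x \<le> norm y + 1" "norm y \<le> norm x + 1"
        using that norm_triangle_ineq2[of x y] norm_triangle_ineq2[of y x] by (auto simp: dist_norm norm_minus_commute)
      then have "x \<notin> K" "y \<notin> K" using False R[of x] R[of y] by auto
      then show ?thesis using z \<open>0 < e\<close> by simp
    qed
    then show "\<exists>d>0. \<forall>x\<in>UNIV. \<forall>x'\<in>UNIV. dist x' x < d \<longrightarrow> dist (f x') (f x) < e"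
      using d(1) by (intro exI[of _ "min d 1"]) auto
  qed
  have "bounded (f ` K)" by (intro compact_imp_bounded compact_continuous_image continuous_on_subset[OF c] K) auto
  then obtain B where "\<And>x. x \<in> K \<Longrightarrow> norm (f x) \<le> B" by (auto simp: bounded_iff)
  then have "norm (f x) \<le> max 0 B" for x using z[of x] by (cases "x \<in> K") (auto simp: le_max_iff_disj)
  then show "\<exists>B\<ge>0. \<forall>x. norm (f x) \<le> B" by (intro exI[of _ "max 0 B"]) auto
qed

lemma C2_has_derivative:
  assumes "C2 h"
  shows "(h has_derivative (\<lambda>v. grad h x \<bullet> v)) (at x)" and "(grad h has_derivative (\<lambda>v. hessian h x *v v)) (at x)"
proof -
  have D: "(h has_derivative frechet_derivative h (at x)) (at x)"
    using assms unfolding C2_def frechet_derivative_works[symmetric] by blast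
  interpret bounded_linear "frechet_derivative h (at x)" by (rule has_derivative_bounded_linear[OF D])
  have "frechet_derivative h (at x) v = grad h x \<bullet> v" for v
  proof -
    have "frechet_derivative h (at x) v = frechet_derivative h (at x) (\<Sum>i\<in>UNIV. v $ i *\<^sub>R axis i 1)"
      using basis_expansion[of v] by (simp add: scalar_mult_eq_scaleR)
    also have "\<dots> = grad h x \<bullet> v" by (simp add: sum scaleR grad_def inner_vec_def mult.commute)
    finally show ?thesis .
  qed
  then have "frechet_derivative h (at x) = (\<lambda>v. grad h x \<bullet> v)" by (rule ext)
  with D show "(h has_derivative (\<lambda>v. grad h x \<bullet> v)) (at x)" by simp
  show "(grad h has_derivative (\<lambda>v. hessian h x *v v)) (at x)"
    using assms unfolding C2_def hessian_def jacobian_works[symmetric] by blast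
qed

text \<open>The rank-one matrix of products \<open>v v^T\<close>, which carries the second
  derivative of the outer function in the Hessian of a composition.\<close>

definition outer_square :: "real^'n \<Rightarrow> real^'n^'n" where
  "outer_square v = (\<chi> i j. v $ i * v $ j)"

lemma outer_square_mult: "outer_square v *v w = (v \<bullet> w) *\<^sub>R v"
  by (simp add: outer_square_def matrix_vector_mult_def inner_vec_def vec_eq_iff sum_distrib_left mult_ac)

lemma matrix_add_rdistrib: "((A::real^'d^'n) + B) ** (C::real^'k^'d) = A ** C + B ** C"
  by (simp add: vec_eq_iff matrix_matrix_mult_def distrib_right sum.distrib)

lemma trace_scaleR: "trace (c *\<^sub>R (A::real^'n^'n)) = c * trace A"
  by (simp add: trace_def sum_distrib_left)

text \<open>For the gradient of \<open>h\<close> this is twice \<open>H_op\<close>, the quantity on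
  the right of the barrier inequality.\<close>

lemma trace_sandwich_outer_square:
  "trace (transpose \<sigma> ** outer_square v ** \<sigma>) = (v v* \<sigma>) \<bullet> (v v* (\<sigma>::real^'d^'n))"
proof -
  have "trace (transpose \<sigma> ** outer_square v ** \<sigma>) =
    (\<Sum>j\<in>UNIV. \<Sum>k\<in>UNIV. (\<Sum>i\<in>UNIV. \<sigma>$i$j * (v$i * v$k)) * \<sigma>$k$j)"
    by (simp add: trace_def matrix_matrix_mult_def transpose_def outer_square_def)
  also have "\<dots> = (\<Sum>j\<in>UNIV. (\<Sum>i\<in>UNIV. v$i * \<sigma>$i$j) * (\<Sum>k\<in>UNIV. v$k * \<sigma>$k$j))"
    by (simp add: sum_product sum_distrib_right sum_distrib_left mult_ac)
  also have "\<dots> = (v v* \<sigma>) \<bullet> (v v* \<sigma>)"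
    by (simp add: inner_vec_def vector_matrix_mult_def mult.commute)
  finally show ?thesis .
qed

text \<open>\<open>D\<close> and \<open>Q\<close> are the gradient and the Hessian as explicit
  functions. The bounds and moduli of continuity are global because Euler sums with Gaussian steps
  may leave every bounded set.\<close>

locale test_function =
  fixes U :: "real^'n \<Rightarrow> real" and D :: "real^'n \<Rightarrow> real^'n" and Q :: "real^'n \<Rightarrow> real^'n^'n"
  assumes D1: "\<And>x. (U has_derivative (\<lambda>v. D x \<bullet> v)) (at x)"
    and D2: "\<And>x. (D has_derivative (\<lambda>v. Q x *v v)) (at x)"
    and uniform: "uniformly_continuous_on UNIV U" "uniformly_continuous_on UNIV D" "uniformly_continuous_on UNIV Q"
    and bounded: "\<exists>B\<ge>0. \<forall>x. \<bar>U x\<bar> \<le> B" "\<exists>B\<ge>0. \<forall>x. norm (D x) \<le> B" "\<exists>B\<ge>0. \<forall>x. norm (Q x) \<le> B"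
    and nonneg: "\<And>x. 0 \<le> U x"
begin

text \<open>No third derivative is available. For short \<open>v\<close> the uniform continuity of
  \<open>Q\<close> gives a small multiple of the square; for \<open>norm v \<ge> d\<close> the
  boundedness of \<open>Q\<close> gives a multiple of \<open>(norm v)\<^sup>2\<close>, which is at
  most \<open>(norm v)^4 / d\<^sup>2\<close>.\<close>

lemma taylor_bound:
  assumes "0 < \<epsilon>"
  shows "\<exists>C\<ge>0. \<forall>x v. U (x + v) \<le> U x + D x \<bullet> v + 1/2 * (v \<bullet> (Q x *v v)) + \<epsilon> * (norm v)\<^sup>2 + C * (norm v)^4"
proof -
  obtain d where d: "0 < d" "\<And>x y. dist y x < d \<Longrightarrow> dist (Q y) (Q x) < \<epsilon>"
    using uniform(3)[unfolded uniformly_continuous_on_def, rule_format, OF assms] by (metis UNIV_I)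
  obtain B where B: "0 \<le> B" "\<And>x. norm (Q x) \<le> B" using bounded(3) by blast
  have "U (x + v) \<le> U x + D x \<bullet> v + 1/2 * (v \<bullet> (Q x *v v)) + \<epsilon> * (norm v)\<^sup>2 + B / d\<^sup>2 * (norm v)^4" for x v
  proof -
    let ?diff = "\<lambda>(m::nat) s. if m = 0 then U (x + s *\<^sub>R v) else if m = 1 then D (x + s *\<^sub>R v) \<bullet> v else v \<bullet> (Q (x + s *\<^sub>R v) *v v)"
    have line: "((\<lambda>s. x + s *\<^sub>R v) has_derivative (\<lambda>s. s *\<^sub>R v)) (at s)" for s :: real
      by (auto intro!: derivative_eq_intros)
    have dU: "((\<lambda>s. U (x + s *\<^sub>R v)) has_field_derivative D (x + s *\<^sub>R v) \<bullet> v) (at s)" for s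
      using has_derivative_compose[OF line D1, of s] by (simp add: has_field_derivative_def mult.commute[of _ "D _ \<bullet> v"])
    have dD: "((\<lambda>s. D (x + s *\<^sub>R v) \<bullet> v) has_field_derivative v \<bullet> (Q (x + s *\<^sub>R v) *v v)) (at s)" for s
      using has_derivative_inner_left[OF has_derivative_compose[OF line D2, of s], of v]
      by (simp add: has_field_derivative_def matrix_vector_mult_scaleR inner_commute mult.commute[of _ "v \<bullet> _"])
    have "\<exists>t>0. t < 1 \<and> U (x + 1 *\<^sub>R v) = (\<Sum>m<2. ?diff m 0 / fact m * 1 ^ m) + ?diff 2 t / fact 2 * 1 ^ 2"
      by (rule Maclaurin[where f="\<lambda>s. U (x + s *\<^sub>R v)"]) (auto simp: less_2_cases_iff dU dD)
    then obtain t where t: "0 < t" "t < 1" and eq: "U (x + v) = U x + D x \<bullet> v + 1/2 * (v \<bullet> (Q (x + t *\<^sub>R v) *v v))"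
      by (auto simp: numeral_2_eq_2)
    have "v \<bullet> (Q (x + t *\<^sub>R v) *v v) - v \<bullet> (Q x *v v) = v \<bullet> ((Q (x + t *\<^sub>R v) - Q x) *v v)"
      by (simp add: matrix_vector_mult_diff_rdistrib inner_diff_right)
    also have "\<dots> \<le> norm v * (norm (Q (x + t *\<^sub>R v) - Q x) * norm v)"
      by (intro order_trans[OF norm_cauchy_schwarz] mult_left_mono norm_matrix_vector_le) auto
    also have "\<dots> \<le> 2 * (\<epsilon> * (norm v)\<^sup>2 + B / d\<^sup>2 * (norm v)^4)"
    proof (cases "norm v < d")
      case True
      have "norm (t *\<^sub>R v) < d" using t True by (simp add: order_le_less_trans[OF mult_left_le_one_le])
      then have "norm (Q (x + t *\<^sub>R v) - Q x) \<le> \<epsilon>" using d(2)[of "x + t *\<^sub>R v" x] by (simp add: dist_norm)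
      then have "norm v * (norm (Q (x + t *\<^sub>R v) - Q x) * norm v) \<le> norm v * (\<epsilon> * norm v)"
        by (intro mult_left_mono mult_right_mono) auto
      also have "\<dots> = \<epsilon> * (norm v)\<^sup>2" by (simp add: power2_eq_square)
      finally have "norm v * (norm (Q (x + t *\<^sub>R v) - Q x) * norm v) \<le> \<epsilon> * (norm v)\<^sup>2" .
      moreover have "0 \<le> B / d\<^sup>2 * (norm v)^4" "0 \<le> \<epsilon> * (norm v)\<^sup>2" using B assms by auto
      moreover have "x \<le> 2 * (p + q)" if "x \<le> p" "0 \<le> q" "0 \<le> p" for x p q :: real using that by simp
      ultimately show ?thesis by blast
    next
      case False
      have "norm (Q (x + t *\<^sub>R v) - Q x) \<le> 2 * B"
        using norm_triangle_ineq4[of "Q (x + t *\<^sub>R v)" "Q x"] B(2)[of x] B(2)[of "x + t *\<^sub>R v"] by simp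
      then have "norm v * (norm (Q (x + t *\<^sub>R v) - Q x) * norm v) \<le> norm v * (2 * B * norm v)"
        by (intro mult_left_mono mult_right_mono) auto
      also have "\<dots> = 2 * B * (norm v)\<^sup>2 * 1" by (simp add: power2_eq_square)
      also have "\<dots> \<le> 2 * B * (norm v)\<^sup>2 * ((norm v)\<^sup>2 / d\<^sup>2)"
        using False d(1) B by (intro mult_left_mono) (auto intro: power_mono)
      also have "\<dots> = 2 * (B / d\<^sup>2 * (norm v)^4)" by (simp add: power2_eq_square power4_eq_xxxx)
      also have "\<dots> \<le> 2 * (\<epsilon> * (norm v)\<^sup>2 + B / d\<^sup>2 * (norm v)^4)" using assms by simp
      finally show ?thesis .
    qed
    finally have "v \<bullet> (Q (x + t *\<^sub>R v) *v v) - v \<bullet> (Q x *v v) \<le> 2 * (\<epsilon> * (norm v)\<^sup>2 + B / d\<^sup>2 * (norm v)^4)" .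
    moreover have "p + 1/2 * y \<le> p + 1/2 * z + q + r" if "y - z \<le> 2 * (q + r)" for p q r y z :: real
      using that by simp
    ultimately show ?thesis unfolding eq by blast
  qed
  moreover have "0 \<le> B / d\<^sup>2" using B by simp
  ultimately show ?thesis by blast
qed

text \<open>Separates the deterministic displacement \<open>\<delta> *\<^sub>R A\<close> from the
  random \<open>G *v w\<close>: what is kept exactly has a computable mean, and the mixed terms are
  absorbed into \<epsilon> and \<open>C\<close>, with \<open>C\<close> uniform in the state, the
  coefficients and the step.\<close>

lemma euler_step_bound:
  assumes "0 < \<epsilon>" and K: "0 \<le> K"
  shows "\<exists>C\<ge>0. \<forall>x A (G::real^'d^'n) w \<delta>. 0 < \<delta> \<longrightarrow> \<delta> \<le> 1 \<longrightarrow> norm A \<le> K \<longrightarrow> norm G \<le> K \<longrightarrow>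
     U (x + \<delta> *\<^sub>R A + G *v w) \<le> U x + \<delta> * (D x \<bullet> A) + D x \<bullet> (G *v w) + 1/2 * ((G *v w) \<bullet> (Q x *v (G *v w)))
       + \<epsilon> * (norm w)\<^sup>2 + C * (\<delta>\<^sup>2 + (norm w)^4)"
proof -
  obtain B where B: "0 \<le> B" "\<And>x. norm (Q x) \<le> B" using bounded(3) by blast
  \<comment> \<open>Since \<open>(norm v)\<^sup>2 \<le> 2 * K\<^sup>2 * (\<delta>\<^sup>2 + (norm
    w)\<^sup>2)\<close>, this \<open>e\<close> uses half of \<epsilon>; the other half pays for the
    mixed quadratic term. The added 4 keeps the denominator positive when \<open>K\<close> is
    0.\<close>
  define e where "e = \<epsilon> / (4 * K\<^sup>2 + 4)"
  have pos: "0 < 4 * K\<^sup>2 + 4" by (simp add: add_nonneg_pos)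
  then have e: "0 < e" using assms by (simp add: e_def)
  have eK: "2 * e * K\<^sup>2 \<le> \<epsilon> / 2"
  proof -
    have "2 * K\<^sup>2 * \<epsilon> \<le> (2 * K\<^sup>2 + 2) * \<epsilon>" using assms by simp
    then show ?thesis using pos by (simp add: e_def field_simps)
  qed
  obtain C where C: "0 \<le> C" "\<And>x v. U (x + v) \<le> U x + D x \<bullet> v + 1/2 * (v \<bullet> (Q x *v v)) + e * (norm v)\<^sup>2 + C * (norm v)^4"
    using taylor_bound[OF e] by blast
  define c where "c = B * K\<^sup>2"
  have c: "0 \<le> c" using B by (simp add: c_def)
  define C' where "C' = c + c\<^sup>2 / (2 * \<epsilon>) + \<epsilon> + 8 * C * K^4"
  have "U (x + \<delta> *\<^sub>R A + G *v w) \<le> U x + \<delta> * (D x \<bullet> A) + D x \<bullet> (G *v w) + 1/2 * ((G *v w) \<bullet> (Q x *v (G *v w)))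
       + \<epsilon> * (norm w)\<^sup>2 + C' * (\<delta>\<^sup>2 + (norm w)^4)"
    if \<delta>: "0 < \<delta>" "\<delta> \<le> 1" and A: "norm A \<le> K" and G: "norm G \<le> K" for x A and G :: "real^'d^'n" and w \<delta>
  proof -
    let ?g = "G *v w" and ?n = "norm w"
    have g: "norm ?g \<le> K * ?n"
      by (rule order_trans[OF norm_matrix_vector_le]) (intro mult_right_mono G norm_ge_zero)
    have q: "p \<bullet> (Q x *v r) \<le> a * (B * b)" if "norm p \<le> a" "norm r \<le> b" for p r a b
    proof -
      have "p \<bullet> (Q x *v r) \<le> norm p * (norm (Q x) * norm r)"
        by (intro order_trans[OF norm_cauchy_schwarz] mult_left_mono norm_matrix_vector_le) auto
      also have "\<dots> \<le> a * (B * b)"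
        using that B order_trans[OF norm_ge_zero that(1)] by (intro mult_mono mult_nonneg_nonneg) auto
      finally show ?thesis .
    qed
    define v where "v = \<delta> *\<^sub>R A + ?g"
    have "v \<bullet> (Q x *v v) = \<delta>\<^sup>2 * (A \<bullet> (Q x *v A)) + \<delta> * (A \<bullet> (Q x *v ?g)) + \<delta> * (?g \<bullet> (Q x *v A)) + ?g \<bullet> (Q x *v ?g)"
      by (simp add: v_def matrix_vector_right_distrib matrix_vector_mult_scaleR inner_add power2_eq_square distrib_left)
    also have "\<dots> \<le> \<delta>\<^sup>2 * (K * (B * K)) + \<delta> * (K * (B * (K * ?n))) + \<delta> * (K * ?n * (B * K)) + ?g \<bullet> (Q x *v ?g)"
      using \<delta> by (intro add_right_mono add_mono mult_left_mono q A g) auto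
    also have "\<dots> = c * \<delta>\<^sup>2 + 2 * (c * \<delta>) * ?n + ?g \<bullet> (Q x *v ?g)" by (simp add: c_def power2_eq_square)
    \<comment> \<open>Young's inequality: the mixed term is neither small against \<delta> nor
      exactly computable, so it is split into a small multiple of the square of \<open>?n\<close>
      and a multiple of the square of \<delta>.\<close>
    also have "2 * (c * \<delta>) * ?n \<le> \<epsilon> * ?n\<^sup>2 + (c * \<delta>)\<^sup>2 / \<epsilon>"
    proof -
      have "0 \<le> (\<epsilon> * ?n - c * \<delta>)\<^sup>2 / \<epsilon>" using assms by simp
      also have "\<dots> = \<epsilon> * ?n\<^sup>2 + (c * \<delta>)\<^sup>2 / \<epsilon> - 2 * (c * \<delta>) * ?n"
        using assms by (simp add: power2_diff field_simps power2_eq_square)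
      finally show ?thesis by simp
    qed
    finally have quad: "1/2 * (v \<bullet> (Q x *v v)) \<le> 1/2 * (?g \<bullet> (Q x *v ?g)) + c / 2 * \<delta>\<^sup>2 + \<epsilon> / 2 * ?n\<^sup>2 + c\<^sup>2 / (2 * \<epsilon>) * \<delta>\<^sup>2"
      by (simp add: power_mult_distrib field_simps)
    have "norm v \<le> norm (\<delta> *\<^sub>R A) + norm ?g" unfolding v_def by (rule norm_triangle_ineq)
    also have "\<dots> \<le> K * \<delta> + K * ?n"
      using \<delta> by (intro add_mono g) (simp add: mult.commute[of K \<delta>] mult_left_mono A)
    finally have nv: "norm v \<le> K * (\<delta> + ?n)" by (simp add: distrib_left)
    have sq: "(\<delta> + ?n)\<^sup>2 \<le> 2 * (\<delta>\<^sup>2 + ?n\<^sup>2)"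
      using sum_squares_bound[of \<delta> ?n] by (simp add: power2_sum)
    have v2: "(norm v)\<^sup>2 \<le> K\<^sup>2 * (2 * (\<delta>\<^sup>2 + ?n\<^sup>2))"
      using power_mono[OF nv norm_ge_zero, of 2] mult_left_mono[OF sq, of "K\<^sup>2"] by (simp add: power_mult_distrib)
    have v4: "(norm v)^4 \<le> 8 * K^4 * (\<delta>\<^sup>2 + ?n^4)"
    proof -
      have "(norm v)^4 = ((norm v)\<^sup>2)\<^sup>2" by simp
      also have "\<dots> \<le> (K\<^sup>2 * (2 * (\<delta>\<^sup>2 + ?n\<^sup>2)))\<^sup>2" using v2 by (rule power_mono) simp
      also have "\<dots> = 4 * K^4 * (\<delta>\<^sup>2 + ?n\<^sup>2)\<^sup>2"
        unfolding power_mult_distrib by (simp only: power_mult[symmetric]) simp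
      also have "\<dots> \<le> 4 * K^4 * (2 * ((\<delta>\<^sup>2)\<^sup>2 + (?n\<^sup>2)\<^sup>2))"
        using sum_squares_bound[of "\<delta>\<^sup>2" "?n\<^sup>2"] by (intro mult_left_mono) (auto simp: power2_sum)
      also have "\<dots> \<le> 4 * K^4 * (2 * (\<delta>\<^sup>2 + (?n\<^sup>2)\<^sup>2))"
      proof -
        have "(\<delta>\<^sup>2)\<^sup>2 \<le> \<delta>\<^sup>2" using \<delta> power_le_one[of \<delta> 2] power_decreasing[of 1 2 "\<delta>\<^sup>2"] by simp
        then show ?thesis by (intro mult_left_mono) auto
      qed
      finally show ?thesis by (simp add: algebra_simps)
    qed
    have "e * (norm v)\<^sup>2 \<le> \<epsilon> / 2 * (\<delta>\<^sup>2 + ?n\<^sup>2)"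
    proof -
      have "e * (norm v)\<^sup>2 \<le> e * (K\<^sup>2 * (2 * (\<delta>\<^sup>2 + ?n\<^sup>2)))" using v2 e by (intro mult_left_mono) auto
      also have "\<dots> = 2 * e * K\<^sup>2 * (\<delta>\<^sup>2 + ?n\<^sup>2)" by simp
      also have "\<dots> \<le> \<epsilon> / 2 * (\<delta>\<^sup>2 + ?n\<^sup>2)" using eK by (rule mult_right_mono) simp
      finally show ?thesis .
    qed
    moreover have "C * (norm v)^4 \<le> C * (8 * K^4 * (\<delta>\<^sup>2 + ?n^4))" using v4 C by (intro mult_left_mono) auto
    ultimately have "U (x + v) \<le> U x + D x \<bullet> v + (1/2 * (?g \<bullet> (Q x *v ?g)) + c / 2 * \<delta>\<^sup>2 + \<epsilon> / 2 * ?n\<^sup>2 + c\<^sup>2 / (2 * \<epsilon>) * \<delta>\<^sup>2)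
       + \<epsilon> / 2 * (\<delta>\<^sup>2 + ?n\<^sup>2) + C * (8 * K^4 * (\<delta>\<^sup>2 + ?n^4))"
      using C(2)[of x v] quad by linarith
    also have "\<dots> = U x + D x \<bullet> v + 1/2 * (?g \<bullet> (Q x *v ?g)) + \<epsilon> * ?n\<^sup>2 +
       ((c / 2 + c\<^sup>2 / (2 * \<epsilon>) + \<epsilon> / 2 + 8 * C * K^4) * \<delta>\<^sup>2 + 8 * C * K^4 * ?n^4)"
      by (simp add: algebra_simps)
    also have "\<dots> \<le> U x + D x \<bullet> v + 1/2 * (?g \<bullet> (Q x *v ?g)) + \<epsilon> * ?n\<^sup>2 + (C' * \<delta>\<^sup>2 + C' * ?n^4)"
      using c C assms by (intro add_left_mono add_mono mult_right_mono) (auto simp: C'_def)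
    finally show ?thesis by (simp add: v_def inner_add_right distrib_left add.assoc)
  qed
  moreover have "0 \<le> C'" using c C assms by (simp add: C'_def)
  ultimately show ?thesis by blast
qed

end

text \<open>Composes the cutoff exponential with \<open>h\<close>. The support lies in
  \<open>{x. -1 \<le> h x}\<close>, which is compact by properness, and a continuous function with
  compact support is bounded and uniformly continuous.\<close>

lemma exp_test_function:
  fixes h :: "real^'n \<Rightarrow> real"
  assumes h: "C2 h" and K: "\<And>L. compact {x. L \<le> h x}"
  obtains U D Q where "test_function U D Q"
    "\<And>x. 0 \<le> h x \<Longrightarrow> U x = exp (- b * h x)"
    "\<And>x. 0 \<le> h x \<Longrightarrow> D x = (- b * exp (- b * h x)) *\<^sub>R grad h x"
    "\<And>x. 0 \<le> h x \<Longrightarrow> Q x = (- b * exp (- b * h x)) *\<^sub>R hessian h x + (b\<^sup>2 * exp (- b * h x)) *\<^sub>R outer_square (grad h x)"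
proof -
  obtain \<Psi> \<Psi>' \<Psi>'' :: "real \<Rightarrow> real" where
    d: "\<And>r. DERIV \<Psi> r :> \<Psi>' r" "\<And>r. DERIV \<Psi>' r :> \<Psi>'' r" and c: "continuous_on UNIV \<Psi>''" and nn: "\<And>r. 0 \<le> \<Psi> r"
    and pos: "\<And>r. 0 \<le> r \<Longrightarrow> \<Psi> r = exp (- b * r)" "\<And>r. 0 \<le> r \<Longrightarrow> \<Psi>' r = - b * exp (- b * r)"
    "\<And>r. 0 \<le> r \<Longrightarrow> \<Psi>'' r = b\<^sup>2 * exp (- b * r)"
    and neg: "\<And>r. r \<le> -1 \<Longrightarrow> \<Psi> r = 0 \<and> \<Psi>' r = 0 \<and> \<Psi>'' r = 0"
    by (rule exp_cutoff[of b], rule that, assumption+)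
  define U where "U x = \<Psi> (h x)" for x
  define D where "D x = \<Psi>' (h x) *\<^sub>R grad h x" for x
  define Q where "Q x = \<Psi>' (h x) *\<^sub>R hessian h x + \<Psi>'' (h x) *\<^sub>R outer_square (grad h x)" for x
  note dh = C2_has_derivative[OF h]
  have c1: "continuous_on UNIV h" "continuous_on UNIV (grad h)"
    using dh by (auto intro!: has_derivative_continuous_on[of UNIV] simp: has_derivative_at_withinI)
  have c2: "continuous_on UNIV (hessian h)" using h by (simp add: C2_def)
  have c\<Psi>: "continuous_on UNIV \<Psi>" "continuous_on UNIV \<Psi>'"
    using d by (auto intro!: DERIV_continuous_on intro: DERIV_subset)
  have D1: "(U has_derivative (\<lambda>v. D x \<bullet> v)) (at x)" for x
    unfolding U_def[abs_def] D_def
    using has_derivative_compose[OF dh(1) d(1)[unfolded has_field_derivative_def], of x] by simp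
  have D2: "(D has_derivative (\<lambda>v. Q x *v v)) (at x)" for x
    unfolding D_def[abs_def] Q_def
    using has_derivative_scaleR[OF has_derivative_compose[OF dh(1) d(2)[unfolded has_field_derivative_def], of x] dh(2)[of x]]
    by (simp add: matrix_vector_mult_add_rdistrib scaleR_matrix_vector_assoc[symmetric] outer_square_mult mult.commute)
  have cU: "continuous_on UNIV U" and cD: "continuous_on UNIV D" and cQ: "continuous_on UNIV Q"
    unfolding U_def[abs_def] D_def[abs_def] Q_def[abs_def] outer_square_def
    by (intro continuous_intros c2 continuous_on_compose2[OF c\<Psi>(1) c1(1)] continuous_on_compose2[OF c\<Psi>(2) c1(1)]
        continuous_on_compose2[OF c c1(1)] c1 | simp)+
  have z: "U x = 0" "D x = 0" "Q x = 0" if "x \<notin> {x. -1 \<le> h x}" for x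
    using neg[of "h x"] that by (auto simp: U_def D_def Q_def)
  note supp = compact_support_uniformly_continuous[OF cU K z(1)] compact_support_uniformly_continuous[OF cD K z(2)]
    compact_support_uniformly_continuous[OF cQ K z(3)]
  have "test_function U D Q"
    by standard (use D1 D2 supp nn in \<open>simp_all add: U_def[symmetric]\<close>, simp add: U_def nn)
  then show thesis by (rule that) (simp_all add: U_def D_def Q_def pos)
qed

text \<open>The left side is \<open>- b * exp (- b * h x)\<close> times the difference
  \<open>generator ... h x - b * H_op \<sigma> h x\<close>. The rank-one part of the Hessian
  produces the \<open>H_op\<close> term, which explains the form of the barrier condition.\<close>

lemma generator_exp_nonpos:
  fixes \<sigma> :: "real^'n \<Rightarrow> real^'d^'n"
  assumes b: "0 < b" and ge: "b * H_op \<sigma> h x \<le> generator f g \<sigma> (\<phi> x) (u\<^sub>o x) h x"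
    and D: "D = (- b * exp (- b * h x)) *\<^sub>R grad h x"
    and Q: "Q = (- b * exp (- b * h x)) *\<^sub>R hessian h x + (b\<^sup>2 * exp (- b * h x)) *\<^sub>R outer_square (grad h x)"
  shows "D \<bullet> closed_loop_drift f g u\<^sub>o \<phi> x + 1/2 * trace (transpose (\<sigma> x) ** Q ** \<sigma> x) \<le> 0"
proof -
  let ?e = "b * exp (- b * h x)"
  have drift: "grad h x \<bullet> closed_loop_drift f g u\<^sub>o \<phi> x = LD f g (\<phi> x) (u\<^sub>o x) h x"
    by (simp add: closed_loop_drift_def LD_def lie_vec_def lie_mat_def inner_add_right dot_lmul_matrix matrix_vector_right_distrib)
  have hess: "trace (transpose (\<sigma> x) ** hessian h x ** \<sigma> x) = 2 * LI \<sigma> h x"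
    by (simp add: LI_def) (metis matrix_mul_assoc trace_mul_sym)
  have "transpose (\<sigma> x) ** Q ** \<sigma> x = (- ?e) *\<^sub>R (transpose (\<sigma> x) ** hessian h x ** \<sigma> x)
     + (b * ?e) *\<^sub>R (transpose (\<sigma> x) ** outer_square (grad h x) ** \<sigma> x)"
    unfolding Q matrix_add_ldistrib matrix_add_rdistrib matrix_scalar_ac scalar_matrix_assoc[symmetric]
    by (simp add: power2_eq_square)
  then have "trace (transpose (\<sigma> x) ** Q ** \<sigma> x) = - ?e * (2 * LI \<sigma> h x) + b * ?e * (2 * H_op \<sigma> h x)"
    by (simp add: trace_add trace_sub trace_scaleR hess trace_sandwich_outer_square H_op_def lie_mat_def)
  then have "D \<bullet> closed_loop_drift f g u\<^sub>o \<phi> x + 1/2 * trace (transpose (\<sigma> x) ** Q ** \<sigma> x)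
     = - ?e * (generator f g \<sigma> (\<phi> x) (u\<^sub>o x) h x - b * H_op \<sigma> h x)"
    by (simp add: D drift generator_def algebra_simps)
  also have "\<dots> \<le> 0" using ge b by (simp add: mult_nonneg_nonneg)
  finally show ?thesis .
qed

section \<open>Ito expansion along a discretised solution\<close>

lemma abs_trace_le: "\<bar>trace (A::real^'n^'n)\<bar> \<le> CARD('n) * norm A"
proof -
  have "\<bar>A $ i $ i\<bar> \<le> norm A" for i
    by (metis order_trans Finite_Cartesian_Product.norm_nth_le real_norm_def)
  then have "(\<Sum>i\<in>UNIV. \<bar>A $ i $ i\<bar>) \<le> (\<Sum>i\<in>(UNIV::'n set). norm A)" by (intro sum_mono)
  then show ?thesis unfolding trace_def using order_trans[OF sum_abs] by fastforce
qed

lemma norm_sandwich_le: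
  assumes "norm (G::real^'d^'n) \<le> K" "norm Q \<le> B"
  shows "norm (transpose G ** Q ** G) \<le> K * B * K"
proof -
  have K: "0 \<le> K" "0 \<le> B" using assms norm_ge_zero order_trans by blast+
  have "norm (transpose G ** Q ** G) \<le> norm (transpose G ** Q) * norm G" by (rule norm_matrix_matrix_le)
  also have "\<dots> \<le> (norm (transpose G) * norm Q) * norm G" by (intro mult_right_mono norm_matrix_matrix_le) auto
  also have "\<dots> \<le> K * B * K" using assms K by (intro mult_mono) auto
  finally show ?thesis .
qed

text \<open>Each step contributes at most \<open>e * \<delta>\<close>, and the errors add up over
  the steps.\<close>

lemma riemann_sum_error:
  fixes \<phi> :: "real \<Rightarrow> 'b::euclidean_space"
  assumes c: "continuous_on {0..c} \<phi>" and "0 < \<delta>" "real l * \<delta> \<le> c"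
    and osc: "\<And>s t. s \<in> {0..c} \<Longrightarrow> t \<in> {0..c} \<Longrightarrow> \<bar>s - t\<bar> \<le> \<delta> \<Longrightarrow> norm (\<phi> s - \<phi> t) \<le> e"
  shows "norm ((\<Sum>m<l. \<delta> *\<^sub>R \<phi> (real m * \<delta>)) - integral {0..real l * \<delta>} \<phi>) \<le> e * (real l * \<delta>)"
  using \<open>real l * \<delta> \<le> c\<close>
proof (induction l)
  case (Suc l)
  let ?s = "real l * \<delta>" and ?t = "real (Suc l) * \<delta>"
  have st: "0 \<le> ?s" "?s \<le> ?t" "?t \<le> c" "?t - ?s = \<delta>" using \<open>0 < \<delta>\<close> Suc.prems by (auto simp: distrib_right)
  have sub: "{?s..?t} \<subseteq> {0..c}" "{0..?t} \<subseteq> {0..c}"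
    using st(1-3) unfolding atLeastatMost_subset_iff by linarith+
  have int: "\<phi> integrable_on {0..?t}"
    by (intro integrable_continuous_real continuous_on_subset[OF c sub(2)])
  have cont: "continuous_on {?s..?t} \<phi>" by (rule continuous_on_subset[OF c sub(1)])
  have split: "integral {0..?t} \<phi> = integral {0..?s} \<phi> + integral {?s..?t} \<phi>"
    using Henstock_Kurzweil_Integration.integral_combine[OF st(1,2) int] by simp
  have "\<delta> *\<^sub>R \<phi> ?s - integral {?s..?t} \<phi> = integral {?s..?t} (\<lambda>u. \<phi> ?s - \<phi> u)"
    using integral_diff[OF integrable_const_ivl[of "\<phi> ?s" ?s ?t] integrable_continuous_real[OF cont]] st(2,4)
    by simp
  also have "norm \<dots> \<le> e * (?t - ?s)"
  proof (intro integral_bound continuous_intros cont osc)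
    show "?s \<in> {0..c}" "\<And>u. u \<in> {?s..?t} \<Longrightarrow> u \<in> {0..c}" using st(1-3) sub(1) by (auto simp only: atLeastAtMost_iff)
    show "\<And>u. u \<in> {?s..?t} \<Longrightarrow> \<bar>?s - u\<bar> \<le> \<delta>" using st(4) by (simp only: atLeastAtMost_iff) linarith
  qed (use st in simp)
  finally have step: "norm (\<delta> *\<^sub>R \<phi> ?s - integral {?s..?t} \<phi>) \<le> e * \<delta>" by (simp only: st(4))
  have "norm (((\<Sum>m<l. \<delta> *\<^sub>R \<phi> (real m * \<delta>)) - integral {0..?s} \<phi>) + (\<delta> *\<^sub>R \<phi> ?s - integral {?s..?t} \<phi>)) \<le> e * ?s + e * \<delta>"
    using Suc st by (intro norm_triangle_mono step) auto
  then show ?case unfolding split by (simp add: algebra_simps)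
qed simp

section \<open>Expected growth of a test function along Euler sums\<close>

context wiener_process
begin

abbreviation euler_sum ::
  "real \<Rightarrow> real^'n \<Rightarrow> (nat \<Rightarrow> 'a \<Rightarrow> real^'n) \<Rightarrow> (nat \<Rightarrow> 'a \<Rightarrow> real^'d^'n) \<Rightarrow> nat \<Rightarrow> 'a \<Rightarrow> real^'n" where
  "euler_sum \<delta> x0 A G l \<omega> \<equiv> x0 + (\<Sum>m<l. \<delta> *\<^sub>R A m \<omega>) + incr_sum \<delta> G l \<omega>"

text \<open>A discrete Dynkin inequality: the linear term of each step has mean zero and the
  quadratic one yields the trace. \<open>C\<close> is chosen before the step, the start and the
  coefficients, so over a horizon \<open>T = real N * \<delta>\<close> the error is
  \<open>T * \<epsilon> + T * C * \<delta>\<close>.\<close>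

lemma euler_expectation:
  fixes U :: "real^'n \<Rightarrow> real"
  assumes tf: "test_function U D Q" and "0 < \<epsilon>" and K: "0 \<le> K"
  obtains C where "0 \<le> C"
    "\<And>\<delta> x0 (A::nat \<Rightarrow> 'a \<Rightarrow> real^'n) (G::nat \<Rightarrow> 'a \<Rightarrow> real^'d^'n) N. 0 < \<delta> \<Longrightarrow> \<delta> \<le> 1 \<Longrightarrow>
      (\<And>l. A l \<in> borel_measurable (F (real l * \<delta>))) \<Longrightarrow> (\<And>l. G l \<in> borel_measurable (F (real l * \<delta>))) \<Longrightarrow>
      (\<And>l \<omega>. norm (A l \<omega>) \<le> K) \<Longrightarrow> (\<And>l \<omega>. norm (G l \<omega>) \<le> K) \<Longrightarrow>
      expectation (\<lambda>\<omega>. U (euler_sum \<delta> x0 A G N \<omega>)) \<le> U x0 +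
        (\<Sum>l<N. \<delta> * expectation (\<lambda>\<omega>. D (euler_sum \<delta> x0 A G l \<omega>) \<bullet> A l \<omega> +
           1/2 * trace (transpose (G l \<omega>) ** Q (euler_sum \<delta> x0 A G l \<omega>) ** G l \<omega>)))
        + real N * (\<epsilon> * \<delta> + C * \<delta>\<^sup>2)"
proof -
  interpret test_function U D Q by (rule tf)
  \<comment> \<open>The expected squared norm of an increment is \<open>d * \<delta>\<close>, so the
    one-step bound is used with \<open>\<epsilon> / d\<close>.\<close>
  define d where "d = real CARD('d)"
  have d: "0 < d" by (simp add: d_def)
  obtain C where C: "0 \<le> C" and step: "\<And>x A (G::real^'d^'n) w \<delta>. 0 < \<delta> \<Longrightarrow> \<delta> \<le> 1 \<Longrightarrow> norm A \<le> K \<Longrightarrow> norm G \<le> K \<Longrightarrow>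
     U (x + \<delta> *\<^sub>R A + G *v w) \<le> U x + \<delta> * (D x \<bullet> A) + D x \<bullet> (G *v w) + 1/2 * ((G *v w) \<bullet> (Q x *v (G *v w)))
       + \<epsilon> / d * (norm w)\<^sup>2 + C * (\<delta>\<^sup>2 + (norm w)^4)"
    using euler_step_bound[of "\<epsilon> / d" K, where 'd='d] K \<open>0 < \<epsilon>\<close> d by (auto 0 0)
  obtain B0 B1 B2 where B: "\<And>x. \<bar>U x\<bar> \<le> B0" "\<And>x. norm (D x) \<le> B1" "\<And>x. norm (Q x) \<le> B2" "0 \<le> B1" "0 \<le> B2"
    using bounded by blast
  have [measurable]: "U \<in> borel_measurable borel" "D \<in> borel_measurable borel" "Q \<in> borel_measurable borel"
    using uniform by (auto intro!: borel_measurable_continuous_onI uniformly_continuous_imp_continuous)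
  \<comment> \<open>Collects the explicit square of \<delta> and the fourth moment of the increment,
    at most \<open>3 * d\<^sup>2 * \<delta>\<^sup>2\<close>.\<close>
  define C' where "C' = C * (1 + 3 * d\<^sup>2)"
  have "expectation (\<lambda>\<omega>. U (euler_sum \<delta> x0 A G N \<omega>)) \<le> U x0 +
      (\<Sum>l<N. \<delta> * expectation (\<lambda>\<omega>. D (euler_sum \<delta> x0 A G l \<omega>) \<bullet> A l \<omega> +
         1/2 * trace (transpose (G l \<omega>) ** Q (euler_sum \<delta> x0 A G l \<omega>) ** G l \<omega>)))
      + real N * (\<epsilon> * \<delta> + C' * \<delta>\<^sup>2)"
    if \<delta>: "0 < \<delta>" "\<delta> \<le> 1" and A: "\<And>l. A l \<in> borel_measurable (F (real l * \<delta>))"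
      and G: "\<And>l. G l \<in> borel_measurable (F (real l * \<delta>))"
      and bd: "\<And>l \<omega>. norm (A l \<omega>) \<le> K" "\<And>l \<omega>. norm (G l \<omega>) \<le> K"
    for \<delta> x0 N and A :: "nat \<Rightarrow> 'a \<Rightarrow> real^'n" and G :: "nat \<Rightarrow> 'a \<Rightarrow> real^'d^'n"
  proof (induction N)
    case 0
    show ?case by (simp add: prob_space)
  next
    case (Suc l)
    define Z where "Z l \<omega> = euler_sum \<delta> x0 A G l \<omega>" for l \<omega>
    let ?s = "real l * \<delta>" and ?t = "real (Suc l) * \<delta>"
    let ?w = "\<lambda>\<omega>. W ?t \<omega> - W ?s \<omega>"
    have st: "0 \<le> ?s" "?s < ?t" "?t - ?s = \<delta>" using \<delta> by (auto simp: distrib_right)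
    have Zm: "Z l \<in> borel_measurable (F (real l * \<delta>))" for l
      unfolding Z_def[abs_def]
    proof (intro borel_measurable_add borel_measurable_const borel_measurable_sum borel_measurable_scaleR)
      show "A m \<in> borel_measurable (F (real l * \<delta>))" if "m \<in> {..<l}" for m
        using that \<delta> by (intro measurable_F_mono[OF A]) auto
      show "incr_sum \<delta> G l \<in> borel_measurable (F (real l * \<delta>))"
        using \<delta> G by (intro incr_sum_measurable) auto
    qed
    note [measurable] = Zm[of l] A[of l] G[of l]
    define c where "c \<omega> = transpose (G l \<omega>) *v D (Z l \<omega>)" for \<omega>
    define R where "R \<omega> = transpose (G l \<omega>) ** Q (Z l \<omega>) ** G l \<omega>" for \<omega>
    have cm: "c \<in> borel_measurable (F ?s)" unfolding c_def[abs_def] by measurable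
    have Rm: "R \<in> borel_measurable (F ?s)" unfolding R_def[abs_def] by measurable
    have cb: "norm (c \<omega>) \<le> K * B1" for \<omega>
      unfolding c_def by (rule order_trans[OF norm_matrix_vector_le]) (use bd B K in \<open>auto intro!: mult_mono\<close>)
    have Rb: "norm (R \<omega>) \<le> K * B2 * K" for \<omega> unfolding R_def by (intro norm_sandwich_le bd B)
    note lin = incr_linear[OF st(1,2) cm cb] and quad = incr_quadratic[OF st(1,2) Rm Rb, unfolded st(3)]
      and n2 = incr_norm_sq[OF st(1,2), unfolded st(3), folded d_def] and n4 = incr_norm_fourth[OF st(1,2), unfolded st(3), folded d_def]
    have UZ: "integrable M (\<lambda>\<omega>. U (Z l \<omega>))" for l
      using Zm[of l] B(1) by (intro bounded_F_integrable[of _ "real l * \<delta>" B0]) auto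
    have DA: "integrable M (\<lambda>\<omega>. D (Z l \<omega>) \<bullet> A l \<omega>)"
    proof (rule bounded_F_integrable[of _ ?s "B1 * K"])
      show "norm (D (Z l \<omega>) \<bullet> A l \<omega>) \<le> B1 * K" for \<omega>
        using B bd K by (auto intro!: order_trans[OF Cauchy_Schwarz_ineq2] mult_mono)
    qed measurable
    have RT: "integrable M (\<lambda>\<omega>. trace (R \<omega>))"
    proof (rule bounded_F_integrable[of _ ?s "d * (K * B2 * K)"])
      show "norm (trace (R \<omega>)) \<le> d * (K * B2 * K)" for \<omega>
        using order_trans[OF abs_trace_le[of "R \<omega>"] mult_left_mono[OF Rb]] by (simp add: d_def)
      show "(\<lambda>\<omega>. trace (R \<omega>)) \<in> borel_measurable (F ?s)"
        using Rm unfolding trace_def by measurable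
    qed
    let ?E = "\<lambda>\<omega>. U (Z l \<omega>) + \<delta> * (D (Z l \<omega>) \<bullet> A l \<omega>) + c \<omega> \<bullet> ?w \<omega> + 1/2 * (?w \<omega> \<bullet> (R \<omega> *v ?w \<omega>))
       + \<epsilon> / d * (norm (?w \<omega>))\<^sup>2 + C * \<delta>\<^sup>2 + C * (norm (?w \<omega>))^4"
    have le: "U (Z (Suc l) \<omega>) \<le> ?E \<omega>" for \<omega>
    proof -
      have "Z (Suc l) \<omega> = Z l \<omega> + \<delta> *\<^sub>R A l \<omega> + G l \<omega> *v ?w \<omega>" by (simp add: Z_def incr_sum_Suc)
      then have "U (Z (Suc l) \<omega>) \<le> U (Z l \<omega>) + \<delta> * (D (Z l \<omega>) \<bullet> A l \<omega>) + D (Z l \<omega>) \<bullet> (G l \<omega> *v ?w \<omega>)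
         + 1/2 * ((G l \<omega> *v ?w \<omega>) \<bullet> (Q (Z l \<omega>) *v (G l \<omega> *v ?w \<omega>)))
         + \<epsilon> / d * (norm (?w \<omega>))\<^sup>2 + C * (\<delta>\<^sup>2 + (norm (?w \<omega>))^4)"
        using step[OF \<delta> bd, of "Z l \<omega>" l \<omega> l \<omega> "?w \<omega>"] by simp
      also have "D (Z l \<omega>) \<bullet> (G l \<omega> *v ?w \<omega>) = c \<omega> \<bullet> ?w \<omega>"
        by (simp add: c_def dot_lmul_matrix[symmetric])
      also have "(G l \<omega> *v ?w \<omega>) \<bullet> (Q (Z l \<omega>) *v (G l \<omega> *v ?w \<omega>)) = ?w \<omega> \<bullet> (R \<omega> *v ?w \<omega>)"
        unfolding R_def by (rule inner_matrix_quadratic)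
      finally show ?thesis by (simp add: distrib_left add.assoc)
    qed
    have hb: "has_bochner_integral M f (expectation f)" if "integrable M f" for f :: "'a \<Rightarrow> real"
      using that by (rule has_bochner_integral_integrable)
    have E: "has_bochner_integral M ?E (expectation (\<lambda>\<omega>. U (Z l \<omega>)) + \<delta> * expectation (\<lambda>\<omega>. D (Z l \<omega>) \<bullet> A l \<omega>)
       + expectation (\<lambda>\<omega>. c \<omega> \<bullet> ?w \<omega>) + 1/2 * expectation (\<lambda>\<omega>. ?w \<omega> \<bullet> (R \<omega> *v ?w \<omega>))
       + \<epsilon> / d * expectation (\<lambda>\<omega>. (norm (?w \<omega>))\<^sup>2) + expectation (\<lambda>_. C * \<delta>\<^sup>2) + C * expectation (\<lambda>\<omega>. (norm (?w \<omega>))^4))"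
      by (intro has_bochner_integral_add has_bochner_integral_mult_right hb UZ DA lin(1) quad(1) n2(1) n4(1)) simp_all
    have EA: "expectation (\<lambda>\<omega>. D (Z l \<omega>) \<bullet> A l \<omega> + 1/2 * trace (R \<omega>)) =
       expectation (\<lambda>\<omega>. D (Z l \<omega>) \<bullet> A l \<omega>) + 1/2 * expectation (\<lambda>\<omega>. trace (R \<omega>))"
      using DA RT by simp
    have "expectation (\<lambda>\<omega>. U (Z (Suc l) \<omega>)) \<le> expectation ?E"
      by (intro integral_mono UZ le) (use E in \<open>simp add: has_bochner_integral_iff\<close>)
    also have "expectation ?E = expectation (\<lambda>\<omega>. U (Z l \<omega>)) + \<delta> * expectation (\<lambda>\<omega>. D (Z l \<omega>) \<bullet> A l \<omega>)
       + 1/2 * (\<delta> * expectation (\<lambda>\<omega>. trace (R \<omega>))) + \<epsilon> / d * (d * \<delta>) + C * \<delta>\<^sup>2 + C * expectation (\<lambda>\<omega>. (norm (?w \<omega>))^4)"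
      unfolding has_bochner_integral_integral_eq[OF E] lin(2) quad(2) n2(2) by (simp add: prob_space)
    also have "\<dots> \<le> expectation (\<lambda>\<omega>. U (Z l \<omega>)) + \<delta> * expectation (\<lambda>\<omega>. D (Z l \<omega>) \<bullet> A l \<omega>)
       + 1/2 * (\<delta> * expectation (\<lambda>\<omega>. trace (R \<omega>))) + \<epsilon> / d * (d * \<delta>) + C * \<delta>\<^sup>2 + C * (3 * d\<^sup>2 * \<delta>\<^sup>2)"
      using n4(2) C by (intro add_left_mono mult_left_mono) (auto simp: d_def)
    also have "\<dots> = expectation (\<lambda>\<omega>. U (Z l \<omega>)) + \<delta> * expectation (\<lambda>\<omega>. D (Z l \<omega>) \<bullet> A l \<omega> + 1/2 * trace (R \<omega>)) + (\<epsilon> * \<delta> + C' * \<delta>\<^sup>2)"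
      unfolding EA C'_def using d by (simp add: algebra_simps)
    also have "\<dots> \<le> (U x0 + (\<Sum>l<l. \<delta> * expectation (\<lambda>\<omega>. D (Z l \<omega>) \<bullet> A l \<omega> + 1/2 * trace (transpose (G l \<omega>) ** Q (Z l \<omega>) ** G l \<omega>)))
        + real l * (\<epsilon> * \<delta> + C' * \<delta>\<^sup>2)) + \<delta> * expectation (\<lambda>\<omega>. D (Z l \<omega>) \<bullet> A l \<omega> + 1/2 * trace (R \<omega>)) + (\<epsilon> * \<delta> + C' * \<delta>\<^sup>2)"
      using Suc.IH unfolding Z_def by (intro add_right_mono)
    finally show ?case unfolding Z_def[symmetric] R_def by (simp add: algebra_simps)
  qed
  note main = this
  show thesis
  proof (rule that[of C'])
    show "0 \<le> C'" using C by (simp add: C'_def)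
  qed (rule main; simp)
qed

text \<open>A maximum principle in discrete time: while the path stays in \<open>S\<close>, where
  the generator of \<open>U\<close> is nonpositive, the mean of \<open>U\<close> hardly grows, and
  reaching \<open>L\<close> costs at least \<open>c\<close>. \<open>hit n\<close> sees the path only
  on the grid of level \<open>n\<close>, up to time \<open>K\<close> and before \<tau>.\<close>

lemma hit_estimate:
  fixes X :: "real \<Rightarrow> 'a \<Rightarrow> real^'n" and \<tau> :: "'a \<Rightarrow> real" and \<sigma> :: "real^'n \<Rightarrow> real^'d^'n" and a :: "real^'n \<Rightarrow> real^'n" and K :: nat
  assumes tf: "test_function U D Q"
    and a: "continuous_on UNIV a" and \<sigma>: "continuous_on UNIV \<sigma>"
    and \<tau>: "stopping_time F \<tau>" "\<And>\<omega>. \<omega> \<in> space M \<Longrightarrow> 0 \<le> \<tau> \<omega>"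
    and Xc: "\<And>\<omega>. \<omega> \<in> space M \<Longrightarrow> continuous_on {0..\<tau> \<omega>} (\<lambda>t. X t \<omega>)"
    and Xm: "\<And>t. 0 \<le> t \<Longrightarrow> (\<lambda>\<omega>. if t \<le> \<tau> \<omega> then X t \<omega> else 0) \<in> borel_measurable (F t)"
    and ito: "\<And>t. 0 \<le> t \<Longrightarrow> \<exists>I. has_ito_integral M F W (\<lambda>s \<omega>. if s \<le> \<tau> \<omega> then \<sigma> (X s \<omega>) else 0) t I \<and>
      (AE \<omega> in M. X (min t (\<tau> \<omega>)) \<omega> = x0 + integral {0..min t (\<tau> \<omega>)} (\<lambda>s. a (X s \<omega>)) + I \<omega>)"
    and S: "bounded S" "S \<in> sets borel"
    and L: "L \<in> sets borel" "L \<inter> S = {}"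
    and gen: "\<And>x. x \<in> S \<Longrightarrow> D x \<bullet> a x + 1/2 * trace (transpose (\<sigma> x) ** Q x ** \<sigma> x) \<le> 0"
    and c: "0 \<le> c" "\<And>x. x \<in> L \<Longrightarrow> c \<le> U x"
  defines "hit \<equiv> \<lambda>n. {\<omega>\<in>space M. \<exists>l\<le>K * 2 ^ n. real l / 2 ^ n \<le> \<tau> \<omega> \<and> X (real l / 2 ^ n) \<omega> \<in> L \<and>
      (\<forall>m<l. X (real m / 2 ^ n) \<omega> \<in> S)}"
  shows "hit n \<in> events" and "0 < e \<Longrightarrow> \<forall>\<^sub>F n in sequentially. c * prob (hit n) \<le> U x0 + e"
proof -
  interpret test_function U D Q by (rule tf)
  \<comment> \<open>Beyond \<tau> the process is replaced by 0 to make it adapted, and the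
    coefficients become left-regular integrands.\<close>
  define Xt where "Xt t \<omega> = (if t \<le> \<tau> \<omega> then X t \<omega> else 0)" for t \<omega>
  define H where "H t \<omega> = (if t \<le> \<tau> \<omega> then \<sigma> (X t \<omega>) else 0)" for t \<omega>
  define b where "b t \<omega> = (if t \<le> \<tau> \<omega> then a (X t \<omega>) else 0)" for t \<omega>
  have \<tau>_pred: "Measurable.pred (F t) (\<lambda>\<omega>. t \<le> \<tau> \<omega>)" for t
    using stopping_time_less_const[OF \<tau>(1), of t] unfolding not_less[symmetric] by measurable
  have Xt_meas: "Xt t \<in> borel_measurable (F t)" if "0 \<le> t" for t
    using Xm[OF that] by (simp add: Xt_def[abs_def])
  have \<sigma>_meas: "\<sigma> \<in> borel_measurable borel" and a_meas: "a \<in> borel_measurable borel"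
    using \<sigma> a by (auto intro: borel_measurable_continuous_onI)
  have left_cont: "left_regular (\<lambda>t \<omega>. if t \<le> \<tau> \<omega> then f (X t \<omega>) else 0)"
    if f: "continuous_on UNIV f" for f :: "real^'n \<Rightarrow> 'c::euclidean_space"
    unfolding left_regular_def
  proof (intro conjI allI impI ballI)
    fix t :: real assume t: "0 \<le> t"
    have "(\<lambda>\<omega>. if t \<le> \<tau> \<omega> then f (Xt t \<omega>) else 0) \<in> borel_measurable (F t)"
      using \<tau>_pred[of t] measurable_compose[OF Xt_meas[OF t] borel_measurable_continuous_onI[OF f]] by measurable
    moreover have "(\<lambda>\<omega>. if t \<le> \<tau> \<omega> then f (Xt t \<omega>) else 0) = (\<lambda>\<omega>. if t \<le> \<tau> \<omega> then f (X t \<omega>) else 0)"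
      by (auto simp: Xt_def)
    ultimately show "(\<lambda>\<omega>. if t \<le> \<tau> \<omega> then f (X t \<omega>) else 0) \<in> borel_measurable (F t)" by simp
  next
    fix \<omega> assume \<omega>: "\<omega> \<in> space M"
    have cf: "continuous_on {0..\<tau> \<omega>} (\<lambda>t. f (X t \<omega>))"
      by (rule continuous_on_compose2[OF f Xc[OF \<omega>]]) simp
    {
      fix s :: real assume s: "0 \<le> s"
      show "continuous (at s within {0..s}) (\<lambda>t. if t \<le> \<tau> \<omega> then f (X t \<omega>) else 0)"
      proof (cases "s \<le> \<tau> \<omega>")
        case True
        have "continuous_on {0..s} (\<lambda>t. if t \<le> \<tau> \<omega> then f (X t \<omega>) else 0)"
          by (rule continuous_on_eq[OF continuous_on_subset[OF cf]]) (use True in auto)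
        then show ?thesis using s by (auto simp: continuous_on_eq_continuous_within)
      next
        case False
        show ?thesis unfolding continuous_within
        proof (rule tendsto_eventually)
          have "s - \<tau> \<omega> > 0" using False by simp
          moreover have "\<not> u \<le> \<tau> \<omega>" if "dist u s < s - \<tau> \<omega>" for u using that by (auto simp: dist_real_def)
          ultimately show "\<forall>\<^sub>F u in at s within {0..s}. (if u \<le> \<tau> \<omega> then f (X u \<omega>) else 0) = (if s \<le> \<tau> \<omega> then f (X s \<omega>) else 0)"
            unfolding eventually_at using False by (intro exI[of _ "s - \<tau> \<omega>"]) auto
        qed
      qed
    next
      fix T :: real
      have "bounded ((\<lambda>t. f (X t \<omega>)) ` {0..\<tau> \<omega>})"
        by (intro compact_imp_bounded compact_continuous_image cf) auto
      then obtain B where "\<And>t. t \<in> {0..\<tau> \<omega>} \<Longrightarrow> norm (f (X t \<omega>)) \<le> B" unfolding bounded_iff by blast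
      then show "\<exists>B. \<forall>s\<ge>0. s \<le> T \<longrightarrow> norm (if s \<le> \<tau> \<omega> then f (X s \<omega>) else 0) \<le> B"
        by (intro exI[of _ "max 0 B"]) (auto simp: le_max_iff_disj)
    }
  qed
  have H: "left_regular H" and b: "left_regular b"
    using left_cont[OF \<sigma>] left_cont[OF a] by (simp_all add: H_def[abs_def] b_def[abs_def])
  obtain I where I: "\<And>t. 0 \<le> t \<Longrightarrow> has_ito_integral M F W H t (I t)"
    and eqI: "\<And>t. 0 \<le> t \<Longrightarrow> AE \<omega> in M. X (min t (\<tau> \<omega>)) \<omega> = x0 + integral {0..min t (\<tau> \<omega>)} (\<lambda>s. a (X s \<omega>)) + I t \<omega>"
  proof -
    have "\<forall>t. \<exists>I. 0 \<le> t \<longrightarrow> has_ito_integral M F W H t I \<and>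
      (AE \<omega> in M. X (min t (\<tau> \<omega>)) \<omega> = x0 + integral {0..min t (\<tau> \<omega>)} (\<lambda>s. a (X s \<omega>)) + I \<omega>)"
      using ito unfolding H_def[abs_def] by blast
    from choice[OF this] show ?thesis using that by blast
  qed
  let ?q = "\<lambda>n l. real l / 2 ^ n"
  let ?J = "\<lambda>n. K * 2 ^ n"
  have b_meas: "b (?q n l) \<in> borel_measurable (F (?q n l))" and H_meas: "H (?q n l) \<in> borel_measurable (F (?q n l))" for n l
    using b H by (auto simp: left_regular_def)
  \<comment> \<open>The gap between the solution and its Euler sum before killing.
    \<open>Bad\<close> collects the outcomes where it exceeds \<theta> at some grid time before
    \<tau>.\<close>
  define Err where "Err n l \<omega> = Xt (?q n l) \<omega> - x0 - (\<Sum>m<l. (1 / 2 ^ n) *\<^sub>R b (?q n m) \<omega>) - grid_sum n H l \<omega>" for n l \<omega>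
  have Err_meas: "Err n l \<in> borel_measurable M" for n l
    unfolding Err_def[abs_def]
    by (intro borel_measurable_diff borel_measurable_const borel_measurable_sum borel_measurable_scaleR
        measurable_F_M[OF Xt_meas] measurable_F_M[OF b_meas] grid_sum_measurable[OF H]) auto
  define Bad where "Bad \<theta> n = {\<omega>\<in>space M. \<exists>l\<le>?J n. ?q n l \<le> \<tau> \<omega> \<and> \<theta> < norm (Err n l \<omega>)}" for \<theta> n
  have \<tau>M: "Measurable.pred M (\<lambda>\<omega>. t \<le> \<tau> \<omega>)" for t by (rule pred_F_M[OF \<tau>_pred])
  have Bad_ev: "Bad \<theta> n \<in> events" for \<theta> n
    unfolding Bad_def using Err_meas \<tau>M by measurable
  \<comment> \<open>The stochastic part of the error is uniformly small outside \<open>V n\<close>,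
    and the drift part is a Riemann sum error of a continuous path; each gets
    \<open>\<theta> / 2\<close>.\<close>
  have Bad_lim: "(\<lambda>n. prob (Bad \<theta> n)) \<longlonglongrightarrow> 0" if \<theta>: "0 < \<theta>" for \<theta>
  proof -
    define V where "V n = {\<omega>\<in>space M. \<exists>l\<le>?J n. \<theta> / 2 < norm (grid_sum n H l \<omega> - I (?q n l) \<omega>)}" for n
    have Im: "I (?q n l) \<in> borel_measurable M" for n l using I[of "?q n l"] by (simp add: has_ito_integral_def)
    have V_ev: "V n \<in> events" for n unfolding V_def using grid_sum_measurable[OF H] Im by measurable
    have V_lim: "(\<lambda>n. prob (V n)) \<longlonglongrightarrow> 0"
      unfolding V_def by (rule grid_sum_tendsto_ito_uniform[OF H I]) (use \<theta> in auto)
    have "(\<lambda>n. prob (Bad \<theta> n - V n)) \<longlonglongrightarrow> 0"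
    proof (rule prob_tendsto_zero)
      show "Bad \<theta> n - V n \<in> events" for n using Bad_ev V_ev by blast
      \<comment> \<open>The null set of the integral equation depends on the time, but all grids
        together have only countably many points.\<close>
      have "AE \<omega> in M. \<forall>n l. X (min (?q n l) (\<tau> \<omega>)) \<omega> = x0 + integral {0..min (?q n l) (\<tau> \<omega>)} (\<lambda>s. a (X s \<omega>)) + I (?q n l) \<omega>"
        unfolding AE_all_countable using eqI by simp
      then show "AE \<omega> in M. \<forall>\<^sub>F n in sequentially. \<omega> \<notin> Bad \<theta> n - V n"
        using AE_space
      proof eventually_elim
        case (elim \<omega>)
        note eqX = elim(1)
        define \<phi> where "\<phi> s = a (X s \<omega>)" for s
        have c\<phi>: "continuous_on {0..\<tau> \<omega>} \<phi>"
          unfolding \<phi>_def by (rule continuous_on_compose2[OF a Xc[OF elim(2)]]) simp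
        \<comment> \<open>Over a horizon \<open>K\<close> the Riemann error is then at most
          \<open>\<theta> / 2\<close>; the added 1 covers \<open>K = 0\<close>.\<close>
        define e where "e = \<theta> / (2 * (real K + 1))"
        have e: "0 < e" "e * real K \<le> \<theta> / 2" using \<theta> by (auto simp: e_def field_simps)
        have "uniformly_continuous_on {0..\<tau> \<omega>} \<phi>" by (rule compact_uniformly_continuous[OF c\<phi>]) simp
        then obtain d where d: "0 < d" "\<And>s t. s \<in> {0..\<tau> \<omega>} \<Longrightarrow> t \<in> {0..\<tau> \<omega>} \<Longrightarrow> dist t s < d \<Longrightarrow> dist (\<phi> t) (\<phi> s) < e"
          using e(1) unfolding uniformly_continuous_on_def by metis
        have "(\<lambda>n. (1/2) ^ n) \<longlonglongrightarrow> (0::real)" by (rule LIMSEQ_realpow_zero) auto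
        then have "\<forall>\<^sub>F n in sequentially. (1/2) ^ n < d" using d(1) by (rule order_tendstoD)
        then show ?case
        proof eventually_elim
          case (elim n)
          note n = elim
          show ?case
          proof
            assume "\<omega> \<in> Bad \<theta> n - V n"
            then obtain l where l: "l \<le> ?J n" "?q n l \<le> \<tau> \<omega>" "\<theta> < norm (Err n l \<omega>)"
              and nV: "norm (grid_sum n H l \<omega> - I (?q n l) \<omega>) \<le> \<theta> / 2"
              by (auto simp: Bad_def V_def not_less)
            have "norm ((\<Sum>m<l. (1 / 2 ^ n) *\<^sub>R \<phi> (real m * (1 / 2 ^ n))) - integral {0..real l * (1 / 2 ^ n)} \<phi>) \<le> e * (real l * (1 / 2 ^ n))"
            proof (rule riemann_sum_error[OF c\<phi>])
              show "norm (\<phi> s - \<phi> t) \<le> e" if "s \<in> {0..\<tau> \<omega>}" "t \<in> {0..\<tau> \<omega>}" "\<bar>s - t\<bar> \<le> 1 / 2 ^ n" for s t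
                using d(2)[OF that(2,1)] that(3) n by (auto simp: dist_norm power_one_over)
            qed (use l in auto)
            also have "\<dots> \<le> e * real K"
            proof -
              have "real l \<le> real K * 2 ^ n" using of_nat_mono[OF l(1), where 'a=real] by simp
              then show ?thesis using e(1) by (simp add: divide_le_eq)
            qed
            finally have R: "norm ((\<Sum>m<l. (1 / 2 ^ n) *\<^sub>R \<phi> (?q n m)) - integral {0..?q n l} \<phi>) \<le> \<theta> / 2"
              using e(2) by simp
            have "(\<Sum>m<l. (1 / 2 ^ n) *\<^sub>R b (?q n m) \<omega>) = (\<Sum>m<l. (1 / 2 ^ n) *\<^sub>R \<phi> (?q n m))"
            proof (intro sum.cong refl)
              fix m assume "m \<in> {..<l}"
              then have "?q n m \<le> ?q n l" by (simp add: divide_right_mono)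
              then show "(1 / 2 ^ n) *\<^sub>R b (?q n m) \<omega> = (1 / 2 ^ n) *\<^sub>R \<phi> (?q n m)"
                using l(2) by (simp add: b_def \<phi>_def)
            qed
            moreover have "Xt (?q n l) \<omega> = x0 + integral {0..?q n l} \<phi> + I (?q n l) \<omega>"
              using eqX[rule_format, of l n] l(2) unfolding \<phi>_def Xt_def by (simp add: min_absorb1)
            ultimately have "Err n l \<omega> = - (((\<Sum>m<l. (1 / 2 ^ n) *\<^sub>R \<phi> (?q n m)) - integral {0..?q n l} \<phi>) + (grid_sum n H l \<omega> - I (?q n l) \<omega>))"
              by (simp add: Err_def)
            then have "norm (Err n l \<omega>) \<le> \<theta> / 2 + \<theta> / 2"
              using norm_triangle_mono[OF R nV] by (simp only: norm_minus_cancel)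
            then show False using l(3) by simp
          qed
        qed
      qed
    qed
    then have "(\<lambda>n. prob (Bad \<theta> n - V n) + prob (V n)) \<longlonglongrightarrow> 0 + 0" using V_lim by (rule tendsto_add)
    moreover have "prob (Bad \<theta> n) \<le> prob (Bad \<theta> n - V n) + prob (V n)" for n
    proof -
      have "prob (Bad \<theta> n) \<le> prob ((Bad \<theta> n - V n) \<union> V n)"
        using Bad_ev V_ev by (intro finite_measure_mono) auto
      also have "\<dots> \<le> prob (Bad \<theta> n - V n) + prob (V n)" using Bad_ev V_ev by (intro measure_Un_le) auto
      finally show ?thesis .
    qed
    ultimately show ?thesis
      by (intro tendsto_sandwich[of "\<lambda>_. 0" "\<lambda>n. prob (Bad \<theta> n)" sequentially "\<lambda>n. prob (Bad \<theta> n - V n) + prob (V n)"]) auto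
  qed
  have XtM: "Xt (?q n l) \<in> borel_measurable M" for n l by (rule measurable_F_M[OF Xt_meas]) simp
  have hit_eq: "hit n = {\<omega>\<in>space M. \<exists>l\<le>?J n. ?q n l \<le> \<tau> \<omega> \<and> Xt (?q n l) \<omega> \<in> L \<and> (\<forall>m<l. Xt (?q n m) \<omega> \<in> S)}" for n
  proof -
    have "X (?q n m) \<omega> = Xt (?q n m) \<omega>" if "?q n l \<le> \<tau> \<omega>" "m \<le> l" for m l \<omega>
    proof -
      have "?q n m \<le> ?q n l" using that by (simp add: divide_right_mono)
      then show ?thesis using that by (simp add: Xt_def)
    qed
    then show ?thesis unfolding hit_def by (intro Collect_cong conj_cong refl ex_cong1) auto
  qed
  have hit_ev: "hit n \<in> events" for n
    unfolding hit_eq using XtM \<tau>M S(2) L(1) by measurable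
  then show "hit n \<in> events" .
  show "\<forall>\<^sub>F n in sequentially. c * prob (hit n) \<le> U x0 + e" if e: "0 < e"
  proof -
    obtain r where "\<And>x. x \<in> S \<Longrightarrow> norm x \<le> r" using S(1) unfolding bounded_iff by blast
    then have r: "S \<subseteq> cball 0 r" by auto
    have "bounded (a ` cball 0 r)" "bounded (\<sigma> ` cball 0 r)"
      by (intro compact_imp_bounded compact_continuous_image continuous_on_subset[OF a] continuous_on_subset[OF \<sigma>]; simp)+
    then obtain Ka Ks where "\<And>x. x \<in> cball 0 r \<Longrightarrow> norm (a x) \<le> Ka" "\<And>x. x \<in> cball 0 r \<Longrightarrow> norm (\<sigma> x) \<le> Ks"
      unfolding bounded_iff by blast
    moreover define Kb where "Kb = max 0 (max Ka Ks)"
    ultimately have Kb: "0 \<le> Kb" "\<And>x. x \<in> S \<Longrightarrow> norm (a x) \<le> Kb" "\<And>x. x \<in> S \<Longrightarrow> norm (\<sigma> x) \<le> Kb"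
      using r by (auto simp: le_max_iff_disj)
    obtain B0 B1 B2 where B: "\<And>x. \<bar>U x\<bar> \<le> B0" "\<And>x. norm (D x) \<le> B1" "\<And>x. norm (Q x) \<le> B2" "0 \<le> B1" "0 \<le> B2"
      using bounded by blast
    \<comment> \<open>The error \<open>q\<close> is spent once in comparing \<open>U\<close> at the
      hitting point, \<open>K\<close> times on the perturbed generator and \<open>K\<close> times on
      Taylor remainders, using half of \<open>e\<close>. The other half absorbs what vanishes as
      \<open>n\<close> grows.\<close>
    define q where "q = e / (2 * (1 + 2 * real K))"
    have q: "0 < q" "q * (1 + 2 * real K) = e / 2" using e by (auto simp: q_def field_simps)
    define dd where "dd = real CARD('d)"
    \<comment> \<open>Changing \<open>D\<close> and \<open>Q\<close> by at most \<epsilon>1 changes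
      the generator expression by at most \<open>\<epsilon>1 * (M1 - 1)\<close>; the summand 1 makes
      \<open>M1\<close> positive.\<close>
    define M1 where "M1 = Kb + 1/2 * (dd * (Kb * Kb)) + 1"
    have M1: "0 < M1" using Kb by (simp add: M1_def dd_def add_nonneg_pos)
    define \<epsilon>1 where "\<epsilon>1 = q / M1"
    have \<epsilon>1: "0 < \<epsilon>1" "\<epsilon>1 * Kb + 1/2 * (dd * (Kb * \<epsilon>1 * Kb)) \<le> q"
    proof -
      show "0 < \<epsilon>1" using q M1 by (simp add: \<epsilon>1_def)
      have "\<epsilon>1 * Kb + 1/2 * (dd * (Kb * \<epsilon>1 * Kb)) = \<epsilon>1 * (M1 - 1)" by (simp add: M1_def algebra_simps)
      also have "\<dots> \<le> \<epsilon>1 * M1" using \<open>0 < \<epsilon>1\<close> by simp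
      also have "\<dots> = q" using M1 by (simp add: \<epsilon>1_def)
      finally show "\<epsilon>1 * Kb + 1/2 * (dd * (Kb * \<epsilon>1 * Kb)) \<le> q" .
    qed
    obtain t1 where t1: "0 < t1" "\<And>x y. dist y x < t1 \<Longrightarrow> dist (U y) (U x) < q"
      using uniform(1)[unfolded uniformly_continuous_on_def, rule_format, OF q(1)] by (metis UNIV_I)
    obtain t2 where t2: "0 < t2" "\<And>x y. dist y x < t2 \<Longrightarrow> dist (D y) (D x) < \<epsilon>1"
      using uniform(2)[unfolded uniformly_continuous_on_def, rule_format, OF \<epsilon>1(1)] by (metis UNIV_I)
    obtain t3 where t3: "0 < t3" "\<And>x y. dist y x < t3 \<Longrightarrow> dist (Q y) (Q x) < \<epsilon>1"
      using uniform(3)[unfolded uniformly_continuous_on_def, rule_format, OF \<epsilon>1(1)] by (metis UNIV_I)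
    define \<theta> where "\<theta> = min t1 (min t2 t3) / 2"
    have \<theta>: "0 < \<theta>" "\<theta> < t1" "\<theta> < t2" "\<theta> < t3" using t1(1) t2(1) t3(1) by (auto simp: \<theta>_def min_def)
    \<comment> \<open>A crude bound for the generator expression on \<open>Bad\<close>, where the
      Euler sum need not be near the solution.\<close>
    define \<Lambda> where "\<Lambda> = B1 * Kb + 1/2 * (dd * (Kb * B2 * Kb))"
    have \<Lambda>: "0 \<le> \<Lambda>" using Kb B by (simp add: \<Lambda>_def dd_def)
    obtain C where C: "0 \<le> C" and euler: "\<And>\<delta> x0 (A::nat \<Rightarrow> 'a \<Rightarrow> real^'n) (G::nat \<Rightarrow> 'a \<Rightarrow> real^'d^'n) N. 0 < \<delta> \<Longrightarrow> \<delta> \<le> 1 \<Longrightarrow>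
      (\<And>l. A l \<in> borel_measurable (F (real l * \<delta>))) \<Longrightarrow> (\<And>l. G l \<in> borel_measurable (F (real l * \<delta>))) \<Longrightarrow>
      (\<And>l \<omega>. norm (A l \<omega>) \<le> Kb) \<Longrightarrow> (\<And>l \<omega>. norm (G l \<omega>) \<le> Kb) \<Longrightarrow>
      expectation (\<lambda>\<omega>. U (euler_sum \<delta> x0 A G N \<omega>)) \<le> U x0 +
        (\<Sum>l<N. \<delta> * expectation (\<lambda>\<omega>. D (euler_sum \<delta> x0 A G l \<omega>) \<bullet> A l \<omega> +
           1/2 * trace (transpose (G l \<omega>) ** Q (euler_sum \<delta> x0 A G l \<omega>) ** G l \<omega>)))
        + real N * (q * \<delta> + C * \<delta>\<^sup>2)"
    proof (rule euler_expectation[OF tf q(1) Kb(1)], goal_cases)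
      case (1 C)
      show ?case by (rule 1(1)[OF 1(2)]) (rule 1(3); simp)
    qed
    have main: "c * prob (hit n) \<le> U x0 + e / 2 + ((c + real K * \<Lambda>) * prob (Bad \<theta> n) + real K * C * (1/2) ^ n)" for n
    proof -
      define \<delta> :: real where "\<delta> = 1 / 2 ^ n"
      have \<delta>: "0 < \<delta>" "\<delta> \<le> 1" by (auto simp: \<delta>_def)
      have q\<delta>: "?q n l = real l * \<delta>" for l by (simp add: \<delta>_def)
      \<comment> \<open>Survival is decided by the grid values up to \<open>l\<close>, hence known
        at the start of step \<open>l\<close>. This makes the killed coefficients adapted, and they
        are bounded because the state lies in \<open>S\<close>.\<close>
      define alive where "alive l \<omega> \<longleftrightarrow> (\<forall>m\<in>{..l}. ?q n m \<le> \<tau> \<omega> \<and> Xt (?q n m) \<omega> \<in> S)" for l \<omega>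
      define A where "A l \<omega> = (if alive l \<omega> then b (?q n l) \<omega> else 0)" for l \<omega>
      define G where "G l \<omega> = (if alive l \<omega> then H (?q n l) \<omega> else 0)" for l \<omega>
      have alive_meas: "Measurable.pred (F (?q n l)) (alive l)" for l
        unfolding alive_def[abs_def]
      proof (intro pred_intros_finite pred_intros_logic)
        fix m assume "m \<in> {..l}"
        then have le: "?q n m \<le> ?q n l" by (simp add: divide_right_mono)
        show "Measurable.pred (F (?q n l)) (\<lambda>\<omega>. ?q n m \<le> \<tau> \<omega>)" by (rule pred_F_mono[OF \<tau>_pred le])
        have "Xt (?q n m) \<in> borel_measurable (F (?q n l))" by (rule measurable_F_mono[OF Xt_meas le]) simp
        then show "Measurable.pred (F (?q n l)) (\<lambda>\<omega>. Xt (?q n m) \<omega> \<in> S)" using S(2) by measurable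
      qed simp
      have A_meas: "A l \<in> borel_measurable (F (real l * \<delta>))" and G_meas: "G l \<in> borel_measurable (F (real l * \<delta>))" for l
        unfolding A_def[abs_def] G_def[abs_def] q\<delta>[symmetric]
        by (intro measurable_If b_meas H_meas borel_measurable_const alive_meas[unfolded pred_def])+
      have alive_eq: "A l \<omega> = a (Xt (?q n l) \<omega>)" "G l \<omega> = \<sigma> (Xt (?q n l) \<omega>)" "Xt (?q n l) \<omega> \<in> S" "?q n l \<le> \<tau> \<omega>"
        if al: "alive l \<omega>" for l \<omega>
      proof -
        show *: "Xt (?q n l) \<omega> \<in> S" "?q n l \<le> \<tau> \<omega>" using al unfolding alive_def by blast+
        show "A l \<omega> = a (Xt (?q n l) \<omega>)" "G l \<omega> = \<sigma> (Xt (?q n l) \<omega>)"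
          using *(2) al by (simp_all add: A_def G_def b_def H_def Xt_def)
      qed
      have bd: "norm (A l \<omega>) \<le> Kb" "norm (G l \<omega>) \<le> Kb" for l \<omega>
      proof -
        show "norm (A l \<omega>) \<le> Kb" using alive_eq(1,3)[of l \<omega>] Kb by (cases "alive l \<omega>") (auto simp: A_def)
        show "norm (G l \<omega>) \<le> Kb" using alive_eq(2,3)[of l \<omega>] Kb by (cases "alive l \<omega>") (auto simp: G_def)
      qed
      define Z where "Z l \<omega> = euler_sum \<delta> x0 A G l \<omega>" for l \<omega>
      have Zm: "Z l \<in> borel_measurable M" for l
        unfolding Z_def[abs_def] using \<delta> A_meas G_meas
        by (intro borel_measurable_add borel_measurable_const borel_measurable_sum borel_measurable_scaleR
            measurable_F_M[OF incr_sum_measurable] measurable_F_M[OF A_meas]) auto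
      have Z_eq: "Z l \<omega> = Xt (?q n l) \<omega> - Err n l \<omega>" if "\<And>m. m < l \<Longrightarrow> alive m \<omega>" for l \<omega>
      proof -
        have "(\<Sum>m<l. \<delta> *\<^sub>R A m \<omega>) = (\<Sum>m<l. (1 / 2 ^ n) *\<^sub>R b (?q n m) \<omega>)"
          using that by (intro sum.cong) (auto simp: A_def \<delta>_def)
        moreover have "incr_sum \<delta> G l \<omega> = grid_sum n H l \<omega>"
          unfolding incr_sum_def \<delta>_def using that by (intro sum.cong) (auto simp: G_def)
        ultimately show ?thesis by (simp add: Z_def Err_def)
      qed
      have U_meas: "U \<in> borel_measurable borel"
        using uniform(1) by (auto intro!: borel_measurable_continuous_onI uniformly_continuous_imp_continuous)
      have UZ: "integrable M (\<lambda>\<omega>. U (Z l \<omega>))" for l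
        using measurable_compose[OF Zm U_meas] B(1) by (intro integrable_const_bound[where B=B0]) auto
      \<comment> \<open>Dead steps contribute 0. For a live step outside \<open>Bad\<close>, the
        derivatives at \<open>Z\<close> differ little from those at the true state in
        \<open>S\<close>, where \<open>gen\<close> applies.\<close>
      have \<Lambda>_bound: "D (Z l \<omega>) \<bullet> A l \<omega> + 1/2 * trace (transpose (G l \<omega>) ** Q (Z l \<omega>) ** G l \<omega>) \<le> q + \<Lambda> * indicator (Bad \<theta> n) \<omega>"
        if l: "l < ?J n" and sp: "\<omega> \<in> space M" for l \<omega>
      proof (cases "alive l \<omega>")
        case False
        then show ?thesis using q(1) \<Lambda> by (simp add: A_def G_def trace_def)
      next
        case True
        note eq = alive_eq[OF True]
        have inner_le: "u \<bullet> A l \<omega> \<le> \<eta> * Kb" if "norm u \<le> \<eta>" for u \<eta>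
          using that bd[of l \<omega>] Kb(1) order_trans[OF norm_ge_zero that]
          by (intro order_trans[OF norm_cauchy_schwarz] mult_mono) auto
        have trace_le: "trace (transpose (G l \<omega>) ** R ** G l \<omega>) \<le> dd * (Kb * \<eta> * Kb)" if "norm R \<le> \<eta>" for R \<eta>
        proof -
          have "trace (transpose (G l \<omega>) ** R ** G l \<omega>) \<le> dd * norm (transpose (G l \<omega>) ** R ** G l \<omega>)"
            using abs_trace_le[of "transpose (G l \<omega>) ** R ** G l \<omega>"] by (simp add: dd_def)
          also have "\<dots> \<le> dd * (Kb * \<eta> * Kb)" by (intro mult_left_mono norm_sandwich_le bd that) (simp add: dd_def)
          finally show ?thesis .
        qed
        show ?thesis
        proof (cases "\<omega> \<in> Bad \<theta> n")
          case True
          have "D (Z l \<omega>) \<bullet> A l \<omega> + 1/2 * trace (transpose (G l \<omega>) ** Q (Z l \<omega>) ** G l \<omega>) \<le> \<Lambda>"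
            unfolding \<Lambda>_def by (intro add_mono mult_left_mono inner_le trace_le B) simp
          then show ?thesis using True q(1) by simp
        next
          case nB: False
          let ?x = "Xt (?q n l) \<omega>"
          have "norm (Err n l \<omega>) \<le> \<theta>" using nB sp eq(4) l by (auto simp: Bad_def not_less)
          moreover have "Z l \<omega> = ?x - Err n l \<omega>" using True by (intro Z_eq) (auto simp: alive_def)
          ultimately have "dist (Z l \<omega>) ?x \<le> \<theta>" by (simp add: dist_norm)
          then have "norm (D (Z l \<omega>) - D ?x) \<le> \<epsilon>1" "norm (Q (Z l \<omega>) - Q ?x) \<le> \<epsilon>1"
            using t2(2)[of "Z l \<omega>" ?x] t3(2)[of "Z l \<omega>" ?x] \<theta> by (auto simp: dist_norm)
          then have h12: "D (Z l \<omega>) \<bullet> A l \<omega> - D ?x \<bullet> A l \<omega> \<le> \<epsilon>1 * Kb"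
            "trace (transpose (G l \<omega>) ** (Q (Z l \<omega>) - Q ?x) ** G l \<omega>) \<le> dd * (Kb * \<epsilon>1 * Kb)"
            unfolding inner_diff_left[symmetric] using inner_le trace_le by blast+
          have h3: "D ?x \<bullet> A l \<omega> + 1/2 * trace (transpose (G l \<omega>) ** Q ?x ** G l \<omega>) \<le> 0"
            using gen[OF eq(3)] unfolding eq(1,2) .
          have "trace (transpose (G l \<omega>) ** Q (Z l \<omega>) ** G l \<omega>) =
            trace (transpose (G l \<omega>) ** (Q (Z l \<omega>) - Q ?x) ** G l \<omega>) + trace (transpose (G l \<omega>) ** Q ?x ** G l \<omega>)"
            by (simp add: trace_add[symmetric] matrix_add_rdistrib[symmetric] matrix_add_ldistrib[symmetric])
          moreover have "p + 1/2 * (r + s) \<le> q" if "p - p0 \<le> y" "r \<le> z" "p0 + 1/2 * s \<le> 0" "y + 1/2 * z \<le> q"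
            for p p0 r s y z :: real using that by (simp add: field_simps)
          note this[OF h12 h3 \<epsilon>1(2)]
          ultimately have "D (Z l \<omega>) \<bullet> A l \<omega> + 1/2 * trace (transpose (G l \<omega>) ** Q (Z l \<omega>) ** G l \<omega>) \<le> q"
            by (simp only:)
          then show ?thesis using nB by simp
        qed
      qed
      have ind: "integrable M (\<lambda>\<omega>. indicator (Bad \<theta> n) \<omega> :: real)" "expectation (\<lambda>\<omega>. indicator (Bad \<theta> n) \<omega> :: real) = prob (Bad \<theta> n)"
        using integrable_real_indicator[OF Bad_ev] sets.sets_into_space[OF Bad_ev] Bad_ev
        by (auto simp: less_top[symmetric] Int_absorb1)
      have ind_hit: "integrable M (\<lambda>\<omega>. indicator (hit n) \<omega> :: real)"
        using integrable_real_indicator[OF hit_ev] by (auto simp: less_top[symmetric])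
      have "expectation (\<lambda>\<omega>. D (Z l \<omega>) \<bullet> A l \<omega> + 1/2 * trace (transpose (G l \<omega>) ** Q (Z l \<omega>) ** G l \<omega>)) \<le> q + \<Lambda> * prob (Bad \<theta> n)"
        if l: "l < ?J n" for l
      proof -
        \<comment> \<open>\<open>integral_mono'\<close> asks only for an integrable, nonnegative
          upper bound.\<close>
        have "expectation (\<lambda>\<omega>. D (Z l \<omega>) \<bullet> A l \<omega> + 1/2 * trace (transpose (G l \<omega>) ** Q (Z l \<omega>) ** G l \<omega>))
          \<le> expectation (\<lambda>\<omega>. q + \<Lambda> * indicator (Bad \<theta> n) \<omega>)"
          by (rule integral_mono') (use \<Lambda>_bound[OF l] ind q(1) \<Lambda> in auto)
        also have "\<dots> = q + \<Lambda> * prob (Bad \<theta> n)" using ind by (simp add: prob_space)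
        finally show ?thesis .
      qed
      then have "(\<Sum>l<?J n. \<delta> * expectation (\<lambda>\<omega>. D (Z l \<omega>) \<bullet> A l \<omega> + 1/2 * trace (transpose (G l \<omega>) ** Q (Z l \<omega>) ** G l \<omega>)))
        \<le> (\<Sum>l<?J n. \<delta> * (q + \<Lambda> * prob (Bad \<theta> n)))"
        using \<delta> by (intro sum_mono mult_left_mono) auto
      also have "\<dots> = real K * (q + \<Lambda> * prob (Bad \<theta> n))" by (simp add: \<delta>_def)
      finally have "expectation (\<lambda>\<omega>. U (Z (?J n) \<omega>)) \<le> U x0 + real K * (q + \<Lambda> * prob (Bad \<theta> n)) + real (?J n) * (q * \<delta> + C * \<delta>\<^sup>2)"
        using euler[OF \<delta> A_meas G_meas bd, of x0 "?J n"] unfolding Z_def by linarith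
      moreover have "real (?J n) * (q * \<delta> + C * \<delta>\<^sup>2) = real K * q + real K * C * (1/2) ^ n"
        by (simp add: \<delta>_def power2_eq_square field_simps power_one_over)
      moreover have "c * prob (hit n) \<le> expectation (\<lambda>\<omega>. U (Z (?J n) \<omega>)) + q + c * prob (Bad \<theta> n)"
      proof -
        \<comment> \<open>On a hit at index \<open>l\<close> the sum is alive up to \<open>l\<close>
          and, as \<open>L\<close> and \<open>S\<close> are disjoint, frozen from then on. Its final
          value is therefore still within \<theta> of a point of \<open>L\<close>.\<close>
        have pt: "c * indicator (hit n) \<omega> \<le> U (Z (?J n) \<omega>) + q + c * indicator (Bad \<theta> n) \<omega>" if sp: "\<omega> \<in> space M" for \<omega>
        proof (cases "\<omega> \<in> hit n - Bad \<theta> n")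
          case False
          then show ?thesis using nonneg[of "Z (?J n) \<omega>"] q(1) c(1) by (auto simp: indicator_def)
        next
          case True
          then obtain l where l: "l \<le> ?J n" "?q n l \<le> \<tau> \<omega>" "Xt (?q n l) \<omega> \<in> L" "\<And>m. m < l \<Longrightarrow> Xt (?q n m) \<omega> \<in> S"
            unfolding hit_eq by blast
          have "?q n m \<le> \<tau> \<omega>" if "m \<le> l" for m
          proof -
            have "?q n m \<le> ?q n l" using that by (simp add: divide_right_mono)
            then show ?thesis using l(2) by simp
          qed
          then have al: "alive m \<omega>" if "m < l" for m using that l(4) by (auto simp: alive_def)
          have dead: "\<not> alive m \<omega>" if "l \<le> m" for m using that l(3) L(2) by (auto simp: alive_def)
          have "Z (?J n) \<omega> = Z l \<omega>"
          proof -
            have "(\<Sum>m<?J n. \<delta> *\<^sub>R A m \<omega>) = (\<Sum>m<l. \<delta> *\<^sub>R A m \<omega>)"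
              using l(1) dead by (intro sum.mono_neutral_right) (auto simp: A_def)
            moreover have "incr_sum \<delta> G (?J n) \<omega> = incr_sum \<delta> G l \<omega>"
              unfolding incr_sum_def using l(1) dead by (intro sum.mono_neutral_right) (auto simp: G_def)
            ultimately show ?thesis by (simp add: Z_def)
          qed
          moreover have "Z l \<omega> = Xt (?q n l) \<omega> - Err n l \<omega>" using al by (rule Z_eq)
          moreover have "norm (Err n l \<omega>) \<le> \<theta>" using True sp l(1,2) by (auto simp: Bad_def not_less)
          ultimately have "dist (Z (?J n) \<omega>) (Xt (?q n l) \<omega>) < t1" using \<theta> by (simp add: dist_norm)
          then have "dist (U (Z (?J n) \<omega>)) (U (Xt (?q n l) \<omega>)) < q" by (rule t1(2))
          then have "c \<le> U (Z (?J n) \<omega>) + q" using c(2)[OF l(3)] by (simp add: dist_real_def)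
          then show ?thesis using True by simp
        qed
        have "expectation (\<lambda>\<omega>. c * indicator (hit n) \<omega>) \<le> expectation (\<lambda>\<omega>. U (Z (?J n) \<omega>) + q + c * indicator (Bad \<theta> n) \<omega>)"
          by (intro integral_mono pt) (use ind_hit UZ ind in auto)
        also have "\<dots> = expectation (\<lambda>\<omega>. U (Z (?J n) \<omega>)) + q + c * prob (Bad \<theta> n)"
          using UZ ind by (simp add: prob_space)
        finally show ?thesis using hit_ev by simp
      qed
      ultimately have "c * prob (hit n) \<le> U x0 + q * (1 + 2 * real K) + ((c + real K * \<Lambda>) * prob (Bad \<theta> n) + real K * C * (1/2) ^ n)"
        by (simp add: algebra_simps)
      then show ?thesis unfolding q(2) .
    qed
    have "(\<lambda>n. (c + real K * \<Lambda>) * prob (Bad \<theta> n) + real K * C * (1/2) ^ n) \<longlonglongrightarrow> (c + real K * \<Lambda>) * 0 + real K * C * 0"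
      by (intro tendsto_intros Bad_lim \<theta> LIMSEQ_realpow_zero) auto
    then have "\<forall>\<^sub>F n in sequentially. (c + real K * \<Lambda>) * prob (Bad \<theta> n) + real K * C * (1/2) ^ n < e / 2"
      using e by (intro order_tendstoD) auto
    then show ?thesis
    proof eventually_elim
      case (elim n)
      then show ?case using main[of n] by linarith
    qed
  qed
qed

end

section \<open>Exit from the safe set\<close>

text \<open>The upper level is extended real so that \<open>\<infinity>\<close> gives
  \<open>{x. 0 < h x}\<close>; transient safety and safety then become the same statement about a
  band.\<close>

definition band :: "(real^'n \<Rightarrow> real) \<Rightarrow> ereal \<Rightarrow> (real^'n) set" where
  "band h \<mu> = {x. 0 < h x \<and> ereal (h x) \<le> \<mu>}"

text \<open>Collects the analysis of a single path; no probability is involved.\<close>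

locale stopped_path =
  fixes X :: "real \<Rightarrow> 'a \<Rightarrow> real^'n" and \<zeta> :: "'a \<Rightarrow> ereal" and h :: "real^'n \<Rightarrow> real" and \<mu> :: ereal and \<omega> :: 'a
  assumes \<zeta>_pos: "0 < \<zeta> \<omega>"
    and path: "continuous_on {t. 0 \<le> t \<and> ereal t < \<zeta> \<omega>} (\<lambda>t. X t \<omega>)"
    and explosion: "\<zeta> \<omega> < \<infinity> \<Longrightarrow> Limsup (at_left (real_of_ereal (\<zeta> \<omega>))) (\<lambda>t. ereal (norm (X t \<omega>))) = \<infinity>"
    and h_cont: "continuous_on UNIV h"
    and proper: "bounded {x. 0 \<le> h x}"
begin

abbreviation "T \<equiv> exit_time X \<zeta> (band h \<mu>) \<omega>"

lemma T_nonneg: "0 \<le> T"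
  unfolding exit_time_def by (rule Inf_greatest) auto

lemma before_exit:
  assumes "0 \<le> t" "ereal t < \<zeta> \<omega>" "ereal t < T" shows "X t \<omega> \<in> band h \<mu>"
proof (rule ccontr)
  assume "X t \<omega> \<notin> band h \<mu>"
  then have "T \<le> ereal t" unfolding exit_time_def by (intro Inf_lower) (use assms in auto)
  then show False using assms(3) by simp
qed

text \<open>A path that never leaves the band stays in the bounded set
  \<open>{x. 0 \<le> h x}\<close> and cannot explode in finite time. Stopping at the exit therefore
  never reads the arbitrary values of \<open>X\<close> after the explosion.\<close>

lemma exit_lt_explosion: "T < \<zeta> \<omega> \<or> (T = \<infinity> \<and> \<zeta> \<omega> = \<infinity>)"
proof (cases "\<exists>t\<ge>0. ereal t < \<zeta> \<omega> \<and> X t \<omega> \<notin> band h \<mu>")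
  case True
  then obtain t where t: "0 \<le> t" "ereal t < \<zeta> \<omega>" "X t \<omega> \<notin> band h \<mu>" by blast
  then have "T \<le> ereal t" unfolding exit_time_def by (intro Inf_lower) auto
  then show ?thesis using t(2) by (auto intro: le_less_trans)
next
  case False
  then have "{ereal t | t. 0 \<le> t \<and> ereal t < \<zeta> \<omega> \<and> X t \<omega> \<notin> band h \<mu>} = {}" by auto
  then have T: "T = \<infinity>" unfolding exit_time_def by (simp only: Inf_empty top_ereal_def)
  have "\<not> \<zeta> \<omega> < \<infinity>"
  proof
    assume fin: "\<zeta> \<omega> < \<infinity>"
    then obtain z where z: "\<zeta> \<omega> = ereal z" "0 < z" using \<zeta>_pos by (cases "\<zeta> \<omega>") auto
    obtain B where B: "\<And>x. 0 \<le> h x \<Longrightarrow> norm x \<le> B" using proper unfolding bounded_iff by blast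
    have "\<forall>\<^sub>F t in at_left z. t \<in> {0<..<z}" using eventually_at_left_real[OF z(2)] .
    then have "\<forall>\<^sub>F t in at_left z. ereal (norm (X t \<omega>)) \<le> ereal B"
    proof eventually_elim
      case (elim t)
      then have "X t \<omega> \<in> band h \<mu>" using False z(1) by auto
      then show ?case using B by (auto simp: band_def)
    qed
    then have "Limsup (at_left z) (\<lambda>t. ereal (norm (X t \<omega>))) \<le> ereal B" by (rule Limsup_bounded)
    then show False using explosion[OF fin] z by simp
  qed
  then show ?thesis using T by simp
qed

lemma upto_exit_lt_explosion: "ereal t \<le> T \<Longrightarrow> ereal t < \<zeta> \<omega>"
  using exit_lt_explosion by (auto intro: le_less_trans)

lemma stopped_inf_eq: "stopped_inf h X (exit_time X \<zeta> (band h \<mu>)) \<omega> = (INF s\<in>{s. 0 \<le> s \<and> ereal s \<le> T}. ereal (h (X s \<omega>)))"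
proof -
  have "(\<lambda>t. real_of_ereal (min (ereal t) T)) ` {0..} = {s. 0 \<le> s \<and> ereal s \<le> T}"
  proof (intro equalityI subsetI)
    fix s assume "s \<in> (\<lambda>t. real_of_ereal (min (ereal t) T)) ` {0..}"
    then obtain t where t: "0 \<le> t" "s = real_of_ereal (min (ereal t) T)" by auto
    show "s \<in> {s. 0 \<le> s \<and> ereal s \<le> T}"
      using t T_nonneg by (cases T) (auto simp: min_def)
  next
    fix s assume "s \<in> {s. 0 \<le> s \<and> ereal s \<le> T}"
    then have "s = real_of_ereal (min (ereal s) T)" "s \<in> {0..}" by (auto simp: min_absorb1)
    then show "s \<in> (\<lambda>t. real_of_ereal (min (ereal t) T)) ` {0..}" by blast
  qed
  note eq = this
  show ?thesis unfolding stopped_inf_def eq[symmetric] image_image by (rule refl)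
qed

lemma stopped_inf_pos_iff:
  "0 < stopped_inf h X (exit_time X \<zeta> (band h \<mu>)) \<omega> \<longleftrightarrow>
    (\<exists>e>0. \<forall>s. 0 \<le> s \<longrightarrow> ereal s \<le> T \<longrightarrow> e \<le> h (X s \<omega>))"
proof
  assume "0 < stopped_inf h X (exit_time X \<zeta> (band h \<mu>)) \<omega>"
  then obtain e where e: "0 < ereal e" "ereal e < stopped_inf h X (exit_time X \<zeta> (band h \<mu>)) \<omega>"
    using ereal_dense2 by blast
  have "e \<le> h (X s \<omega>)" if "0 \<le> s" "ereal s \<le> T" for s
  proof -
    have "stopped_inf h X (exit_time X \<zeta> (band h \<mu>)) \<omega> \<le> ereal (h (X s \<omega>))"
      unfolding stopped_inf_eq by (rule INF_lower) (use that in auto)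
    then show ?thesis using e(2) by (metis ereal_less_eq(3) less_imp_le order_trans)
  qed
  then show "\<exists>e>0. \<forall>s. 0 \<le> s \<longrightarrow> ereal s \<le> T \<longrightarrow> e \<le> h (X s \<omega>)" using e(1) by auto
next
  assume "\<exists>e>0. \<forall>s. 0 \<le> s \<longrightarrow> ereal s \<le> T \<longrightarrow> e \<le> h (X s \<omega>)"
  then obtain e where e: "0 < e" "\<And>s. 0 \<le> s \<Longrightarrow> ereal s \<le> T \<Longrightarrow> e \<le> h (X s \<omega>)" by blast
  have "ereal e \<le> stopped_inf h X (exit_time X \<zeta> (band h \<mu>)) \<omega>"
    unfolding stopped_inf_eq by (rule INF_greatest) (use e in auto)
  then show "0 < stopped_inf h X (exit_time X \<zeta> (band h \<mu>)) \<omega>" using e(1) by (metis ereal_less(2) less_le_trans)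
qed

lemma h_path: "continuous_on {t. 0 \<le> t \<and> ereal t < \<zeta> \<omega>} (\<lambda>t. h (X t \<omega>))"
  by (rule continuous_on_compose2[OF h_cont path]) simp

lemma h_tendsto:
  assumes "0 \<le> t" "ereal t < \<zeta> \<omega>"
  shows "((\<lambda>s. h (X s \<omega>)) \<longlongrightarrow> h (X t \<omega>)) (at t within {t. 0 \<le> t \<and> ereal t < \<zeta> \<omega>})"
  using h_path assms unfolding continuous_on_def by blast

lemma h_near:
  assumes t: "0 \<le> t" "ereal t < \<zeta> \<omega>" and P: "open P" "h (X t \<omega>) \<in> P"
  obtains d where "0 < d" "\<And>s. 0 \<le> s \<Longrightarrow> ereal s < \<zeta> \<omega> \<Longrightarrow> \<bar>s - t\<bar> < d \<Longrightarrow> h (X s \<omega>) \<in> P"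
proof -
  have "\<forall>\<^sub>F s in at t within {t. 0 \<le> t \<and> ereal t < \<zeta> \<omega>}. h (X s \<omega>) \<in> P"
    using topological_tendstoD[OF h_tendsto[OF t] P] .
  then obtain d where "0 < d" "\<And>s. 0 \<le> s \<Longrightarrow> ereal s < \<zeta> \<omega> \<Longrightarrow> s \<noteq> t \<Longrightarrow> dist s t < d \<Longrightarrow> h (X s \<omega>) \<in> P"
    unfolding eventually_at by auto
  then show thesis using P(2) by (intro that[of d]) (auto simp: dist_real_def)
qed

lemma open_above: "open {v::real. \<mu> < ereal v}"
proof -
  have "open (ereal -` {\<mu><..})" by (intro open_vimage open_greaterThan continuous_on_ereal continuous_on_id)
  then show ?thesis by (simp add: vimage_def)
qed

text \<open>Serves measurability: the exit time disappears, and only countably many values of the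
  path remain. A low value at a rational time is harmless if \<open>h\<close> was above the upper
  level at an earlier rational time.\<close>

lemma stopped_inf_pos_rational:
  "0 < stopped_inf h X (exit_time X \<zeta> (band h \<mu>)) \<omega> \<longleftrightarrow>
    (\<exists>j::nat. \<forall>r::rat. 0 \<le> real_of_rat r \<longrightarrow> ereal (real_of_rat r) < \<zeta> \<omega> \<longrightarrow>
       1 / real (Suc j) \<le> h (X (real_of_rat r) \<omega>) \<or>
       (\<exists>s::rat. 0 \<le> real_of_rat s \<and> real_of_rat s < real_of_rat r \<and> \<mu> < ereal (h (X (real_of_rat s) \<omega>))))"
  (is "_ \<longleftrightarrow> (\<exists>j. ?P j)")
proof
  assume "0 < stopped_inf h X (exit_time X \<zeta> (band h \<mu>)) \<omega>"
  then obtain e where e: "0 < e" "\<And>s. 0 \<le> s \<Longrightarrow> ereal s \<le> T \<Longrightarrow> e \<le> h (X s \<omega>)"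
    unfolding stopped_inf_pos_iff by blast
  obtain j where j: "1 / real (Suc j) < e" using nat_approx_posE[OF e(1)] by blast
  have "?P j"
  proof (intro allI impI)
    fix r :: rat assume r: "0 \<le> real_of_rat r" "ereal (real_of_rat r) < \<zeta> \<omega>"
    show "1 / real (Suc j) \<le> h (X (real_of_rat r) \<omega>) \<or>
       (\<exists>s::rat. 0 \<le> real_of_rat s \<and> real_of_rat s < real_of_rat r \<and> \<mu> < ereal (h (X (real_of_rat s) \<omega>)))"
    proof (cases "ereal (real_of_rat r) \<le> T")
      case True then show ?thesis using e(2)[OF r(1)] j by force
    next
      case False
      then obtain t where t: "T = ereal t" "0 \<le> t" "t < real_of_rat r" using T_nonneg by (cases T) auto
      have tz: "ereal t < \<zeta> \<omega>" using t r(2) by (metis ereal_less_eq(3) less_imp_le order_le_less_trans)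
      have "0 < h (X t \<omega>)" using e(2)[of t] e(1) t by simp
      then obtain d where d: "0 < d" "\<And>s. 0 \<le> s \<Longrightarrow> ereal s < \<zeta> \<omega> \<Longrightarrow> \<bar>s - t\<bar> < d \<Longrightarrow> h (X s \<omega>) \<in> {0<..}"
        using h_near[OF t(2) tz, of "{0<..}"] by auto
      \<comment> \<open>By continuity \<open>h\<close> is still positive shortly after the exit
        time, so a point outside the band found there must lie above the upper level; that condition
        is open and persists at a rational time.\<close>
      have "T < ereal (min (t + d) (real_of_rat r))" using t d(1) by simp
      then obtain u where u: "0 \<le> u" "ereal u < \<zeta> \<omega>" "X u \<omega> \<notin> band h \<mu>" "u < t + d" "u < real_of_rat r"
        unfolding exit_time_def Inf_less_iff by auto
      have "T \<le> ereal u" unfolding exit_time_def by (intro Inf_lower) (use u in auto)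
      then have "t \<le> u" using t by simp
      then have "0 < h (X u \<omega>)" using d(2)[OF u(1,2)] u(4) by simp
      then have "\<mu> < ereal (h (X u \<omega>))" using u(3) by (auto simp: band_def)
      then obtain d' where d': "0 < d'" "\<And>s. 0 \<le> s \<Longrightarrow> ereal s < \<zeta> \<omega> \<Longrightarrow> \<bar>s - u\<bar> < d' \<Longrightarrow> \<mu> < ereal (h (X s \<omega>))"
        using h_near[OF u(1,2) open_above] by auto
      obtain s where s: "u < real_of_rat s" "real_of_rat s < min (u + d') (real_of_rat r)"
        using of_rat_dense[of u "min (u + d') (real_of_rat r)"] d'(1) u(5) by auto
      have "ereal (real_of_rat s) < \<zeta> \<omega>" using s r(2) by (metis ereal_less_eq(3) less_imp_le min_less_iff_conj order_le_less_trans)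
      moreover have s0: "0 \<le> (real_of_rat s :: real)" "\<bar>real_of_rat s - u\<bar> < d'" using s u(1) by linarith+
      ultimately have "\<mu> < ereal (h (X (real_of_rat s) \<omega>))" using d'(2) by blast
      then show ?thesis using s s0(1) by (intro disjI2 exI[of _ s]) auto
    qed
  qed
  then show "\<exists>j. ?P j" ..
next
  assume "\<exists>j. ?P j"
  then obtain j where j: "?P j" ..
  define e where "e = 1 / real (Suc j)"
  have e0: "0 < e" by (simp add: e_def)
  have rat: "e \<le> h (X (real_of_rat r) \<omega>)" if r: "0 \<le> real_of_rat r" "ereal (real_of_rat r) \<le> T" for r
  proof -
    have "\<not> \<mu> < ereal (h (X (real_of_rat s) \<omega>))" if "0 \<le> real_of_rat s" "real_of_rat s < real_of_rat r" for s
    proof -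
      have "ereal (real_of_rat s) < T" using that(2) r(2) by (metis less_ereal.simps(1) less_le_trans)
      then have "X (real_of_rat s) \<omega> \<in> band h \<mu>"
        using that(1) by (intro before_exit upto_exit_lt_explosion) auto
      then show ?thesis by (simp add: band_def not_less)
    qed
    then show ?thesis using j r(1) upto_exit_lt_explosion[OF r(2)] unfolding e_def by blast
  qed
  have "e \<le> h (X s \<omega>)" if s: "0 \<le> s" "ereal s \<le> T" for s
  proof (cases "s = 0")
    case True then show ?thesis using rat[of 0] s by simp
  next
    case False
    show ?thesis
    proof (rule ccontr)
      assume "\<not> e \<le> h (X s \<omega>)"
      then obtain d where d: "0 < d" "\<And>u. 0 \<le> u \<Longrightarrow> ereal u < \<zeta> \<omega> \<Longrightarrow> \<bar>u - s\<bar> < d \<Longrightarrow> h (X u \<omega>) \<in> {..<e}"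
        using h_near[OF s(1) upto_exit_lt_explosion[OF s(2)], of "{..<e}"] by auto
      \<comment> \<open>Approaching \<open>s\<close> from the left keeps the rational time within
        the stopped interval, even if \<open>s\<close> is the exit time.\<close>
      obtain r where r: "max 0 (s - d) < real_of_rat r" "real_of_rat r < s"
        using of_rat_dense[of "max 0 (s - d)" s] d(1) s(1) False by auto
      have rT: "ereal (real_of_rat r) \<le> T" using r(2) s(2) by (metis ereal_less_eq(3) less_imp_le order_trans)
      have "h (X (real_of_rat r) \<omega>) < e" using d(2)[of "real_of_rat r"] upto_exit_lt_explosion[OF rT] r by auto
      then show False using rat[OF _ rT] r(1) by simp
    qed
  qed
  then show "0 < stopped_inf h X (exit_time X \<zeta> (band h \<mu>)) \<omega>" unfolding stopped_inf_pos_iff using e0 by blast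
qed

text \<open>Before the exit time the upper bound is part of the band, and at the exit time it
  survives by continuity from the left. An exit at time 0 has no earlier times, which is why the
  start is required to lie in the band.\<close>

lemma not_stopped_inf_pos:
  assumes "\<not> 0 < stopped_inf h X (exit_time X \<zeta> (band h \<mu>)) \<omega>" and "X 0 \<omega> \<in> band h \<mu>" and "0 < \<delta>"
  obtains t where "0 \<le> t" "ereal t < \<zeta> \<omega>" "h (X t \<omega>) < \<delta>" "\<And>s. 0 \<le> s \<Longrightarrow> s \<le> t \<Longrightarrow> ereal (h (X s \<omega>)) \<le> \<mu>"
proof -
  obtain t where t: "0 \<le> t" "ereal t \<le> T" "h (X t \<omega>) < \<delta>"
    using assms(1,3) unfolding stopped_inf_pos_iff by (metis not_le)
  have "ereal (h (X s \<omega>)) \<le> \<mu>" if s: "0 \<le> s" "s \<le> t" for s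
  proof (cases "s = 0")
    case True then show ?thesis using assms(2) by (simp add: band_def)
  next
    case False
    have sT: "ereal s \<le> T" using s(2) t(2) by (metis ereal_less_eq(3) order_trans)
    show ?thesis
    proof (rule ccontr)
      assume "\<not> ereal (h (X s \<omega>)) \<le> \<mu>"
      then obtain d where d: "0 < d" "\<And>u. 0 \<le> u \<Longrightarrow> ereal u < \<zeta> \<omega> \<Longrightarrow> \<bar>u - s\<bar> < d \<Longrightarrow> h (X u \<omega>) \<in> {v. \<mu> < ereal v}"
        using h_near[OF s(1) upto_exit_lt_explosion[OF sT] open_above] by (auto simp: not_le)
      \<comment> \<open>An earlier time within \<open>d\<close> of \<open>s\<close>; the term
        \<open>s / 2\<close> keeps it nonnegative.\<close>
      define u where "u = max (s / 2) (s - d / 2)"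
      have u: "0 \<le> u" "u < s" "\<bar>u - s\<bar> < d" using s False d(1) by (auto simp: u_def max_def)
      have uT: "ereal u < T" using u(2) sT by (metis less_ereal.simps(1) less_le_trans)
      have uz: "ereal u < \<zeta> \<omega>" by (rule upto_exit_lt_explosion) (use uT in simp)
      then show False using before_exit[OF u(1) uz uT] d(2)[OF u(1) uz u(3)] by (auto simp: band_def)
    qed
  qed
  then show thesis using t upto_exit_lt_explosion[OF t(2)] by (intro that[of t]) auto
qed

text \<open>The path enters the layer \<open>0 \<le> h \<le> \<delta>\<close> at a grid point: on a fine grid \<open>h\<close> changes by less
  than \<open>\<delta>\<close> in one step, so the first grid point with \<open>h \<le> \<delta>\<close> still satisfies \<open>h \<ge> 0\<close>.\<close>

lemma eventually_hits_on_grid: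
  assumes t: "0 \<le> t" "ereal t < \<zeta> \<omega>" "h (X t \<omega>) < \<delta>"
    and le: "\<And>s. 0 \<le> s \<Longrightarrow> s \<le> t \<Longrightarrow> ereal (h (X s \<omega>)) \<le> \<mu>" and x0: "\<delta> < h (X 0 \<omega>)" and "0 < \<delta>" and K: "t \<le> real K"
  shows "\<forall>\<^sub>F n in sequentially. \<exists>l\<le>K * 2 ^ n. real l / 2 ^ n \<le> t \<and> X (real l / 2 ^ n) \<omega> \<in> {x. 0 \<le> h x \<and> h x \<le> \<delta>} \<and>
    (\<forall>m<l. X (real m / 2 ^ n) \<omega> \<in> {x. \<delta> < h x \<and> ereal (h x) \<le> \<mu>})"
proof -
  have sub: "{0..t} \<subseteq> {t. 0 \<le> t \<and> ereal t < \<zeta> \<omega>}"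
    using t(2) by (auto intro: le_less_trans[of _ "ereal t"])
  have "uniformly_continuous_on {0..t} (\<lambda>t. h (X t \<omega>))"
    by (intro compact_uniformly_continuous continuous_on_subset[OF h_path sub]) auto
  \<comment> \<open>Two moduli in one: \<delta> prevents a step from jumping over the layer, and
    \<open>\<delta> - h (X t \<omega>)\<close> ensures that the last grid point up to
    \<open>t\<close> already has \<open>h\<close> at most \<delta>.\<close>
  then obtain d where d: "0 < d" "\<And>s u. s \<in> {0..t} \<Longrightarrow> u \<in> {0..t} \<Longrightarrow> dist u s < d \<Longrightarrow> dist (h (X u \<omega>)) (h (X s \<omega>)) < min \<delta> (\<delta> - h (X t \<omega>))"
    unfolding uniformly_continuous_on_def using t(3) \<open>0 < \<delta>\<close> by (metis diff_gt_0_iff_gt min_less_iff_conj)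
  have "(\<lambda>n. (1/2) ^ n) \<longlonglongrightarrow> (0::real)" by (rule LIMSEQ_realpow_zero) auto
  then have "\<forall>\<^sub>F n in sequentially. (1/2) ^ n < d" using d(1) by (rule order_tendstoD)
  then show ?thesis
  proof eventually_elim
    case (elim n)
    then have n: "1 / 2 ^ n < d" by (simp add: power_one_over)
    let ?q = "\<lambda>l. real l / 2 ^ n"
    define i where "i = nat \<lfloor>t * 2 ^ n\<rfloor>"
    have i: "real i \<le> t * 2 ^ n" "t * 2 ^ n < real i + 1" using t(1) by (auto simp: i_def) 
    have qi: "?q i \<le> t" "t - ?q i < 1 / 2 ^ n"
    proof -
      show "?q i \<le> t" using i(1) by (simp add: divide_le_eq)
      have "t < (real i + 1) / 2 ^ n" using i(2) by (simp add: less_divide_eq)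
      then show "t - ?q i < 1 / 2 ^ n" by (simp add: add_divide_distrib)
    qed
    have "dist (h (X (?q i) \<omega>)) (h (X t \<omega>)) < \<delta> - h (X t \<omega>)"
      using d(2)[of t "?q i"] qi n t(1) by (auto simp: dist_real_def)
    then have hi: "h (X (?q i) \<omega>) \<le> \<delta>" by (auto simp: dist_real_def)
    define l where "l = (LEAST l. h (X (?q l) \<omega>) \<le> \<delta>)"
    have l: "h (X (?q l) \<omega>) \<le> \<delta>" unfolding l_def by (rule LeastI[where P="\<lambda>l. h (X (?q l) \<omega>) \<le> \<delta>", OF hi])
    have li: "l \<le> i" unfolding l_def by (rule Least_le[where P="\<lambda>l. h (X (?q l) \<omega>) \<le> \<delta>", OF hi])
    have lt: "\<delta> < h (X (?q m) \<omega>)" if "m < l" for m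
      using not_less_Least[of m "\<lambda>l. h (X (?q l) \<omega>) \<le> \<delta>"] that unfolding l_def by simp
    have ql: "?q m \<le> t" if "m \<le> l" for m
    proof -
      have "?q m \<le> ?q i" using that li by (simp add: divide_right_mono)
      then show ?thesis using qi(1) by simp
    qed
    have "l \<noteq> 0" using l x0 by (intro notI) simp
    then obtain l' where l': "l = Suc l'" by (cases l) auto
    have "dist (h (X (?q l) \<omega>)) (h (X (?q l') \<omega>)) < \<delta>"
    proof -
      have "dist (?q l) (?q l') = 1 / 2 ^ n" by (simp add: l' dist_real_def field_simps)
      then show ?thesis using d(2)[of "?q l'" "?q l"] ql[of l] ql[of l'] n l' by auto
    qed
    then have "0 \<le> h (X (?q l) \<omega>)" using lt[of l'] l' by (auto simp: dist_real_def)
    moreover have "l \<le> K * 2 ^ n"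
    proof -
      have "real i \<le> real K * 2 ^ n" using i(1) K by (meson mult_right_mono order_trans zero_le_numeral zero_le_power)
      then have "real i \<le> real (K * 2 ^ n)" by simp
      then show ?thesis using li by linarith
    qed
    ultimately show ?case using l lt ql le by (intro exI[of _ l]) auto
  qed
qed

end

text \<open>Almost every outcome of \<open>B\<close> lies in all late \<open>A n\<close>, so
  \<open>B - A n\<close> has vanishing probability and the bound carries over to \<open>B\<close>.
  Applied once to the mesh and once to the horizon.\<close>

lemma (in prob_space) prob_le_if_eventually_in:
  assumes B: "B \<in> events" and A: "\<And>n. A n \<in> events" and ev: "AE \<omega> in M. \<omega> \<in> B \<longrightarrow> (\<forall>\<^sub>F n in sequentially. \<omega> \<in> A n)"
    and c: "0 \<le> c" and le: "\<And>e. 0 < e \<Longrightarrow> \<forall>\<^sub>F n in sequentially. c * prob (A n) \<le> u + e"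
  shows "c * prob B \<le> u"
proof (rule field_le_epsilon)
  fix e :: real assume e: "0 < e"
  have "(\<lambda>n. prob (B - A n)) \<longlonglongrightarrow> 0"
  proof (rule prob_tendsto_zero)
    show "AE \<omega> in M. \<forall>\<^sub>F n in sequentially. \<omega> \<notin> B - A n"
      using ev
    proof eventually_elim
      case (elim \<omega>)
      show ?case
      proof (cases "\<omega> \<in> B")
        case True
        with elim have "\<forall>\<^sub>F n in sequentially. \<omega> \<in> A n" by simp
        then show ?thesis by eventually_elim simp
      qed simp
    qed
  qed (use A B in auto)
  then have "(\<lambda>n. c * prob (B - A n)) \<longlonglongrightarrow> c * 0" by (intro tendsto_intros)
  then have "\<forall>\<^sub>F n in sequentially. c * prob (B - A n) < e / 2" using e by (intro order_tendstoD) auto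
  moreover have "\<forall>\<^sub>F n in sequentially. c * prob (A n) \<le> u + e / 2" using le[of "e / 2"] e by simp
  ultimately have "\<forall>\<^sub>F n in sequentially. c * prob B \<le> u + e"
  proof eventually_elim
    case (elim n)
    have "prob B \<le> prob (A n \<union> (B - A n))" using A B by (intro finite_measure_mono) auto
    also have "\<dots> \<le> prob (A n) + prob (B - A n)" using A B by (intro measure_Un_le) auto
    finally have "c * prob B \<le> c * prob (A n) + c * prob (B - A n)"
      using c by (metis distrib_left mult_left_mono)
    then show ?case using elim by linarith
  qed
  then show "c * prob B \<le> u + e" by (simp add: eventually_sequentially) blast
qed

section \<open>Positivity of \<open>h\<close> along a maximal solution\<close>

context wiener_process
begin

text \<open>Failure forces the path, for each small \<delta>, into the layer
  \<open>0 \<le> h \<le> \<delta>\<close> while \<open>h\<close> has stayed at most \<mu>.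
  \<open>hit_estimate\<close> bounds the probability of seeing this on a grid, and the mesh, the
  horizon and \<delta> are then sent to their limits in this order.\<close>

lemma maximal_solution_stays_positive:
  fixes X :: "real \<Rightarrow> 'a \<Rightarrow> real^'n" and h :: "real^'n \<Rightarrow> real" and \<sigma> :: "real^'n \<Rightarrow> real^'d^'n"
    and f :: "real^'n \<Rightarrow> real^'n" and g :: "real^'n \<Rightarrow> real^'m^'n" and \<mu> :: ereal
  assumes sol: "maximal_solution M F W (closed_loop_drift f g u\<^sub>o \<phi>) \<sigma> x0 X \<zeta>"
    and drift_cont: "continuous_on UNIV (closed_loop_drift f g u\<^sub>o \<phi>)" and \<sigma>_cont: "continuous_on UNIV \<sigma>"
    and C2: "C2 h" and proper: "\<And>L. compact {x. L \<le> h x}" and b: "0 < b"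
    and zcbf: "\<And>x. x \<in> band h \<mu> \<Longrightarrow> b * H_op \<sigma> h x \<le> generator f g \<sigma> (\<phi> x) (u\<^sub>o x) h x"
    and x0: "x0 \<in> band h \<mu>"
  shows "1 - exp (- b * h x0) \<le> prob {\<omega>\<in>space M. 0 < stopped_inf h X (exit_time X \<zeta> (band h \<mu>)) \<omega>}"
proof -
  let ?a = "closed_loop_drift f g u\<^sub>o \<phi>"
  have \<zeta>m: "\<And>t. 0 \<le> t \<Longrightarrow> Measurable.pred (F t) (\<lambda>\<omega>. \<zeta> \<omega> \<le> ereal t)"
    and Xm: "\<And>t. 0 \<le> t \<Longrightarrow> (\<lambda>\<omega>. if ereal t < \<zeta> \<omega> then X t \<omega> else 0) \<in> borel_measurable (F t)"
    and Xc: "\<And>\<omega>. \<omega> \<in> space M \<Longrightarrow> continuous_on {t. 0 \<le> t \<and> ereal t < \<zeta> \<omega>} (\<lambda>t. X t \<omega>)"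
    and X0: "AE \<omega> in M. X 0 \<omega> = x0"
    and expl: "\<And>\<omega>. \<omega> \<in> space M \<Longrightarrow> \<zeta> \<omega> < \<infinity> \<Longrightarrow> Limsup (at_left (real_of_ereal (\<zeta> \<omega>))) (\<lambda>t. ereal (norm (X t \<omega>))) = \<infinity>"
    using sol unfolding maximal_solution_def by blast+
  obtain \<tau> :: "nat \<Rightarrow> 'a \<Rightarrow> real" where \<tau>: "\<And>k. stopping_time F (\<tau> k)"
    "\<And>\<omega> k. \<omega> \<in> space M \<Longrightarrow> 0 \<le> \<tau> k \<omega> \<and> ereal (\<tau> k \<omega>) < \<zeta> \<omega>"
    "\<And>\<omega>. \<omega> \<in> space M \<Longrightarrow> (\<lambda>k. ereal (\<tau> k \<omega>)) \<longlonglongrightarrow> \<zeta> \<omega>"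
    and ito: "\<And>k t. 0 \<le> t \<Longrightarrow> \<exists>I. has_ito_integral M F W (\<lambda>s \<omega>. if s \<le> \<tau> k \<omega> then \<sigma> (X s \<omega>) else 0) t I \<and>
      (AE \<omega> in M. X (min t (\<tau> k \<omega>)) \<omega> = x0 + integral {0..min t (\<tau> k \<omega>)} (\<lambda>s. ?a (X s \<omega>)) + I \<omega>)"
    using sol unfolding maximal_solution_def by blast
  have h_cont: "continuous_on UNIV h"
    using C2_has_derivative(1)[OF C2] by (intro has_derivative_continuous_on[of UNIV]) (rule has_derivative_at_withinI)
  then have [measurable]: "h \<in> borel_measurable borel" by (rule borel_measurable_continuous_onI)
  have bdd: "bounded {x. 0 \<le> h x}" by (rule compact_imp_bounded[OF proper])
  have path: "stopped_path X \<zeta> h \<omega>" if "\<omega> \<in> space M" for \<omega>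
  proof
    have "0 \<le> ereal (\<tau> 0 \<omega>)" "ereal (\<tau> 0 \<omega>) < \<zeta> \<omega>" using \<tau>(2)[OF that, of 0] by auto
    then show "0 < \<zeta> \<omega>" by (rule le_less_trans)
  qed (use Xc expl that h_cont bdd in auto)
  define E where "E = {\<omega>\<in>space M. 0 < stopped_inf h X (exit_time X \<zeta> (band h \<mu>)) \<omega>}"
  have E_ev: "E \<in> events"
  proof -
    \<comment> \<open>After the explosion time the values of \<open>X\<close> are arbitrary, even as
      functions of the outcome; setting them to 0 restores measurability without changing the
      rational criterion.\<close>
    define Y where "Y t \<omega> = (if ereal t < \<zeta> \<omega> then X t \<omega> else 0)" for t \<omega>
    have YM: "Y t \<in> borel_measurable M" if "0 \<le> t" for t
      using measurable_F_M[OF Xm[OF that]] by (simp add: Y_def[abs_def])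
    have \<zeta>M: "Measurable.pred M (\<lambda>\<omega>. ereal t < \<zeta> \<omega>)" if "0 \<le> t" for t
      using pred_F_M[OF \<zeta>m[OF that]] unfolding not_le[symmetric] by measurable
    have eq: "E = {\<omega>\<in>space M. \<exists>j::nat. \<forall>r::rat. 0 \<le> real_of_rat r \<longrightarrow> ereal (real_of_rat r) < \<zeta> \<omega> \<longrightarrow>
       1 / real (Suc j) \<le> h (Y (real_of_rat r) \<omega>) \<or>
       (\<exists>s::rat. 0 \<le> real_of_rat s \<and> real_of_rat s < real_of_rat r \<and> \<mu> < ereal (h (Y (real_of_rat s) \<omega>)))}"
    proof -
      have Y1: "ereal (real_of_rat r) < \<zeta> \<omega> \<Longrightarrow> Y (real_of_rat r) \<omega> = X (real_of_rat r) \<omega>" for r \<omega>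
        by (simp add: Y_def)
      have Y2: "ereal (real_of_rat r) < \<zeta> \<omega> \<Longrightarrow> real_of_rat s < real_of_rat r \<Longrightarrow> Y (real_of_rat s) \<omega> = X (real_of_rat s) \<omega>" for r s \<omega>
        unfolding Y_def by (metis less_ereal.simps(1) less_trans)
      show ?thesis
        unfolding E_def
      proof (intro Collect_cong conj_cong refl)
        fix \<omega> assume "\<omega> \<in> space M"
        from stopped_path.stopped_inf_pos_rational[OF path[OF this], of \<mu>]
        show "0 < stopped_inf h X (exit_time X \<zeta> (band h \<mu>)) \<omega> \<longleftrightarrow>
          (\<exists>j::nat. \<forall>r::rat. 0 \<le> real_of_rat r \<longrightarrow> ereal (real_of_rat r) < \<zeta> \<omega> \<longrightarrow>
             1 / real (Suc j) \<le> h (Y (real_of_rat r) \<omega>) \<or>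
             (\<exists>s::rat. 0 \<le> real_of_rat s \<and> real_of_rat s < real_of_rat r \<and> \<mu> < ereal (h (Y (real_of_rat s) \<omega>))))"
        proof (rule trans, intro ex_cong1 all_cong1 imp_cong disj_cong conj_cong refl)
          fix r s :: rat
          assume "ereal (real_of_rat r) < \<zeta> \<omega>"
          note r = this
          then show "1 / real (Suc j) \<le> h (X (real_of_rat r) \<omega>) \<longleftrightarrow> 1 / real (Suc j) \<le> h (Y (real_of_rat r) \<omega>)" for j
            by (simp only: Y1)
          assume "real_of_rat s < (real_of_rat r :: real)"
          then show "\<mu> < ereal (h (X (real_of_rat s) \<omega>)) \<longleftrightarrow> \<mu> < ereal (h (Y (real_of_rat s) \<omega>))"
            by (simp only: Y2[OF r])
        qed
      qed
    qed
    have m1: "Measurable.pred M (\<lambda>\<omega>. 0 \<le> real_of_rat r \<longrightarrow> ereal (real_of_rat r) < \<zeta> \<omega> \<longrightarrow>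
       1 / real (Suc j) \<le> h (Y (real_of_rat r) \<omega>) \<or>
       (\<exists>s::rat. 0 \<le> real_of_rat s \<and> real_of_rat s < real_of_rat r \<and> \<mu> < ereal (h (Y (real_of_rat s) \<omega>))))" for r :: rat and j :: nat
    proof (cases "0 \<le> real_of_rat r")
      case True
      have "Measurable.pred M (\<lambda>\<omega>. 0 \<le> real_of_rat s \<and> real_of_rat s < real_of_rat r \<and> \<mu> < ereal (h (Y (real_of_rat s) \<omega>)))" for s :: rat
      proof (cases "0 \<le> real_of_rat s")
        case True
        note [measurable] = YM[OF True]
        show ?thesis by measurable
      qed simp
      then have p2: "Measurable.pred M (\<lambda>\<omega>. \<exists>s::rat. 0 \<le> real_of_rat s \<and> real_of_rat s < real_of_rat r \<and> \<mu> < ereal (h (Y (real_of_rat s) \<omega>)))"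
        by (rule pred_intros_countable)
      have p1: "Measurable.pred M (\<lambda>\<omega>. 1 / real (Suc j) \<le> h (Y (real_of_rat r) \<omega>))"
        by (rule measurable_compose[OF YM[OF True], of "\<lambda>x. 1 / real (Suc j) \<le> h x"]) measurable
      have "Measurable.pred M (\<lambda>\<omega>. A \<omega> \<longrightarrow> B \<omega> \<or> C \<omega>)"
        if [measurable]: "Measurable.pred M A" "Measurable.pred M B" "Measurable.pred M C" for A B C by measurable
      from this[OF \<zeta>M[OF True] p1 p2] show ?thesis using True by (simp only: True_implies_equals simp_thms)
    qed simp
    then show ?thesis unfolding eq by (intro predE pred_intros_countable)
  qed
  have hx0: "0 < h x0" using x0 by (simp add: band_def)
  have main: "exp (- b * \<delta>) * prob (space M - E) \<le> exp (- b * h x0)" if \<delta>: "0 < \<delta>" "\<delta> < h x0" for \<delta>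
  proof -
    define S where "S = {x. \<delta> < h x \<and> ereal (h x) \<le> \<mu>}"
    define L where "L = {x. 0 \<le> h x \<and> h x \<le> \<delta>}"
    obtain U D Q where tf: "test_function U D Q" and U: "\<And>x. 0 \<le> h x \<Longrightarrow> U x = exp (- b * h x)"
      and D: "\<And>x. 0 \<le> h x \<Longrightarrow> D x = (- b * exp (- b * h x)) *\<^sub>R grad h x"
      and Q: "\<And>x. 0 \<le> h x \<Longrightarrow> Q x = (- b * exp (- b * h x)) *\<^sub>R hessian h x + (b\<^sup>2 * exp (- b * h x)) *\<^sub>R outer_square (grad h x)"
      using exp_test_function[OF C2 proper, of b] by blast
    have S_band: "x \<in> band h \<mu>" if "x \<in> S" for x using that \<delta> by (auto simp: S_def band_def)
    have gen: "D x \<bullet> ?a x + 1/2 * trace (transpose (\<sigma> x) ** Q x ** \<sigma> x) \<le> 0" if "x \<in> S" for x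
    proof -
      have "0 \<le> h x" using that \<delta> by (simp add: S_def)
      then show ?thesis 
        using generator_exp_nonpos[where f=f and g=g and u\<^sub>o=u\<^sub>o and \<phi>=\<phi> and x=x and \<sigma>=\<sigma> and h=h and b=b,
            OF b zcbf[OF S_band[OF that]] D Q] by simp
    qed
    have c: "exp (- b * \<delta>) \<le> U x" if "x \<in> L" for x using that b U by (simp add: L_def)
    have bS: "bounded S" by (rule bounded_subset[OF bdd]) (use \<delta> in \<open>auto simp: S_def\<close>)
    have SL: "S \<in> sets borel" "L \<in> sets borel" unfolding S_def L_def by measurable
    have LS: "L \<inter> S = {}" by (auto simp: L_def S_def)
    have cont: "continuous_on {0..\<tau> k \<omega>} (\<lambda>t. X t \<omega>)" if "\<omega> \<in> space M" for \<omega> k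
    proof (rule continuous_on_subset[OF Xc[OF that]])
      show "{0..\<tau> k \<omega>} \<subseteq> {t. 0 \<le> t \<and> ereal t < \<zeta> \<omega>}"
        using \<tau>(2)[OF that, of k] by (auto intro: le_less_trans[of _ "ereal (\<tau> k \<omega>)"])
    qed
    have meas: "(\<lambda>\<omega>. if t \<le> \<tau> k \<omega> then X t \<omega> else 0) \<in> borel_measurable (F t)" if t: "0 \<le> t" for t k
    proof -
      have "Measurable.pred (F t) (\<lambda>\<omega>. t \<le> \<tau> k \<omega>)"
        using stopping_time_less_const[OF \<tau>(1), of k t] unfolding not_less[symmetric] by measurable
      then have "(\<lambda>\<omega>. if t \<le> \<tau> k \<omega> then if ereal t < \<zeta> \<omega> then X t \<omega> else 0 else 0) \<in> borel_measurable (F t)"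
        by (intro measurable_If[OF Xm[OF t] borel_measurable_const]) (simp add: pred_def)
      moreover have "(if t \<le> \<tau> k \<omega> then if ereal t < \<zeta> \<omega> then X t \<omega> else 0 else 0) = (if t \<le> \<tau> k \<omega> then X t \<omega> else 0)"
        if "\<omega> \<in> space (F t)" for \<omega>
      proof -
        have "\<omega> \<in> space M" using that space_F by simp
        then show ?thesis using \<tau>(2)[of \<omega> k] le_less_trans[of "ereal t" "ereal (\<tau> k \<omega>)" "\<zeta> \<omega>"] by auto
      qed
      ultimately show ?thesis by (simp cong: measurable_cong)
    qed
    have \<tau>0: "0 \<le> \<tau> k \<omega>" if "\<omega> \<in> space M" for \<omega> k using \<tau>(2)[OF that] by blast
    note est = hit_estimate[OF tf drift_cont \<sigma>_cont \<tau>(1) \<tau>0 cont meas ito bS SL LS gen exp_ge_zero c]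
    \<comment> \<open>The index \<open>k\<close> plays two roles, as the time horizon and as the
      number of the announcing stopping time, so one limit in \<open>k\<close> handles both.\<close>
    define hit where "hit k n = {\<omega>\<in>space M. \<exists>l\<le>k * 2 ^ n. real l / 2 ^ n \<le> \<tau> k \<omega> \<and> X (real l / 2 ^ n) \<omega> \<in> L \<and>
        (\<forall>m<l. X (real m / 2 ^ n) \<omega> \<in> S)}" for k n
    have hit_ev: "hit k n \<in> events" for k n unfolding hit_def by (rule est(1)[of k])
    \<comment> \<open>The outcomes seen by all sufficiently fine grids, for fixed
      \<open>k\<close>.\<close>
    define hits where "hits k = (\<Union>N. \<Inter>n\<in>{N..}. hit k n)" for k
    have hits_ev: "hits k \<in> events" for k unfolding hits_def using hit_ev by (intro sets.countable_UN sets.countable_INT') auto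
    have U0: "U x0 = exp (- b * h x0)" using U hx0 by simp
    have hits_le: "exp (- b * \<delta>) * prob (hits k) \<le> exp (- b * h x0)" for k
    proof (rule prob_le_if_eventually_in[of _ "hit k"])
      show "AE \<omega> in M. \<omega> \<in> hits k \<longrightarrow> (\<forall>\<^sub>F n in sequentially. \<omega> \<in> hit k n)"
        by (auto simp: hits_def eventually_sequentially intro!: AE_I2)
      show "\<forall>\<^sub>F n in sequentially. exp (- b * \<delta>) * prob (hit k n) \<le> exp (- b * h x0) + e" if "0 < e" for e
        using est(2)[OF _ _ _ _ _ _ that, of k k] unfolding hit_def U0 by simp
    qed (use hits_ev hit_ev in auto)
    show ?thesis
    proof (rule prob_le_if_eventually_in[of _ hits])
      show "AE \<omega> in M. \<omega> \<in> space M - E \<longrightarrow> (\<forall>\<^sub>F k in sequentially. \<omega> \<in> hits k)"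
        using X0
      proof eventually_elim
        case (elim \<omega>)
        show ?case
        proof
          assume \<omega>: "\<omega> \<in> space M - E"
          interpret stopped_path X \<zeta> h \<mu> \<omega> using path \<omega> by simp
          obtain t where t: "0 \<le> t" "ereal t < \<zeta> \<omega>" "h (X t \<omega>) < \<delta>" "\<And>s. 0 \<le> s \<Longrightarrow> s \<le> t \<Longrightarrow> ereal (h (X s \<omega>)) \<le> \<mu>"
            using not_stopped_inf_pos[of \<delta>] \<omega> elim x0 \<delta>(1) unfolding E_def by auto
          \<comment> \<open>The time \<open>t\<close> of the low value precedes the explosion, so
            late announcing times pass it, as does the horizon.\<close>
          have "\<forall>\<^sub>F k in sequentially. ereal t < ereal (\<tau> k \<omega>)"
            using \<tau>(3)[of \<omega>] \<omega> t(2) by (intro order_tendstoD(1)) auto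
          moreover have "\<forall>\<^sub>F k in sequentially. t \<le> real k"
            using eventually_ge_at_top[of "nat \<lceil>t\<rceil>"] by eventually_elim linarith
          ultimately show "\<forall>\<^sub>F k in sequentially. \<omega> \<in> hits k"
          proof eventually_elim
            case (elim k)
            have x0\<delta>: "\<delta> < h (X 0 \<omega>)" using \<open>X 0 \<omega> = x0\<close> \<delta>(2) by simp
            have "\<forall>\<^sub>F n in sequentially. \<omega> \<in> hit k n"
            proof (rule eventually_mono)
              show "\<forall>\<^sub>F n in sequentially. \<exists>l\<le>k * 2 ^ n. real l / 2 ^ n \<le> t \<and> X (real l / 2 ^ n) \<omega> \<in> {x. 0 \<le> h x \<and> h x \<le> \<delta>} \<and>
                (\<forall>m<l. X (real m / 2 ^ n) \<omega> \<in> {x. \<delta> < h x \<and> ereal (h x) \<le> \<mu>})"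
                by (rule eventually_hits_on_grid[OF t(1-3) _ x0\<delta> \<delta>(1) elim(2)]) (rule t(4))
              fix n
              assume "\<exists>l\<le>k * 2 ^ n. real l / 2 ^ n \<le> t \<and> X (real l / 2 ^ n) \<omega> \<in> {x. 0 \<le> h x \<and> h x \<le> \<delta>} \<and>
                (\<forall>m<l. X (real m / 2 ^ n) \<omega> \<in> {x. \<delta> < h x \<and> ereal (h x) \<le> \<mu>})"
              then obtain l where "l \<le> k * 2 ^ n" "real l / 2 ^ n \<le> t" "X (real l / 2 ^ n) \<omega> \<in> L" "\<forall>m<l. X (real m / 2 ^ n) \<omega> \<in> S"
                unfolding L_def S_def by blast
              then show "\<omega> \<in> hit k n" using \<omega> elim(1) unfolding hit_def by (auto intro!: exI[of _ l])
            qed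
            then show ?case by (auto simp: hits_def eventually_sequentially)
          qed
        qed
      qed
      show "\<forall>\<^sub>F k in sequentially. exp (- b * \<delta>) * prob (hits k) \<le> exp (- b * h x0) + e" if "0 < e" for e
        using hits_le that by (intro always_eventually allI) (simp add: add_increasing2)
    qed (use hits_ev E_ev in auto)
  qed
  \<comment> \<open>The failure event does not depend on \<delta>, so letting \<delta> tend to 0
    from above removes the factor in front.\<close>
  have "((\<lambda>\<delta>. exp (- b * \<delta>) * prob (space M - E)) \<longlongrightarrow> exp (- b * 0) * prob (space M - E)) (at_right 0)"
    by (intro tendsto_intros)
  then have "exp (- b * 0) * prob (space M - E) \<le> exp (- b * h x0)"
  proof (rule tendsto_upperbound)
    show "\<forall>\<^sub>F \<delta> in at_right 0. exp (- b * \<delta>) * prob (space M - E) \<le> exp (- b * h x0)"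
      using eventually_at_right_real[OF hx0] by eventually_elim (use main in auto)
  qed simp
  then have "prob (space M - E) \<le> exp (- b * h x0)" by simp
  then show ?thesis using prob_compl[OF E_ev] unfolding E_def by simp
qed

end

theorem theorem4:
  fixes f :: "real^'n \<Rightarrow> real^'n"
    and g :: "real^'n \<Rightarrow> real^'m^'n"
    and \<sigma> :: "real^'n \<Rightarrow> real^'d^'n"
    and u\<^sub>o \<phi> :: "real^'n \<Rightarrow> real^'m"
    and h :: "real^'n \<Rightarrow> real"
    and Chi :: "(real^'n) set"
    and \<mu> b :: real
    and M :: "'a measure"
    and F :: "real \<Rightarrow> 'a measure"
    and W :: "real \<Rightarrow> 'a \<Rightarrow> real^'d"
  assumes wiener: "wiener_process M F W"
    and f_lip: "local_lipschitz (UNIV :: real set) UNIV (\<lambda>_. f)"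
    and g_lip: "local_lipschitz (UNIV :: real set) UNIV (\<lambda>_. g)"
    and \<sigma>_lip: "local_lipschitz (UNIV :: real set) UNIV (\<lambda>_. \<sigma>)"
    and uo_cont: "continuous_on UNIV u\<^sub>o"
    and Chi_open: "open Chi"
    and Z1: "C2 h"
    and Z2: "\<And>L. compact {x. h x \<ge> L}"
    and Z3: "Chi = {x. h x > 0}" "frontier Chi = {x. h x = 0}"
    and \<mu>_pos: "\<mu> > 0"
    and zcbf: "stochastic_ZCBF_with f g \<sigma> u\<^sub>o h \<mu> \<phi> b"
  shows "transiently_safe M F W (closed_loop_drift f g u\<^sub>o \<phi>) \<sigma> h \<mu> (\<lambda>x0. 1 - exp (- b * h x0)) \<and>
    ((\<forall>\<mu>'>0. stochastic_ZCBF_with f g \<sigma> u\<^sub>o h \<mu>' \<phi> b) \<longrightarrow>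
       safe M F W (closed_loop_drift f g u\<^sub>o \<phi>) \<sigma> h Chi (\<lambda>x0. 1 - exp (- b * h x0)))"
proof -
  interpret wiener_process M F W by (rule wiener)
  have \<phi>_cont: "continuous_on UNIV \<phi>" and b: "0 < b" using zcbf by (auto simp: stochastic_ZCBF_with_def)
  have lip: "continuous_on UNIV f" "continuous_on UNIV g" "continuous_on UNIV \<sigma>"
    using local_lipschitz_continuous_on[OF f_lip] local_lipschitz_continuous_on[OF g_lip]
      local_lipschitz_continuous_on[OF \<sigma>_lip] by auto
  have drift: "continuous_on UNIV (closed_loop_drift f g u\<^sub>o \<phi>)"
    unfolding closed_loop_drift_def[abs_def] matrix_vector_mult_def
    by (intro continuous_intros lip uo_cont \<phi>_cont)
  have bands: "chi_mu h \<mu> = band h (ereal \<mu>)" "Chi = band h \<infinity>"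
    unfolding Z3 by (auto simp: chi_mu_def band_def)
  note stay = maximal_solution_stays_positive[OF _ drift lip(3) Z1 Z2 b]
  show ?thesis
  proof (intro conjI impI)
    show "transiently_safe M F W (closed_loop_drift f g u\<^sub>o \<phi>) \<sigma> h \<mu> (\<lambda>x0. 1 - exp (- b * h x0))"
      unfolding transiently_safe_def bands
    proof (intro ballI allI impI stay)
      show "b * H_op \<sigma> h x \<le> generator f g \<sigma> (\<phi> x) (u\<^sub>o x) h x" if "x \<in> band h (ereal \<mu>)" for x
        using zcbf that by (simp add: stochastic_ZCBF_with_def band_def)
    qed
  next
    assume all: "\<forall>\<mu>'>0. stochastic_ZCBF_with f g \<sigma> u\<^sub>o h \<mu>' \<phi> b"
    show "safe M F W (closed_loop_drift f g u\<^sub>o \<phi>) \<sigma> h Chi (\<lambda>x0. 1 - exp (- b * h x0))"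
      unfolding safe_def bands
    proof (intro ballI allI impI stay)
      \<comment> \<open>The inequality at \<open>x\<close> comes from the hypothesis at the level
        \<open>h x\<close>, which is positive in the band.\<close>
      show "b * H_op \<sigma> h x \<le> generator f g \<sigma> (\<phi> x) (u\<^sub>o x) h x" if "x \<in> band h \<infinity>" for x
        using all[rule_format, of "h x"] that by (simp add: stochastic_ZCBF_with_def band_def)
    qed
  qed
qed

end
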